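(* Let $(M,h,J)$ be a connected, smooth nearly Kähler manifold of real dimension $6$ whose almost complex structure $J$ is not integrable (i.e. the Nijenhuis tensor of $J$ does not vanish identically on $M$). Then $J$ is not compatible with any symplectic form, even locally: for every non-empty open subset $U\subseteq M$ there is no symplectic form $\omega$ on $U$ with which $J|_U$ is compatible.
   Context: An almost complex structure $J$ on a smooth manifold $M$ is a smooth endomorphism field of the tangent bundle with $J^2=-\mathrm{Id}$. A symplectic form is a closed, non-degenerate smooth $2$-form. An almost complex structure $J$ is compatible with a symplectic form $\omega$ (also: $J$ is $\omega$-compatible) if the bilinear form $g(\cdot,\cdot)=\omega(\cdot,J\cdot)$ is symmetric and positive-definite, i.e. is a Riemannian metric. An almost Hermitian structure $(h,J)$ on $M$ consists of an almost complex structure $J$ and a Riemannian metric $h$ with $h(J\cdot,J\cdot)=h(\cdot,\cdot)$; its fundamental $2$-form is $F(\cdot,\cdot)=h(J\cdot,\cdot)$. The structure $(h,J)$ is nearly Kähler if $D^hF=\frac13 dF$, where $D^h$ is the Levi-Civita connection of $h$ (with the convention that $dF(X,Y,Z)$ is the cyclic sum over $X,Y,Z$ of $(D^h_XF)(Y,Z)$). The Nijenhuis tensor $N$ of $J$ is defined by $4N(X,Y)=[JX,JY]-J[JX,Y]-J[X,JY]-[X,Y]$; $J$ is integrable if and only if $N\equiv 0$. *)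

theory Defs
  imports "HOL-Analysis.Analysis"
begin

text \<open>For open \<open>S\<close> and a finite-dimensional domain this is the usual class \<open>C\<^sup>k\<close>.\<close>

fun Ck_on :: "nat \<Rightarrow> 'e::real_normed_vector set \<Rightarrow> ('e \<Rightarrow> 'f::real_normed_vector) \<Rightarrow> bool" where
  "Ck_on 0 S f \<longleftrightarrow> continuous_on S f"
| "Ck_on (Suc k) S f \<longleftrightarrow> (\<forall>x\<in>S. f differentiable (at x)) \<and>
     (\<forall>v. Ck_on k S (\<lambda>x. frechet_derivative f (at x) v))"

definition smooth_on :: "'e::real_normed_vector set \<Rightarrow> ('e \<Rightarrow> 'f::real_normed_vector) \<Rightarrow> bool" where
  "smooth_on S f \<longleftrightarrow> (\<forall>k. Ck_on k S f)"

text \<open>A chart is a pair \<open>(U, \<phi>)\<close>; the values of \<open>\<phi>\<close> outside \<open>U\<close> are irrelevant. The atlas is not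
  required to be maximal, since every atlas determines the smooth structure.\<close>

type_synonym ('a, 'e) atlas = "('a set \<times> ('a \<Rightarrow> 'e)) set"

definition smooth_manifold :: "'a topology \<Rightarrow> ('a, 'e::euclidean_space) atlas \<Rightarrow> bool" where
  "smooth_manifold M A \<longleftrightarrow>
     Hausdorff_space M \<and> second_countable M \<and>
     (\<forall>(U, \<phi>)\<in>A. openin M U \<and> open (\<phi> ` U) \<and>
        homeomorphic_map (subtopology M U) (top_of_set (\<phi> ` U)) \<phi>) \<and>
     (\<Union>(U, \<phi>)\<in>A. U) = topspace M \<and>
     (\<forall>(U, \<phi>)\<in>A. \<forall>(V, \<psi>)\<in>A. smooth_on (\<phi> ` (U \<inter> V)) (\<psi> \<circ> inv_into U \<phi>))"

definition smooth_fun_on ::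
    "'a topology \<Rightarrow> ('a, 'e::euclidean_space) atlas \<Rightarrow> 'a set \<Rightarrow> ('a \<Rightarrow> real) \<Rightarrow> bool" where
  "smooth_fun_on M A W f \<longleftrightarrow>
     openin M W \<and> (\<forall>(U, \<phi>)\<in>A. smooth_on (\<phi> ` (U \<inter> W)) (f \<circ> inv_into U \<phi>))"

definition smooth_near ::
    "'a topology \<Rightarrow> ('a, 'e::euclidean_space) atlas \<Rightarrow> 'a \<Rightarrow> ('a \<Rightarrow> real) \<Rightarrow> bool" where
  "smooth_near M A p f \<longleftrightarrow> (\<exists>W. p \<in> W \<and> smooth_fun_on M A W f)"

text \<open>A tangent vector at \<open>p\<close> is a derivation at \<open>p\<close> on the functions that are smooth near \<open>p\<close>.
  Such a derivation depends only on the germ of its argument: if \<open>f = g\<close> on an open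
  neighbourhood of \<open>p\<close>, apply the Leibniz rule to \<open>f - g\<close> times the indicator function of that
  neighbourhood. Setting the value to \<open>0\<close> on all other functions makes two tangent vectors equal
  as HOL functions iff they agree as derivations.\<close>

type_synonym 'a tvec = "('a \<Rightarrow> real) \<Rightarrow> real"

definition tangent_space ::
    "'a topology \<Rightarrow> ('a, 'e::euclidean_space) atlas \<Rightarrow> 'a \<Rightarrow> 'a tvec set" where
  "tangent_space M A p = {v.
     (\<forall>f g. smooth_near M A p f \<and> smooth_near M A p g \<longrightarrow>
        (\<forall>a b. v (\<lambda>q. a * f q + b * g q) = a * v f + b * v g) \<and>
        v (\<lambda>q. f q * g q) = f p * v g + g p * v f) \<and>
     (\<forall>f. \<not> smooth_near M A p f \<longrightarrow> v f = 0)}"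

definition tcomb :: "real \<Rightarrow> 'a tvec \<Rightarrow> real \<Rightarrow> 'a tvec \<Rightarrow> 'a tvec" where
  "tcomb a v b w = (\<lambda>f. a * v f + b * w f)"

definition tzero :: "'a tvec" where
  "tzero = (\<lambda>f. 0)"

text \<open>Fields are total functions on the type \<open>'a\<close>; only their values on the open set under
  consideration matter. This also makes restriction to an open subset implicit.\<close>

definition smooth_vector_field ::
    "'a topology \<Rightarrow> ('a, 'e::euclidean_space) atlas \<Rightarrow> 'a set \<Rightarrow> ('a \<Rightarrow> 'a tvec) \<Rightarrow> bool" where
  "smooth_vector_field M A U X \<longleftrightarrow>
     openin M U \<and> (\<forall>p\<in>U. X p \<in> tangent_space M A p) \<and>
     (\<forall>W f. W \<subseteq> U \<and> smooth_fun_on M A W f \<longrightarrow> smooth_fun_on M A W (\<lambda>p. X p f))"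

definition lie_bracket ::
    "'a topology \<Rightarrow> ('a, 'e::euclidean_space) atlas \<Rightarrow>
     ('a \<Rightarrow> 'a tvec) \<Rightarrow> ('a \<Rightarrow> 'a tvec) \<Rightarrow> 'a \<Rightarrow> 'a tvec" where
  "lie_bracket M A X Y p =
     (\<lambda>f. if smooth_near M A p f then X p (\<lambda>q. Y q f) - Y p (\<lambda>q. X q f) else 0)"

definition smooth_endomorphism_field ::
    "'a topology \<Rightarrow> ('a, 'e::euclidean_space) atlas \<Rightarrow> 'a set \<Rightarrow>
     ('a \<Rightarrow> 'a tvec \<Rightarrow> 'a tvec) \<Rightarrow> bool" where
  "smooth_endomorphism_field M A U J \<longleftrightarrow>
     openin M U \<and>
     (\<forall>p\<in>U. \<forall>v\<in>tangent_space M A p. J p v \<in> tangent_space M A p \<and>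
        (\<forall>w\<in>tangent_space M A p. \<forall>a b. J p (tcomb a v b w) = tcomb a (J p v) b (J p w))) \<and>
     (\<forall>W X. W \<subseteq> U \<and> smooth_vector_field M A W X \<longrightarrow>
        smooth_vector_field M A W (\<lambda>p. J p (X p)))"

definition smooth_bilinear_field ::
    "'a topology \<Rightarrow> ('a, 'e::euclidean_space) atlas \<Rightarrow> 'a set \<Rightarrow>
     ('a \<Rightarrow> 'a tvec \<Rightarrow> 'a tvec \<Rightarrow> real) \<Rightarrow> bool" where
  "smooth_bilinear_field M A U B \<longleftrightarrow>
     openin M U \<and>
     (\<forall>p\<in>U. \<forall>u\<in>tangent_space M A p. \<forall>v\<in>tangent_space M A p. \<forall>w\<in>tangent_space M A p. \<forall>a b.
        B p (tcomb a u b v) w = a * B p u w + b * B p v w \<and>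
        B p w (tcomb a u b v) = a * B p w u + b * B p w v) \<and>
     (\<forall>W X Y. W \<subseteq> U \<and> smooth_vector_field M A W X \<and> smooth_vector_field M A W Y \<longrightarrow>
        smooth_fun_on M A W (\<lambda>p. B p (X p) (Y p)))"

definition riemannian_metric ::
    "'a topology \<Rightarrow> ('a, 'e::euclidean_space) atlas \<Rightarrow> 'a set \<Rightarrow>
     ('a \<Rightarrow> 'a tvec \<Rightarrow> 'a tvec \<Rightarrow> real) \<Rightarrow> bool" where
  "riemannian_metric M A U g \<longleftrightarrow>
     smooth_bilinear_field M A U g \<and>
     (\<forall>p\<in>U. \<forall>v\<in>tangent_space M A p. \<forall>w\<in>tangent_space M A p. g p v w = g p w v) \<and>
     (\<forall>p\<in>U. \<forall>v\<in>tangent_space M A p. v \<noteq> tzero \<longrightarrow> 0 < g p v v)"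

definition smooth_two_form ::
    "'a topology \<Rightarrow> ('a, 'e::euclidean_space) atlas \<Rightarrow> 'a set \<Rightarrow>
     ('a \<Rightarrow> 'a tvec \<Rightarrow> 'a tvec \<Rightarrow> real) \<Rightarrow> bool" where
  "smooth_two_form M A U \<omega> \<longleftrightarrow>
     smooth_bilinear_field M A U \<omega> \<and> (\<forall>p\<in>U. \<forall>v\<in>tangent_space M A p. \<omega> p v v = 0)"

text \<open>The normalisation without a factor \<open>1/3\<close>, so that \<open>d\<omega>(X,Y,Z)\<close> is the cyclic sum of
  \<open>(D\<^sub>X\<omega>)(Y,Z)\<close> for every torsion-free connection \<open>D\<close>.\<close>

definition ext_deriv ::
    "'a topology \<Rightarrow> ('a, 'e::euclidean_space) atlas \<Rightarrow> ('a \<Rightarrow> 'a tvec \<Rightarrow> 'a tvec \<Rightarrow> real) \<Rightarrow>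
     ('a \<Rightarrow> 'a tvec) \<Rightarrow> ('a \<Rightarrow> 'a tvec) \<Rightarrow> ('a \<Rightarrow> 'a tvec) \<Rightarrow> 'a \<Rightarrow> real" where
  "ext_deriv M A \<omega> X Y Z p =
     X p (\<lambda>q. \<omega> q (Y q) (Z q)) + Y p (\<lambda>q. \<omega> q (Z q) (X q)) + Z p (\<lambda>q. \<omega> q (X q) (Y q))
     - \<omega> p (lie_bracket M A X Y p) (Z p)
     - \<omega> p (lie_bracket M A Y Z p) (X p)
     - \<omega> p (lie_bracket M A Z X p) (Y p)"

definition closed_two_form ::
    "'a topology \<Rightarrow> ('a, 'e::euclidean_space) atlas \<Rightarrow> 'a set \<Rightarrow>
     ('a \<Rightarrow> 'a tvec \<Rightarrow> 'a tvec \<Rightarrow> real) \<Rightarrow> bool" where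
  "closed_two_form M A U \<omega> \<longleftrightarrow>
     smooth_two_form M A U \<omega> \<and>
     (\<forall>W X Y Z. W \<subseteq> U \<and> smooth_vector_field M A W X \<and> smooth_vector_field M A W Y \<and>
        smooth_vector_field M A W Z \<longrightarrow> (\<forall>p\<in>W. ext_deriv M A \<omega> X Y Z p = 0))"

definition symplectic_form ::
    "'a topology \<Rightarrow> ('a, 'e::euclidean_space) atlas \<Rightarrow> 'a set \<Rightarrow>
     ('a \<Rightarrow> 'a tvec \<Rightarrow> 'a tvec \<Rightarrow> real) \<Rightarrow> bool" where
  "symplectic_form M A U \<omega> \<longleftrightarrow>
     closed_two_form M A U \<omega> \<and>
     (\<forall>p\<in>U. \<forall>v\<in>tangent_space M A p. (\<forall>w\<in>tangent_space M A p. \<omega> p v w = 0) \<longrightarrow> v = tzero)"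

definition almost_complex_structure ::
    "'a topology \<Rightarrow> ('a, 'e::euclidean_space) atlas \<Rightarrow> ('a \<Rightarrow> 'a tvec \<Rightarrow> 'a tvec) \<Rightarrow> bool" where
  "almost_complex_structure M A J \<longleftrightarrow>
     smooth_endomorphism_field M A (topspace M) J \<and>
     (\<forall>p\<in>topspace M. \<forall>v\<in>tangent_space M A p. J p (J p v) = (\<lambda>f. - v f))"

definition compatible_on ::
    "'a topology \<Rightarrow> ('a, 'e::euclidean_space) atlas \<Rightarrow> 'a set \<Rightarrow>
     ('a \<Rightarrow> 'a tvec \<Rightarrow> 'a tvec) \<Rightarrow> ('a \<Rightarrow> 'a tvec \<Rightarrow> 'a tvec \<Rightarrow> real) \<Rightarrow> bool" where
  "compatible_on M A U J \<omega> \<longleftrightarrow> riemannian_metric M A U (\<lambda>p v w. \<omega> p v (J p w))"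

definition nijenhuis ::
    "'a topology \<Rightarrow> ('a, 'e::euclidean_space) atlas \<Rightarrow> ('a \<Rightarrow> 'a tvec \<Rightarrow> 'a tvec) \<Rightarrow>
     ('a \<Rightarrow> 'a tvec) \<Rightarrow> ('a \<Rightarrow> 'a tvec) \<Rightarrow> 'a \<Rightarrow> 'a tvec" where
  "nijenhuis M A J X Y p =
     (let JX = (\<lambda>q. J q (X q)); JY = (\<lambda>q. J q (Y q)) in
      (\<lambda>f. (lie_bracket M A JX JY p f
            - J p (lie_bracket M A JX Y p) f
            - J p (lie_bracket M A X JY p) f
            - lie_bracket M A X Y p f) / 4))"

definition integrable_acs ::
    "'a topology \<Rightarrow> ('a, 'e::euclidean_space) atlas \<Rightarrow> ('a \<Rightarrow> 'a tvec \<Rightarrow> 'a tvec) \<Rightarrow> bool" where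
  "integrable_acs M A J \<longleftrightarrow>
     (\<forall>W X Y. smooth_vector_field M A W X \<and> smooth_vector_field M A W Y \<longrightarrow>
        (\<forall>p\<in>W. nijenhuis M A J X Y p = tzero))"

text \<open>A connection is given by its action on vector fields over arbitrary open subsets, which is
  how a connection on \<open>M\<close>, being a local operator, acts.\<close>

definition affine_connection ::
    "'a topology \<Rightarrow> ('a, 'e::euclidean_space) atlas \<Rightarrow>
     (('a \<Rightarrow> 'a tvec) \<Rightarrow> ('a \<Rightarrow> 'a tvec) \<Rightarrow> 'a \<Rightarrow> 'a tvec) \<Rightarrow> bool" where
  "affine_connection M A D \<longleftrightarrow>
     (\<forall>W X Y. smooth_vector_field M A W X \<and> smooth_vector_field M A W Y \<longrightarrow>
        smooth_vector_field M A W (D X Y) \<and>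
        (\<forall>X'. smooth_vector_field M A W X' \<longrightarrow>
           (\<forall>p\<in>W. D (\<lambda>q. tcomb 1 (X q) 1 (X' q)) Y p = tcomb 1 (D X Y p) 1 (D X' Y p))) \<and>
        (\<forall>Y'. smooth_vector_field M A W Y' \<longrightarrow>
           (\<forall>p\<in>W. D X (\<lambda>q. tcomb 1 (Y q) 1 (Y' q)) p = tcomb 1 (D X Y p) 1 (D X Y' p))) \<and>
        (\<forall>u. smooth_fun_on M A W u \<longrightarrow>
           (\<forall>p\<in>W. D (\<lambda>q f. u q * X q f) Y p = (\<lambda>f. u p * D X Y p f) \<and>
                  D X (\<lambda>q f. u q * Y q f) p = tcomb (X p u) (Y p) (u p) (D X Y p))))"

definition levi_civita ::
    "'a topology \<Rightarrow> ('a, 'e::euclidean_space) atlas \<Rightarrow> ('a \<Rightarrow> 'a tvec \<Rightarrow> 'a tvec \<Rightarrow> real) \<Rightarrow>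
     (('a \<Rightarrow> 'a tvec) \<Rightarrow> ('a \<Rightarrow> 'a tvec) \<Rightarrow> 'a \<Rightarrow> 'a tvec) \<Rightarrow> bool" where
  "levi_civita M A h D \<longleftrightarrow>
     affine_connection M A D \<and>
     (\<forall>W X Y Z. smooth_vector_field M A W X \<and> smooth_vector_field M A W Y \<and>
        smooth_vector_field M A W Z \<longrightarrow>
        (\<forall>p\<in>W. tcomb 1 (D X Y p) (-1) (D Y X p) = lie_bracket M A X Y p \<and>
               X p (\<lambda>q. h q (Y q) (Z q)) = h p (D X Y p) (Z p) + h p (Y p) (D X Z p)))"

definition cov_deriv ::
    "(('a \<Rightarrow> 'a tvec) \<Rightarrow> ('a \<Rightarrow> 'a tvec) \<Rightarrow> 'a \<Rightarrow> 'a tvec) \<Rightarrow>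
     ('a \<Rightarrow> 'a tvec \<Rightarrow> 'a tvec \<Rightarrow> real) \<Rightarrow>
     ('a \<Rightarrow> 'a tvec) \<Rightarrow> ('a \<Rightarrow> 'a tvec) \<Rightarrow> ('a \<Rightarrow> 'a tvec) \<Rightarrow> 'a \<Rightarrow> real" where
  "cov_deriv D B X Y Z p =
     X p (\<lambda>q. B q (Y q) (Z q)) - B p (D X Y p) (Z p) - B p (Y p) (D X Z p)"

definition almost_hermitian ::
    "'a topology \<Rightarrow> ('a, 'e::euclidean_space) atlas \<Rightarrow> ('a \<Rightarrow> 'a tvec \<Rightarrow> 'a tvec \<Rightarrow> real) \<Rightarrow>
     ('a \<Rightarrow> 'a tvec \<Rightarrow> 'a tvec) \<Rightarrow> bool" where
  "almost_hermitian M A h J \<longleftrightarrow>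
     almost_complex_structure M A J \<and> riemannian_metric M A (topspace M) h \<and>
     (\<forall>p\<in>topspace M. \<forall>v\<in>tangent_space M A p. \<forall>w\<in>tangent_space M A p.
        h p (J p v) (J p w) = h p v w)"

definition fundamental_form ::
    "('a \<Rightarrow> 'a tvec \<Rightarrow> 'a tvec \<Rightarrow> real) \<Rightarrow> ('a \<Rightarrow> 'a tvec \<Rightarrow> 'a tvec) \<Rightarrow>
     'a \<Rightarrow> 'a tvec \<Rightarrow> 'a tvec \<Rightarrow> real" where
  "fundamental_form h J = (\<lambda>p v w. h p (J p v) w)"

text \<open>The existential quantifier only names the Levi-Civita connection, which exists and is
  unique on \<open>M\<close>.\<close>

definition nearly_kaehler ::
    "'a topology \<Rightarrow> ('a, 'e::euclidean_space) atlas \<Rightarrow> ('a \<Rightarrow> 'a tvec \<Rightarrow> 'a tvec \<Rightarrow> real) \<Rightarrow>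
     ('a \<Rightarrow> 'a tvec \<Rightarrow> 'a tvec) \<Rightarrow> bool" where
  "nearly_kaehler M A h J \<longleftrightarrow>
     almost_hermitian M A h J \<and>
     (\<exists>D. levi_civita M A h D \<and>
        (\<forall>W X Y Z. smooth_vector_field M A W X \<and> smooth_vector_field M A W Y \<and>
           smooth_vector_field M A W Z \<longrightarrow>
           (\<forall>p\<in>W. cov_deriv D (fundamental_form h J) X Y Z p =
                  (1/3) * ext_deriv M A (fundamental_form h J) X Y Z p)))"

end

theory Submission
  imports Defs "HOL-Library.Function_Algebras"
begin

text \<open>
  The canonical Hermitian connection \<open>\<nabla>\<^sub>X Y = 1/2 (D\<^sub>X Y - J D\<^sub>X (J Y))\<close> of a nearly Kaehler
  structure is metric, makes \<open>J\<close> parallel, and has torsion \<open>N\<close>, where \<open>h(N(X,Y),Z)\<close> is totally skew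
  and \<open>N(JX,Y) = -J N(X,Y)\<close>. Separating the first Bianchi identity of \<open>\<nabla>\<close> by complex type gives
  \<open>\<nabla>N = 0\<close> (Kirichenko). In a coordinate frame this is a linear differential system for the
  components of \<open>N\<close>, so on a connected manifold \<open>N\<close> vanishes everywhere as soon as it vanishes at
  one point.

  On the other hand a \<open>J\<close>-compatible symplectic form \<open>\<omega>\<close> has type \<open>(1,1)\<close>, so the part of
  \<open>d\<omega> = 0\<close> of type \<open>(3,0) + (0,3)\<close> says that the cyclic sum of \<open>\<omega>(N(X,Y),Z)\<close> is zero. Suppose
  \<open>N(X,Y) \<noteq> 0\<close> with \<open>Y\<close> orthogonal to \<open>X\<close> and \<open>JX\<close>, and put \<open>Z = J N(X,Y)\<close>. In real dimension 6
  total skewness forces \<open>N(Y,Z)\<close> and \<open>N(Z,X)\<close> to be negative multiples of \<open>JX\<close> and \<open>JY\<close>, and then the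
  cyclic sum is a positive combination of \<open>\<omega>(Z,JZ)\<close>, \<open>\<omega>(X,JX)\<close> and \<open>\<omega>(Y,JY)\<close>, which is absurd. So
  \<open>N\<close> vanishes wherever such an \<open>\<omega>\<close> exists.
\<close>

section \<open>Functions of class \<open>C\<^sup>k\<close>\<close>

text \<open>The obstacle is that the Nijenhuis tensor and the connection act on vector fields over
  open sets, and field identities hold only on such a set. The calculus of \<open>\<nabla>\<close>
  is therefore carried out in an abstract real vector space with a metric, \<open>J\<close> and
  \<open>D\<close> (\<open>nearly_kaehler_module\<close>), whose model is the space of fields on
  \<open>W\<close> extended by zero; values at a point return through a coordinate frame. The nearly
  Kaehler condition enters the algebra as one symmetry: the covariant derivative of the fundamental
  form equals a third of \<open>ext_deriv\<close>, whose formula is invariant under cyclic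
  permutation, so \<open>h((D_X J)Y, Z)\<close> is cyclic. As \<open>D\<close> is metric, that
  expression is also skew in \<open>Y\<close> and \<open>Z\<close>, hence totally skew. Complex
  types are never introduced as such: restricting an identity to a type means adding up instances of
  the real identity with \<open>J\<close> inserted in an even number of slots, eight of them for the
  Bianchi identity and four for \<open>d\<omega>\<close>. Dimension six enters where
  \<open>X, JX, Y, JY, Z, JZ\<close> has to exhaust the tangent space; the analysis amounts to
  Hadamard's lemma and a Gronwall estimate along segments in a chart.\<close>

lemma Ck_on_cong:
  assumes "open S" "\<And>x. x \<in> S \<Longrightarrow> f x = g x"
  shows "Ck_on k S f \<longleftrightarrow> Ck_on k S g"
  using assms(2)
proof (induction k arbitrary: f g)
  case 0
  then show ?case by (auto cong: continuous_on_cong)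
next
  case (Suc k)
  have ev: "(f has_derivative D) (at x) \<longleftrightarrow> (g has_derivative D) (at x)" if "x \<in> S" for x D
    using Suc.prems that assms(1)
    by (metis has_derivative_transform_within_open)
  then have 1: "f differentiable at x \<longleftrightarrow> g differentiable at x" if "x \<in> S" for x
    using that by (simp add: differentiable_def)
  have "frechet_derivative f (at x) = frechet_derivative g (at x)" if "x \<in> S" for x
    using ev[OF that] by (simp add: frechet_derivative_def)
  then have "Ck_on k S (\<lambda>x. frechet_derivative f (at x) v) \<longleftrightarrow> Ck_on k S (\<lambda>x. frechet_derivative g (at x) v)" for v
    by (intro Suc.IH) simp
  with 1 show ?case by auto
qed

lemma Ck_on_subset: "Ck_on k S f \<Longrightarrow> T \<subseteq> S \<Longrightarrow> Ck_on k T f"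
  by (induction k arbitrary: f) (auto intro: continuous_on_subset)

lemma Ck_on_SucD: "Ck_on (Suc k) S f \<Longrightarrow> Ck_on k S f"
proof (induction k arbitrary: f)
  case 0
  then show ?case
    by (auto intro!: continuous_at_imp_continuous_on differentiable_imp_continuous_within)
next
  case (Suc k)
  then show ?case by (metis Ck_on.simps(2))
qed

text \<open>Derivatives at a point are unique, so any explicit derivative serves; the product and
  chain rules can be fed in without computing \<open>frechet_derivative\<close>.\<close>

lemma Ck_on_SucI:
  assumes "open S" and d: "\<And>x. x \<in> S \<Longrightarrow> (f has_derivative f' x) (at x)"
    and f': "\<And>v. Ck_on k S (\<lambda>x. f' x v)"
  shows "Ck_on (Suc k) S f"
proof -
  have "Ck_on k S (\<lambda>x. frechet_derivative f (at x) v)" for v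
  proof -
    have "frechet_derivative f (at x) v = f' x v" if "x \<in> S" for x
      using frechet_derivative_at[OF d[OF that]] by simp
    from Ck_on_cong[OF assms(1) this] show ?thesis using f'[of v] by simp
  qed
  then show ?thesis using d by (auto simp: differentiable_def)
qed

lemma Ck_on_Suc_derivative:
  assumes "Ck_on (Suc k) S f"
  shows "x \<in> S \<Longrightarrow> (f has_derivative frechet_derivative f (at x)) (at x)"
    and "Ck_on k S (\<lambda>x. frechet_derivative f (at x) v)"
  using assms by (simp_all add: frechet_derivative_works[symmetric])

lemma Ck_on_const: "Ck_on k S (\<lambda>x. c)"
proof (induction k arbitrary: c)
  case 0
  then show ?case by simp
next
  case (Suc k)
  then show ?case by (simp add: frechet_derivative_const)
qed

lemma Ck_on_bounded_linear:
  assumes L: "bounded_linear L" and "open S"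
  shows "Ck_on k S f \<Longrightarrow> Ck_on k S (\<lambda>x. L (f x))"
proof (induction k arbitrary: f)
  case 0
  then show ?case
    using bounded_linear.continuous_on[OF L] by simp
next
  case (Suc k)
  note f = Ck_on_Suc_derivative[OF Suc.prems]
  show ?case
    by (rule Ck_on_SucI[OF assms(2) bounded_linear.has_derivative[OF L f(1)] Suc.IH[OF f(2)]])
qed

lemma Ck_on_add:
  assumes "open S"
  shows "Ck_on k S f \<Longrightarrow> Ck_on k S g \<Longrightarrow> Ck_on k S (\<lambda>x. f x + g x)"
proof (induction k arbitrary: f g)
  case 0
  then show ?case by (simp add: continuous_on_add)
next
  case (Suc k)
  note f = Ck_on_Suc_derivative[OF Suc.prems(1)] and g = Ck_on_Suc_derivative[OF Suc.prems(2)]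
  show ?case
    by (rule Ck_on_SucI[OF assms has_derivative_add[OF f(1) g(1)] Suc.IH[OF f(2) g(2)]])
qed

lemma Ck_on_bounded_bilinear:
  assumes B: "bounded_bilinear B" and "open S"
  shows "Ck_on k S f \<Longrightarrow> Ck_on k S g \<Longrightarrow> Ck_on k S (\<lambda>x. B (f x) (g x))"
proof (induction k arbitrary: f g)
  case 0
  then show ?case
    using bounded_bilinear.continuous_on[OF B] by simp
next
  case (Suc k)
  note f = Ck_on_Suc_derivative[OF Suc.prems(1)] and g = Ck_on_Suc_derivative[OF Suc.prems(2)]
  show ?case
    by (rule Ck_on_SucI[OF assms(2) bounded_bilinear.FDERIV[OF B f(1) g(1)]
          Ck_on_add[OF assms(2) Suc.IH[OF Ck_on_SucD[OF Suc.prems(1)] g(2)]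
            Suc.IH[OF f(2) Ck_on_SucD[OF Suc.prems(2)]]]])
qed

lemma Ck_on_sum:
  assumes "open S" "\<And>i. i \<in> I \<Longrightarrow> Ck_on k S (f i)"
  shows "Ck_on k S (\<lambda>x. \<Sum>i\<in>I. f i x)"
  using assms(2)
proof (induction I rule: infinite_finite_induct)
  case (insert i I)
  then show ?case using Ck_on_add[OF assms(1), of k "f i" "\<lambda>x. \<Sum>i\<in>I. f i x"] by simp
qed (simp_all add: Ck_on_const)

text \<open>The chain rule differentiates \<open>g\<close> in a direction that varies with
  \<open>x\<close>, whereas the induction hypothesis speaks of fixed directions. Expanding the
  direction in \<open>Basis\<close> separates the two, hence the Euclidean type in the
  middle.\<close>

lemma Ck_on_compose:
  fixes f :: "'a::real_normed_vector \<Rightarrow> 'b::euclidean_space"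
  assumes "open S"
  shows "Ck_on k S f \<Longrightarrow> Ck_on k T g \<Longrightarrow> f ` S \<subseteq> T \<Longrightarrow> Ck_on k S (\<lambda>x. g (f x))"
proof (induction k arbitrary: g)
  case 0
  then show ?case using continuous_on_compose2 by auto
next
  case (Suc k)
  let ?f = "\<lambda>x. frechet_derivative f (at x)" and ?g = "\<lambda>x. frechet_derivative g (at x)"
  note f = Ck_on_Suc_derivative[OF Suc.prems(1)] and g = Ck_on_Suc_derivative[OF Suc.prems(2)]
  show ?case
  proof (rule Ck_on_SucI[OF assms])
    fix x assume x: "x \<in> S"
    then have gx: "(g has_derivative ?g (f x)) (at (f x))"
      using g(1) Suc.prems(3) by blast
    have "((\<lambda>x. g (f x)) has_derivative (\<lambda>v. ?g (f x) (?f x v))) (at x)"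
      by (rule has_derivative_compose[OF f(1)[OF x] gx])
    moreover have "?g (f x) (\<Sum>b\<in>Basis. (?f x v \<bullet> b) *\<^sub>R b) = (\<Sum>b\<in>Basis. (?f x v \<bullet> b) *\<^sub>R ?g (f x) b)" for v
      using has_derivative_linear[OF gx] by (simp add: linear_sum linear_cmul)
    ultimately show "((\<lambda>x. g (f x)) has_derivative (\<lambda>v. \<Sum>b\<in>Basis. (?f x v \<bullet> b) *\<^sub>R ?g (f x) b)) (at x)"
      by (simp add: euclidean_representation)
  next
    fix v
    have "Ck_on k S (\<lambda>x. ?g (f x) b)" for b
      by (rule Suc.IH[OF Ck_on_SucD[OF Suc.prems(1)] g(2) Suc.prems(3)])
    then show "Ck_on k S (\<lambda>x. \<Sum>b\<in>Basis. (?f x v \<bullet> b) *\<^sub>R ?g (f x) b)"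
      by (intro Ck_on_sum Ck_on_bounded_bilinear[OF bounded_bilinear_scaleR]
          Ck_on_bounded_linear[OF bounded_linear_inner_left] f(2) assms)
  qed
qed

lemma Ck_on_ident: "open S \<Longrightarrow> Ck_on k S (\<lambda>x. x)"
  by (cases k) (auto intro!: Ck_on_SucI[where f' = "\<lambda>x v. v"] Ck_on_const simp del: Ck_on.simps(2))

lemma smooth_on_cong: "open S \<Longrightarrow> (\<And>x. x \<in> S \<Longrightarrow> f x = g x) \<Longrightarrow> smooth_on S f \<longleftrightarrow> smooth_on S g"
  unfolding smooth_on_def using Ck_on_cong by blast

lemma smooth_on_subset: "smooth_on S f \<Longrightarrow> T \<subseteq> S \<Longrightarrow> smooth_on T f"
  unfolding smooth_on_def using Ck_on_subset by blast

lemma smooth_on_const: "smooth_on S (\<lambda>x. c)"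
  by (simp add: smooth_on_def Ck_on_const)

lemma smooth_on_inner: "open S \<Longrightarrow> smooth_on S (\<lambda>x. x \<bullet> b)"
  unfolding smooth_on_def by (intro allI Ck_on_bounded_linear[OF bounded_linear_inner_left] Ck_on_ident)

lemma smooth_on_add: "open S \<Longrightarrow> smooth_on S f \<Longrightarrow> smooth_on S g \<Longrightarrow> smooth_on S (\<lambda>x. f x + g x)"
  by (simp add: smooth_on_def Ck_on_add)

lemma smooth_on_mult:
  fixes f g :: "'a::real_normed_vector \<Rightarrow> real"
  shows "open S \<Longrightarrow> smooth_on S f \<Longrightarrow> smooth_on S g \<Longrightarrow> smooth_on S (\<lambda>x. f x * g x)"
  by (simp add: smooth_on_def Ck_on_bounded_bilinear[OF bounded_bilinear_mult])

lemma smooth_on_compose: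
  fixes f :: "'a::real_normed_vector \<Rightarrow> 'b::euclidean_space"
  shows "open S \<Longrightarrow> smooth_on S f \<Longrightarrow> smooth_on T g \<Longrightarrow> f ` S \<subseteq> T \<Longrightarrow> smooth_on S (\<lambda>x. g (f x))"
  unfolding smooth_on_def using Ck_on_compose by blast

lemma smooth_on_derivative: "smooth_on S f \<Longrightarrow> smooth_on S (\<lambda>x. frechet_derivative f (at x) v)"
  unfolding smooth_on_def using Ck_on_Suc_derivative(2) by blast

lemma smooth_on_has_derivative:
  "smooth_on S f \<Longrightarrow> x \<in> S \<Longrightarrow> (f has_derivative frechet_derivative f (at x)) (at x)"
  unfolding smooth_on_def using Ck_on_Suc_derivative(1) by blast

lemma smooth_on_continuous_on: "smooth_on S f \<Longrightarrow> continuous_on S f"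
  unfolding smooth_on_def using Ck_on.simps(1) by blast

text \<open>The factor \<open>t ^ m\<close> makes the class of these integrals closed under differentiation.\<close>

lemma has_derivative_segment_integral:
  fixes f :: "'a::euclidean_space \<Rightarrow> real"
  assumes f: "Ck_on (Suc 0) (ball p r) f" and x: "x \<in> ball p r"
  shows "((\<lambda>x. integral {0..1} (\<lambda>t. t ^ m * f (p + t *\<^sub>R (x - p)))) has_derivative
    (\<lambda>v. integral {0..1} (\<lambda>t. t ^ Suc m * frechet_derivative f (at (p + t *\<^sub>R (x - p))) v))) (at x)"
proof -
  let ?D = "\<lambda>y. frechet_derivative f (at y)"
  \<comment> \<open>The Leibniz rule for parameter integrals takes the derivative as a point in the
    space of bounded linear maps; continuity there is checked one vector at a time.\<close>
  define F where "F y = (Blinfun (?D y) :: 'a \<Rightarrow>\<^sub>L real)" for y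
  have D: "(f has_derivative ?D y) (at y)" if "y \<in> ball p r" for y
    using f that by (auto simp: frechet_derivative_works[symmetric])
  have F: "blinfun_apply (F y) = ?D y" if "y \<in> ball p r" for y
    unfolding F_def using D[OF that]
    by (simp add: bounded_linear_Blinfun_apply has_derivative_bounded_linear)
  have seg: "p + t *\<^sub>R (y - p) \<in> ball p r" if "y \<in> ball p r" "t \<in> cbox 0 1" for y and t::real
  proof -
    have "t * norm (y - p) \<le> norm (y - p)"
      using that by (simp add: mult_left_le_one_le)
    then show ?thesis using that by (auto simp: dist_norm norm_minus_commute)
  qed
  have contF: "continuous_on (ball p r) F"
  proof (rule continuous_on_blinfun_componentwise)
    fix i :: 'a
    have "continuous_on (ball p r) (\<lambda>y. ?D y i)" using f by auto
    then show "continuous_on (ball p r) (\<lambda>y. blinfun_apply (F y) i)"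
      by (rule continuous_on_eq) (simp add: F)
  qed
  have contf: "continuous_on (ball p r) f"
    using Ck_on_SucD[of 0 "ball p r" f] f by simp
  \<comment> \<open>The inner map \<open>y \<mapsto> p + t (y - p)\<close> has derivative
    \<open>t\<close> times the identity, which raises the exponent by one.\<close>
  define G where "G y t = t ^ Suc m *\<^sub>R F (p + t *\<^sub>R (y - p))" for y and t::real
  have "((\<lambda>x. integral (cbox 0 1) (\<lambda>t. t ^ m * f (p + t *\<^sub>R (x - p)))) has_derivative
    integral (cbox 0 1) (G x)) (at x within ball p r)"
  proof (rule leibniz_rule)
    show "((\<lambda>y. t ^ m * f (p + t *\<^sub>R (y - p))) has_derivative blinfun_apply (G y t)) (at y within ball p r)"
      if "y \<in> ball p r" "t \<in> cbox 0 1" for y t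
    proof -
      have "((\<lambda>y. f (p + t *\<^sub>R (y - p))) has_derivative (\<lambda>v. ?D (p + t *\<^sub>R (y - p)) (t *\<^sub>R v))) (at y)"
        by (rule has_derivative_compose[where g = f and f = "\<lambda>y. p + t *\<^sub>R (y - p)", OF _ D[OF seg[OF that]]])
          (rule has_derivative_eq_rhs[OF has_derivative_add[OF has_derivative_const
              has_derivative_scaleR_right[OF has_derivative_diff[OF has_derivative_ident has_derivative_const]]]], simp)
      then have "((\<lambda>y. t ^ m * f (p + t *\<^sub>R (y - p))) has_derivative (\<lambda>v. t ^ m * ?D (p + t *\<^sub>R (y - p)) (t *\<^sub>R v))) (at y)"
        by (rule has_derivative_mult_right)
      moreover have "(\<lambda>v. t ^ m * ?D (p + t *\<^sub>R (y - p)) (t *\<^sub>R v)) = blinfun_apply (G y t)"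
        using F[OF seg[OF that]] linear_cmul[OF has_derivative_linear[OF D[OF seg[OF that]]]]
        by (auto simp: G_def scaleR_blinfun.rep_eq)
      ultimately show ?thesis
        by (metis has_derivative_at_withinI)
    qed
    show "(\<lambda>t. t ^ m * f (p + t *\<^sub>R (y - p))) integrable_on cbox 0 1" if "y \<in> ball p r" for y
      using seg[OF that]
      by (intro integrable_continuous continuous_intros continuous_on_compose2[OF contf]) auto
    show "continuous_on (ball p r \<times> cbox 0 1) (\<lambda>(y, t). G y t)"
      unfolding G_def split_beta
      using seg by (intro continuous_intros continuous_on_compose2[OF contF]) auto
  qed (use x in auto)
  moreover have "blinfun_apply (integral (cbox 0 1) (G x)) =
      (\<lambda>v. integral (cbox 0 1) (\<lambda>t. t ^ Suc m * ?D (p + t *\<^sub>R (x - p)) v))"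
  proof
    fix v
    have "G x integrable_on cbox 0 1"
      unfolding G_def using seg[OF x]
      by (intro integrable_continuous continuous_intros continuous_on_compose2[OF contF]) auto
    then have "blinfun_apply (integral (cbox 0 1) (G x)) v = integral (cbox 0 1) (\<lambda>t. blinfun_apply (G x t) v)"
      by (rule blinfun_apply_integral)
    also have "\<dots> = integral (cbox 0 1) (\<lambda>t. t ^ Suc m * ?D (p + t *\<^sub>R (x - p)) v)"
      using F[OF seg[OF x]] by (intro integral_cong) (simp add: G_def scaleR_blinfun.rep_eq)
    finally show "blinfun_apply (integral (cbox 0 1) (G x)) v = integral (cbox 0 1) (\<lambda>t. t ^ Suc m * ?D (p + t *\<^sub>R (x - p)) v)" .
  qed
  ultimately show ?thesis
    by (simp add: at_within_open[OF x open_ball])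
qed

lemma Ck_on_segment_integral:
  fixes f :: "'a::euclidean_space \<Rightarrow> real"
  assumes "smooth_on (ball p r) f"
  shows "Ck_on k (ball p r) (\<lambda>x. integral {0..1} (\<lambda>t. t ^ m * f (p + t *\<^sub>R (x - p))))"
  using assms
proof (induction k arbitrary: f m)
  case 0
  have "Ck_on (Suc 0) (ball p r) f" using 0 by (simp add: smooth_on_def del: Ck_on.simps)
  from has_derivative_segment_integral[OF this] show ?case
    unfolding Ck_on.simps
    by (intro continuous_at_imp_continuous_on ballI has_derivative_continuous)
next
  case (Suc k)
  have "Ck_on (Suc 0) (ball p r) f" using Suc by (simp add: smooth_on_def del: Ck_on.simps)
  note d = has_derivative_segment_integral[OF this]
  have "smooth_on (ball p r) (\<lambda>y. frechet_derivative f (at y) v)" for v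
    using Suc.prems Ck_on_Suc_derivative(2) unfolding smooth_on_def by blast
  from Ck_on_SucI[OF open_ball d Suc.IH[OF this]] show ?case .
qed

text \<open>The increment \<open>f x - f p\<close> is the integral of the derivative along the
  segment from \<open>p\<close> to \<open>x\<close>; splitting the direction \<open>x - p\<close> in
  the basis gives the coefficients. Their values at \<open>p\<close> are what later produces the
  coordinate vectors.\<close>

lemma hadamard:
  fixes f :: "'a::euclidean_space \<Rightarrow> real"
  assumes f: "smooth_on (ball p r) f"
  obtains g where "\<And>b. smooth_on (ball p r) (g b)"
    and "\<And>x. x \<in> ball p r \<Longrightarrow> f x = f p + (\<Sum>b\<in>Basis. ((x - p) \<bullet> b) * g b x)"
    and "\<And>b. g b p = frechet_derivative f (at p) b"
proof
  let ?D = "\<lambda>y. frechet_derivative f (at y)"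
  \<comment> \<open>The factor \<open>t ^ 0\<close> brings the integral into the form treated by
    \<open>Ck_on_segment_integral\<close>.\<close>
  define g where "g b x = integral {0..1} (\<lambda>t. t ^ 0 * ?D (p + t *\<^sub>R (x - p)) b)" for b x
  have "smooth_on (ball p r) (\<lambda>y. ?D y v)" for v
    using f Ck_on_Suc_derivative(2) unfolding smooth_on_def by blast
  then show "smooth_on (ball p r) (g b)" for b
    unfolding g_def smooth_on_def by (intro allI Ck_on_segment_integral) (auto simp: smooth_on_def)
  show "g b p = ?D p b" for b by (simp add: g_def)
  fix x assume x: "x \<in> ball p r"
  have f1: "Ck_on (Suc 0) (ball p r) f" using f by (simp add: smooth_on_def del: Ck_on.simps)
  have D: "(f has_derivative ?D y) (at y)" if "y \<in> ball p r" for y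
    using f1 that by (auto simp: frechet_derivative_works[symmetric])
  have seg: "p + t *\<^sub>R (x - p) \<in> ball p r" if "t \<in> {0..1}" for t::real
  proof -
    have "t * norm (x - p) \<le> norm (x - p)"
      using that by (simp add: mult_left_le_one_le)
    then show ?thesis using that x by (auto simp: dist_norm norm_minus_commute)
  qed
  have "((\<lambda>t. f (p + t *\<^sub>R (x - p))) has_vector_derivative ?D (p + t *\<^sub>R (x - p)) (x - p)) (at t within {0..1})"
    if "t \<in> {0..1}" for t
  proof -
    have "((\<lambda>t. f (p + t *\<^sub>R (x - p))) has_derivative (\<lambda>s. ?D (p + t *\<^sub>R (x - p)) (s *\<^sub>R (x - p)))) (at t)"
      by (rule has_derivative_compose[where g = f and f = "\<lambda>t. p + t *\<^sub>R (x - p)", OF _ D[OF seg[OF that]]])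
          (rule has_derivative_eq_rhs[OF has_derivative_add[OF has_derivative_const
            has_derivative_scaleR_left[OF has_derivative_ident]]], simp)
    then show ?thesis
      using linear_cmul[OF has_derivative_linear[OF D[OF seg[OF that]]]]
      by (simp add: has_vector_derivative_def has_derivative_at_withinI)
  qed
  then have "((\<lambda>t. ?D (p + t *\<^sub>R (x - p)) (x - p)) has_integral f (p + 1 *\<^sub>R (x - p)) - f (p + 0 *\<^sub>R (x - p))) {0..1}"
    by (intro fundamental_theorem_of_calculus) auto
  then have "f x - f p = integral {0..1} (\<lambda>t. ?D (p + t *\<^sub>R (x - p)) (x - p))"
    by (simp add: integral_unique)
  also have "\<dots> = integral {0..1} (\<lambda>t. \<Sum>b\<in>Basis. ((x - p) \<bullet> b) * ?D (p + t *\<^sub>R (x - p)) b)"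
  proof (rule integral_cong)
    fix t :: real assume "t \<in> {0..1}"
    then have "linear (?D (p + t *\<^sub>R (x - p)))" using D[OF seg] has_derivative_linear by blast
    then have "?D (p + t *\<^sub>R (x - p)) (\<Sum>b\<in>Basis. ((x - p) \<bullet> b) *\<^sub>R b) = (\<Sum>b\<in>Basis. ((x - p) \<bullet> b) * ?D (p + t *\<^sub>R (x - p)) b)"
      by (simp add: linear_sum linear_cmul)
    then show "?D (p + t *\<^sub>R (x - p)) (x - p) = (\<Sum>b\<in>Basis. ((x - p) \<bullet> b) * ?D (p + t *\<^sub>R (x - p)) b)"
      by (simp add: euclidean_representation)
  qed
  also have "\<dots> = (\<Sum>b\<in>Basis. ((x - p) \<bullet> b) * g b x)"
  proof -
    have int: "(\<lambda>t. ?D (p + t *\<^sub>R (x - p)) b) integrable_on {0..1}" for b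
    proof -
      have c: "continuous_on (ball p r) (\<lambda>y. ?D y b)" using f1 by auto
      have "continuous_on {0..1} (\<lambda>t. ?D (p + t *\<^sub>R (x - p)) b)"
        by (rule continuous_on_compose2[OF c, where f = "\<lambda>t. p + t *\<^sub>R (x - p)"])
          (use seg in \<open>auto intro!: continuous_intros\<close>)
      then show ?thesis by (rule integrable_continuous_interval)
    qed
    have "integral {0..1} (\<lambda>t. \<Sum>b\<in>Basis. ((x - p) \<bullet> b) * ?D (p + t *\<^sub>R (x - p)) b) =
        (\<Sum>b\<in>Basis. integral {0..1} (\<lambda>t. ((x - p) \<bullet> b) * ?D (p + t *\<^sub>R (x - p)) b))"
      by (rule integral_sum) (simp_all add: int integrable_on_mult_right)
    then show ?thesis
      by (simp add: g_def)
  qed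
  finally show "f x = f p + (\<Sum>b\<in>Basis. ((x - p) \<bullet> b) * g b x)" by simp
qed

text \<open>Gronwall's argument for the sum of squares \<open>u\<close>: it satisfies
  \<open>u' \<le> K u\<close>, so \<open>u s * exp (- K * s)\<close> does not increase from its
  initial value zero.\<close>

lemma linear_system_zero:
  fixes y y' :: "'i \<Rightarrow> real \<Rightarrow> real"
  assumes I: "finite I"
    and d: "\<And>i s. i \<in> I \<Longrightarrow> 0 \<le> s \<Longrightarrow> s \<le> 1 \<Longrightarrow> (y i has_real_derivative y' i s) (at s)"
    and b: "\<And>i s. i \<in> I \<Longrightarrow> 0 \<le> s \<Longrightarrow> s \<le> 1 \<Longrightarrow> \<bar>y' i s\<bar> \<le> C * (\<Sum>j\<in>I. \<bar>y j s\<bar>)"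
    and 0: "\<And>i. i \<in> I \<Longrightarrow> y i 0 = 0" and i: "i \<in> I"
  shows "y i 1 = 0"
proof -
  define u where "u s = (\<Sum>i\<in>I. (y i s)\<^sup>2)" for s
  \<comment> \<open>The factor 2 comes from differentiating squares and \<open>card I\<close> from
    Cauchy-Schwarz for \<open>(\<Sum>\<bar>y j\<bar>)^2\<close>. The absolute value is there because
    the sign of \<open>C\<close> is not prescribed.\<close>
  define K where "K = 2 * \<bar>C\<bar> * real (card I)"
  define S where "S s = (\<Sum>j\<in>I. \<bar>y j s\<bar>)" for s
  have u': "(u has_real_derivative (\<Sum>i\<in>I. 2 * y i s * y' i s)) (at s)" if "0 \<le> s" "s \<le> 1" for s
    unfolding u_def[abs_def]
    by (rule DERIV_sum) (auto intro!: derivative_eq_intros d that)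
  have bound: "(\<Sum>i\<in>I. 2 * y i s * y' i s) \<le> K * u s" if "0 \<le> s" "s \<le> 1" for s
  proof -
    have "(\<Sum>i\<in>I. 2 * y i s * y' i s) \<le> (\<Sum>i\<in>I. 2 * \<bar>y i s\<bar> * (\<bar>C\<bar> * S s))"
    proof (rule sum_mono)
      fix i assume i: "i \<in> I"
      have "\<bar>y' i s\<bar> \<le> C * S s" using b[OF i that] by (simp add: S_def)
      also have "\<dots> \<le> \<bar>C\<bar> * S s" by (intro mult_right_mono) (auto simp: S_def sum_nonneg)
      finally have "\<bar>y i s\<bar> * \<bar>y' i s\<bar> \<le> \<bar>y i s\<bar> * (\<bar>C\<bar> * S s)" by (intro mult_left_mono) auto
      moreover have "y i s * y' i s \<le> \<bar>y i s\<bar> * \<bar>y' i s\<bar>" by (metis abs_ge_self abs_mult)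
      ultimately show "2 * y i s * y' i s \<le> 2 * \<bar>y i s\<bar> * (\<bar>C\<bar> * S s)" by linarith
    qed
    also have "\<dots> = 2 * \<bar>C\<bar> * (S s)\<^sup>2"
      by (simp add: S_def power2_eq_square sum_distrib_left sum_distrib_right algebra_simps)
    also have "(S s)\<^sup>2 \<le> real (card I) * u s"
      using Cauchy_Schwarz_ineq_sum[of "\<lambda>i. \<bar>y i s\<bar>" "\<lambda>_. 1" I] by (simp add: S_def u_def mult.commute)
    finally show ?thesis by (simp add: K_def mult_left_mono mult.assoc)
  qed
  define w where "w s = u s * exp (- K * s)" for s
  have "w 1 \<le> w 0"
  proof (rule DERIV_nonpos_imp_nonincreasing[where f = w])
    fix s :: real assume s: "0 \<le> s" "s \<le> 1"
    have "(w has_real_derivative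
        (\<Sum>i\<in>I. 2 * y i s * y' i s) * exp (- K * s) + (exp (- K * s) * - K) * u s) (at s)"
      unfolding w_def[abs_def]
      by (rule DERIV_mult[OF u'[OF s]]) (auto intro!: derivative_eq_intros)
    moreover have "(\<Sum>i\<in>I. 2 * y i s * y' i s) * exp (- K * s) + (exp (- K * s) * - K) * u s
        = ((\<Sum>i\<in>I. 2 * y i s * y' i s) - K * u s) * exp (- K * s)" by (simp add: algebra_simps)
    moreover have "\<dots> \<le> 0" using bound[OF s] by (simp add: mult_le_0_iff)
    ultimately show "\<exists>z. (w has_real_derivative z) (at s) \<and> z \<le> 0" by metis
  qed simp
  then have "u 1 \<le> 0" using 0 by (simp add: w_def u_def mult_le_0_iff)
  then have "(\<Sum>i\<in>I. (y i 1)\<^sup>2) = 0" by (simp add: u_def antisym sum_nonneg)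
  then show ?thesis using I i by (simp add: sum_nonneg_eq_0_iff)
qed

section \<open>The canonical Hermitian connection has parallel torsion\<close>

text \<open>Functions, derivations and vector fields are all HOL functions; with pointwise
  operations they are vectors, so that \<open>subspace\<close>, finite sums and linear maps apply to
  each of them.\<close>

instantiation "fun" :: (type, real_vector) real_vector
begin
definition scaleR_fun_def: "scaleR c f = (\<lambda>x. c *\<^sub>R f x)"
instance
  by standard (auto simp: scaleR_fun_def plus_fun_def algebra_simps)
end

text \<open>Here \<open>A\<close> stands for \<open>\<nabla>N\<close>, \<open>R\<close> for the curvature of \<open>\<nabla>\<close> and \<open>Q\<close> for \<open>h(N(X,N(Y,Z)),W)\<close>, and \<open>I\<close> is the
  first Bianchi identity. The proof evaluates \<open>I\<close> on complex vectors \<open>V \<plusminus> i JV\<close> of type \<open>(0,1)\<close>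
  and \<open>(1,0)\<close>, written out in real parts.\<close>

lemma kirichenko_pointwise:
  fixes J :: "'v::real_vector \<Rightarrow> 'v"
    and A Q R :: "'v \<Rightarrow> 'v \<Rightarrow> 'v \<Rightarrow> 'v \<Rightarrow> real"
  assumes E: "\<And>X. X \<in> E \<Longrightarrow> J X \<in> E" and JJ: "\<And>X. X \<in> E \<Longrightarrow> J (J X) = - X"
    and Amin: "\<And>V X Y Z. \<lbrakk>V\<in>E; X\<in>E; Y\<in>E; Z\<in>E\<rbrakk> \<Longrightarrow> A (-V) X Y Z = - A V X Y Z"
      "\<And>V X Y Z. \<lbrakk>V\<in>E; X\<in>E; Y\<in>E; Z\<in>E\<rbrakk> \<Longrightarrow> A V (-X) Y Z = - A V X Y Z"
    and A: "\<And>V X Y Z. \<lbrakk>V\<in>E; X\<in>E; Y\<in>E; Z\<in>E\<rbrakk> \<Longrightarrow> A V Y X Z = - A V X Y Z"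
      "\<And>V X Y Z. \<lbrakk>V\<in>E; X\<in>E; Y\<in>E; Z\<in>E\<rbrakk> \<Longrightarrow> A V X Z Y = - A V X Y Z"
    and AJ: "\<And>V X Y Z. \<lbrakk>V\<in>E; X\<in>E; Y\<in>E; Z\<in>E\<rbrakk> \<Longrightarrow> A V X (J Y) Z = A V (J X) Y Z"
    and Qmin: "\<And>X Y Z W. \<lbrakk>X\<in>E; Y\<in>E; Z\<in>E; W\<in>E\<rbrakk> \<Longrightarrow> Q X (-Y) Z W = - Q X Y Z W"
      "\<And>X Y Z W. \<lbrakk>X\<in>E; Y\<in>E; Z\<in>E; W\<in>E\<rbrakk> \<Longrightarrow> Q (-X) Y Z W = - Q X Y Z W"
    and Q: "\<And>X Y Z W. \<lbrakk>X\<in>E; Y\<in>E; Z\<in>E; W\<in>E\<rbrakk> \<Longrightarrow> Q X Y (J Z) W = Q X (J Y) Z W"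
      "\<And>X Y Z W. \<lbrakk>X\<in>E; Y\<in>E; Z\<in>E; W\<in>E\<rbrakk> \<Longrightarrow> Q X Y Z (J W) = Q (J X) Y Z W"
      "\<And>X Y Z W. \<lbrakk>X\<in>E; Y\<in>E; Z\<in>E; W\<in>E\<rbrakk> \<Longrightarrow> Q X (J Y) Z W = - Q (J X) Y Z W"
    and Rmin: "\<And>X Y Z W. \<lbrakk>X\<in>E; Y\<in>E; Z\<in>E; W\<in>E\<rbrakk> \<Longrightarrow> R X Y (-Z) W = - R X Y Z W"
      "\<And>X Y Z W. \<lbrakk>X\<in>E; Y\<in>E; Z\<in>E; W\<in>E\<rbrakk> \<Longrightarrow> R (-X) Y Z W = - R X Y Z W"
      "\<And>X Y Z W. \<lbrakk>X\<in>E; Y\<in>E; Z\<in>E; W\<in>E\<rbrakk> \<Longrightarrow> R X (-Y) Z W = - R X Y Z W"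
    and R: "\<And>X Y Z W. \<lbrakk>X\<in>E; Y\<in>E; Z\<in>E; W\<in>E\<rbrakk> \<Longrightarrow> R X Y W Z = - R X Y Z W"
      "\<And>X Y Z W. \<lbrakk>X\<in>E; Y\<in>E; Z\<in>E; W\<in>E\<rbrakk> \<Longrightarrow> R X Y Z (J W) = - R X Y (J Z) W"
    and I: "\<And>X Y Z W. \<lbrakk>X\<in>E; Y\<in>E; Z\<in>E; W\<in>E\<rbrakk> \<Longrightarrow>
      R X Y Z W + R Y Z X W + R Z X Y W =
      A X Y Z W + A Y Z X W + A Z X Y W - Q X Y Z W - Q Y Z X W - Q Z X Y W"
    and mem: "X\<in>E" "Y\<in>E" "Z\<in>E" "W\<in>E"
  shows "A X Y Z W = 0"
proof -
  note rw = E JJ Amin Qmin Rmin AJ Q R(2)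
  have AJ3: "A V X Y (J Z) = A V (J X) Y Z" if "V\<in>E" "X\<in>E" "Y\<in>E" "Z\<in>E" for V X Y Z
    using that A(2)[of V X Y "J Z"] A(2)[of V "J X" Y Z] AJ[of V X Z Y] E by simp
  \<comment> \<open>all four arguments of type \<open>(0,1)\<close>: neither \<open>R\<close> nor \<open>Q\<close> contributes\<close>
  have s1: "A X Y Z W - A (J X) (J Y) Z W + (A Y Z X W - A (J Y) (J Z) X W) + (A Z X Y W - A (J Z) (J X) Y W) = 0"
    if "X\<in>E" "Y\<in>E" "Z\<in>E" "W\<in>E" for X Y Z W
    using I[of X Y Z W] I[of "J X" "J Y" Z W] I[of "J X" Y "J Z" W] I[of X "J Y" "J Z" W]
      I[of "J X" Y Z "J W"] I[of X "J Y" Z "J W"] I[of X Y "J Z" "J W"] I[of "J X" "J Y" "J Z" "J W"] that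
    by (simp add: rw AJ3)
  \<comment> \<open>Up to a constant, \<open>B\<close> is the real part of \<open>A\<close> on four
    vectors of equal type, and \<open>C\<close> below is the same with the first vector of the
    opposite type. Hence \<open>A\<close> is half of \<open>B + C\<close>.\<close>
  define B where "B X Y Z W = A X Y Z W - A (J X) (J Y) Z W" for X Y Z W
  have Bskew: "B X Z Y W = - B X Y Z W" "B X Y W Z = - B X Y Z W" if "X\<in>E" "Y\<in>E" "Z\<in>E" "W\<in>E" for X Y Z W
    using that A[of X Y Z W] A[of "J X" "J Y" Z W] A[of "J X" Y "J Z" W] A(1)[of "J X" "J Z" Y W] by (auto simp: B_def E AJ AJ3)
  have Bcyc: "B X Y Z W + B Y Z X W + B Z X Y W = 0" if "X\<in>E" "Y\<in>E" "Z\<in>E" "W\<in>E" for X Y Z W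
    using s1[OF that] by (simp add: B_def)
  \<comment> \<open>Skewness in the last three slots leaves, up to sign, one value for each choice
    of the first argument. By \<open>Bcyc\<close> any three of these four signed values add up to
    zero, so all four vanish.\<close>
  have B0: "B X Y Z W = 0" if "X\<in>E" "Y\<in>E" "Z\<in>E" "W\<in>E" for X Y Z W
  proof -
    have cyc: "B a b c d = B a c d b" "B a b c d = B a d b c" if "a\<in>E" "b\<in>E" "c\<in>E" "d\<in>E" for a b c d
      using that Bskew(1)[of a b c d] Bskew(2)[of a c b d] Bskew(2)[of a b c d] Bskew(1)[of a b d c] by simp_all
    note m = that
    show ?thesis
      using Bcyc[OF m(1,2,3,4)] Bcyc[OF m(2,3,4,1)] Bcyc[OF m(3,4,1,2)] Bcyc[OF m(4,1,2,3)]
        Bskew(1)[OF m(2,1,3,4)] cyc[OF m(2,1,3,4)] cyc[OF m(3,1,2,4)] cyc[OF m(1,2,3,4)] cyc[OF m(4,1,2,3)]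
        Bskew(2)[OF m(3,4,1,2)] Bskew(1)[OF m(4,1,2,3)] Bskew(2)[OF m(1,2,3,4)]
        cyc[OF m(3,4,2,1)] cyc[OF m(4,2,1,3)] cyc[OF m(1,2,4,3)] cyc[OF m(2,3,1,4)] cyc[OF m(3,2,1,4)]
        Bskew(1)[OF m(3,1,2,4)] Bskew(1)[OF m(1,2,3,4)]
      by linarith
  qed
  \<comment> \<open>\<open>X\<close>, \<open>Y\<close>, \<open>W\<close> of type \<open>(0,1)\<close> and \<open>Z\<close> of type \<open>(1,0)\<close>\<close>
  have s2: "R X Y Z W - R (J X) (J Y) Z W + R (J X) Y (J Z) W + R X (J Y) (J Z) W = 2 * (A Z X Y W + A (J Z) (J X) Y W)"
    if "X\<in>E" "Y\<in>E" "Z\<in>E" "W\<in>E" for X Y Z W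
    using I[of X Y Z W] I[of "J X" "J Y" Z W] I[of "J X" Y "J Z" W] I[of X "J Y" "J Z" W]
      I[of "J X" Y Z "J W"] I[of X "J Y" Z "J W"] I[of X Y "J Z" "J W"] I[of "J X" "J Y" "J Z" "J W"] that
    by (simp add: rw AJ3)
  define P where "P X Y Z W = R X Y Z W - R (J X) (J Y) Z W + R (J X) Y (J Z) W + R X (J Y) (J Z) W" for X Y Z W
  define C where "C X Y Z W = A X Y Z W + A (J X) (J Y) Z W" for X Y Z W
  have PC: "P X Y Z W = 2 * C Z X Y W" if "X\<in>E" "Y\<in>E" "Z\<in>E" "W\<in>E" for X Y Z W
    using s2[OF that] by (simp add: P_def C_def)
  have Cskew: "C X Z Y W = - C X Y Z W" "C X Y W Z = - C X Y Z W" if "X\<in>E" "Y\<in>E" "Z\<in>E" "W\<in>E" for X Y Z W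
    using that A[of X Y Z W] A[of "J X" "J Y" Z W] A[of "J X" Y "J Z" W] A(1)[of "J X" "J Z" Y W] by (auto simp: C_def E AJ AJ3)
  \<comment> \<open>the same types with \<open>Z\<close> in the last slot\<close>
  have Pcyc: "P X Y Z W + P Y W Z X + P W X Z Y = 0" if "X\<in>E" "Y\<in>E" "Z\<in>E" "W\<in>E" for X Y Z W
  proof -
    have r: "R a b c Z = - R a b Z c" "R a b (J c) Z = R a b (J Z) c" if "a\<in>E" "b\<in>E" "c\<in>E" for a b c
      using that \<open>Z\<in>E\<close> R(1)[of a b Z c] R(1)[of a b Z "J c"] R(2)[of a b Z c] E by simp_all
    show ?thesis
      using I[of X Y W Z] I[of "J X" "J Y" W Z] I[of "J X" Y W "J Z"] I[of X "J Y" W "J Z"]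
        I[of "J X" Y "J W" Z] I[of X "J Y" "J W" Z] I[of X Y "J W" "J Z"] I[of "J X" "J Y" "J W" "J Z"] that
      by (simp add: rw AJ3 r P_def)
  qed
  \<comment> \<open>Through \<open>PC\<close> the identity \<open>Pcyc\<close> becomes a cyclic sum
    over the last three slots of \<open>C\<close>. Since \<open>C\<close> is skew there, the three
    terms agree and each is zero.\<close>
  have C0: "C Z X Y W = 0" if "X\<in>E" "Y\<in>E" "Z\<in>E" "W\<in>E" for X Y Z W
  proof -
    note m = that
    show ?thesis
      using Pcyc[OF m(1,2,3,4)] PC[OF m(1,2,3,4)] PC[OF m(2,4,3,1)] PC[OF m(4,1,3,2)]
        Cskew(1)[OF m(3,1,2,4)] Cskew(2)[OF m(3,2,1,4)] Cskew(2)[OF m(3,1,2,4)] Cskew(1)[OF m(3,1,4,2)]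
      by linarith
  qed
  show ?thesis using B0[OF mem] C0[OF mem(2,3,1,4)] by (simp add: B_def C_def)
qed

text \<open>\<open>D\<close> plays the Levi-Civita connection. Being torsion free, it expresses the
  Lie bracket as \<open>D X Y - D Y X\<close>, which is the form of the bracket in
  \<open>act_bracket\<close> and \<open>jacobi\<close>. The axiom \<open>cyclic\<close> is the
  nearly Kaehler condition. All linearity is over the reals.\<close>

locale nearly_kaehler_module =
  fixes E :: "'x::real_vector set" and F :: "('a \<Rightarrow> real) set"
    and act :: "'x \<Rightarrow> ('a \<Rightarrow> real) \<Rightarrow> 'a \<Rightarrow> real"
    and h :: "'x \<Rightarrow> 'x \<Rightarrow> 'a \<Rightarrow> real"
    and J :: "'x \<Rightarrow> 'x" and D :: "'x \<Rightarrow> 'x \<Rightarrow> 'x"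
  assumes subspace_E: "subspace E"
    and act_add: "\<lbrakk>X \<in> E; f \<in> F; g \<in> F\<rbrakk> \<Longrightarrow> act X (f + g) = act X f + act X g"
    and act_scale: "\<lbrakk>X \<in> E; f \<in> F\<rbrakk> \<Longrightarrow> act X (c *\<^sub>R f) = c *\<^sub>R act X f"
    and h_closed: "\<lbrakk>X \<in> E; Y \<in> E\<rbrakk> \<Longrightarrow> h X Y \<in> F"
    and h_sym: "\<lbrakk>X \<in> E; Y \<in> E\<rbrakk> \<Longrightarrow> h X Y = h Y X"
    and h_add: "\<lbrakk>X \<in> E; Y \<in> E; Z \<in> E\<rbrakk> \<Longrightarrow> h (X + Y) Z = h X Z + h Y Z"
    and h_scale: "\<lbrakk>X \<in> E; Z \<in> E\<rbrakk> \<Longrightarrow> h (c *\<^sub>R X) Z = c *\<^sub>R h X Z"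
    and h_definite: "\<lbrakk>X \<in> E; h X X = 0\<rbrakk> \<Longrightarrow> X = 0"
    and J_closed: "X \<in> E \<Longrightarrow> J X \<in> E"
    and J_add: "\<lbrakk>X \<in> E; Y \<in> E\<rbrakk> \<Longrightarrow> J (X + Y) = J X + J Y"
    and J_scale: "X \<in> E \<Longrightarrow> J (c *\<^sub>R X) = c *\<^sub>R J X"
    and J_J: "X \<in> E \<Longrightarrow> J (J X) = - X"
    and h_J_J: "\<lbrakk>X \<in> E; Y \<in> E\<rbrakk> \<Longrightarrow> h (J X) (J Y) = h X Y"
    and D_closed: "\<lbrakk>X \<in> E; Y \<in> E\<rbrakk> \<Longrightarrow> D X Y \<in> E"
    and D_add_left: "\<lbrakk>X \<in> E; Y \<in> E; Z \<in> E\<rbrakk> \<Longrightarrow> D (X + Y) Z = D X Z + D Y Z"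
    and D_add_right: "\<lbrakk>X \<in> E; Y \<in> E; Z \<in> E\<rbrakk> \<Longrightarrow> D X (Y + Z) = D X Y + D X Z"
    and D_scale_left: "\<lbrakk>X \<in> E; Y \<in> E\<rbrakk> \<Longrightarrow> D (c *\<^sub>R X) Y = c *\<^sub>R D X Y"
    and D_scale_right: "\<lbrakk>X \<in> E; Y \<in> E\<rbrakk> \<Longrightarrow> D X (c *\<^sub>R Y) = c *\<^sub>R D X Y"
    and D_metric: "\<lbrakk>X \<in> E; Y \<in> E; Z \<in> E\<rbrakk> \<Longrightarrow> act X (h Y Z) = h (D X Y) Z + h Y (D X Z)"
    and act_bracket: "\<lbrakk>X \<in> E; Y \<in> E; f \<in> F\<rbrakk> \<Longrightarrow>
      act (D X Y - D Y X) f = act X (act Y f) - act Y (act X f)"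
    and jacobi: "\<lbrakk>X \<in> E; Y \<in> E; Z \<in> E\<rbrakk> \<Longrightarrow>
      (D X (D Y Z - D Z Y) - D (D Y Z - D Z Y) X) + (D Y (D Z X - D X Z) - D (D Z X - D X Z) Y)
      + (D Z (D X Y - D Y X) - D (D X Y - D Y X) Z) = 0"
    and cyclic: "\<lbrakk>X \<in> E; Y \<in> E; Z \<in> E\<rbrakk> \<Longrightarrow>
      h (D X (J Y) - J (D X Y)) Z = h (D Y (J Z) - J (D Y Z)) X"
begin

lemma minus_closed: "X \<in> E \<Longrightarrow> - X \<in> E"
  using subspace_E by (rule subspace_neg)

lemma add_closed: "X \<in> E \<Longrightarrow> Y \<in> E \<Longrightarrow> X + Y \<in> E"
  using subspace_E by (rule subspace_add)

lemma diff_closed: "X \<in> E \<Longrightarrow> Y \<in> E \<Longrightarrow> X - Y \<in> E"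
  using subspace_E by (rule subspace_diff)

lemma scale_closed: "X \<in> E \<Longrightarrow> c *\<^sub>R X \<in> E"
  using subspace_E by (rule subspace_scale)

lemma J_minus: "X \<in> E \<Longrightarrow> J (- X) = - J X"
  using J_scale[of X "-1"] by simp

lemma J_diff: "X \<in> E \<Longrightarrow> Y \<in> E \<Longrightarrow> J (X - Y) = J X - J Y"
  using J_add[of X "- Y"] by (simp add: J_minus minus_closed)

lemma h_minus: "X \<in> E \<Longrightarrow> Z \<in> E \<Longrightarrow> h (- X) Z = - h X Z"
  using h_scale[of X Z "-1"] by simp

lemma h_diff: "X \<in> E \<Longrightarrow> Y \<in> E \<Longrightarrow> Z \<in> E \<Longrightarrow> h (X - Y) Z = h X Z - h Y Z"
  using h_add[of X "- Y" Z] by (simp add: h_minus minus_closed)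

lemma h_add_right: "X \<in> E \<Longrightarrow> Y \<in> E \<Longrightarrow> Z \<in> E \<Longrightarrow> h X (Y + Z) = h X Y + h X Z"
  by (simp add: h_sym[of X] h_add add_closed)

lemma h_scale_right: "X \<in> E \<Longrightarrow> Z \<in> E \<Longrightarrow> h X (c *\<^sub>R Z) = c *\<^sub>R h X Z"
  by (simp add: h_sym[of X] h_scale scale_closed)

lemma h_minus_right: "X \<in> E \<Longrightarrow> Z \<in> E \<Longrightarrow> h X (- Z) = - h X Z"
  by (simp add: h_sym[of X] h_minus minus_closed)

lemma h_diff_right: "X \<in> E \<Longrightarrow> Y \<in> E \<Longrightarrow> Z \<in> E \<Longrightarrow> h X (Y - Z) = h X Y - h X Z"
  by (simp add: h_sym[of X] h_diff diff_closed)

lemma h_J: "X \<in> E \<Longrightarrow> Y \<in> E \<Longrightarrow> h (J X) Y = - h X (J Y)"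
  using h_J_J[of X "J Y"] by (simp add: J_J J_closed h_minus_right) (metis minus_minus)

lemma D_minus_left: "X \<in> E \<Longrightarrow> Y \<in> E \<Longrightarrow> D (- X) Y = - D X Y"
  using D_scale_left[of X Y "-1"] by simp

lemma D_minus_right: "X \<in> E \<Longrightarrow> Y \<in> E \<Longrightarrow> D X (- Y) = - D X Y"
  using D_scale_right[of X Y "-1"] by simp

lemma D_diff_left: "X \<in> E \<Longrightarrow> Y \<in> E \<Longrightarrow> Z \<in> E \<Longrightarrow> D (X - Y) Z = D X Z - D Y Z"
  using D_add_left[of X "- Y" Z] by (simp add: D_minus_left minus_closed)

lemma D_diff_right: "X \<in> E \<Longrightarrow> Y \<in> E \<Longrightarrow> Z \<in> E \<Longrightarrow> D X (Y - Z) = D X Y - D X Z"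
  using D_add_right[of X Y "- Z"] by (simp add: D_minus_right minus_closed)

lemma act_minus: "X \<in> E \<Longrightarrow> f \<in> F \<Longrightarrow> act X (- f) = - act X f"
  using act_scale[of X f "-1"] by simp

lemmas closed = minus_closed add_closed diff_closed scale_closed J_closed D_closed

lemmas linear =
  J_add J_scale J_minus J_diff h_add h_scale h_minus h_diff
  h_add_right h_scale_right h_minus_right h_diff_right D_add_left D_add_right D_scale_left D_scale_right
  D_minus_left D_minus_right D_diff_left D_diff_right

section \<open>The derivative of \<open>J\<close> and the canonical Hermitian connection\<close>

definition DJ :: "'x \<Rightarrow> 'x \<Rightarrow> 'x" where
  "DJ X Y = D X (J Y) - J (D X Y)"

lemma DJ_closed: "X \<in> E \<Longrightarrow> Y \<in> E \<Longrightarrow> DJ X Y \<in> E"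
  by (simp add: DJ_def closed)

text \<open>\<open>J\<close> is skew for \<open>h\<close> and \<open>D\<close> is metric:
  differentiating \<open>h (J Z) Y = - h Z (J Y)\<close> makes \<open>D_X J\<close> skew as
  well.\<close>

lemma h_DJ_skew: "h (DJ X Z) Y = - h (DJ X Y) Z" if "X \<in> E" "Y \<in> E" "Z \<in> E"
proof -
  have "act X (h (J Z) Y) = - act X (h Z (J Y))"
    using that by (simp add: h_J act_minus h_closed closed)
  then have "h (D X (J Z)) Y + h (J Z) (D X Y) + h (D X Z) (J Y) + h Z (D X (J Y)) = 0"
    using that by (simp add: D_metric closed algebra_simps)
  then show ?thesis
    using that by (simp add: DJ_def linear closed h_J h_sym[of Z] algebra_simps eq_neg_iff_add_eq_0)
qed

text \<open>Skewness in the last two slots and cyclic invariance make \<open>h (DJ X Y) Z\<close>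
  totally skew; definiteness of \<open>h\<close> strips off \<open>Z\<close>.\<close>

lemma DJ_skew: "DJ Y X = - DJ X Y" if "X \<in> E" "Y \<in> E"
proof -
  have "h (DJ X Y + DJ Y X) Z = 0" if Z: "Z \<in> E" for Z
  proof -
    have "h (DJ Y X) Z = - h (DJ Y Z) X" "h (DJ Y Z) X = h (DJ X Y) Z"
      using h_DJ_skew[of Y Z X] cyclic[of X Y Z] Z \<open>X \<in> E\<close> \<open>Y \<in> E\<close> by (simp_all flip: DJ_def)
    then show ?thesis using Z \<open>X \<in> E\<close> \<open>Y \<in> E\<close> by (simp add: h_add DJ_closed)
  qed
  then have "DJ X Y + DJ Y X = 0"
    using that by (intro h_definite) (simp_all add: closed DJ_closed)
  then show ?thesis by (simp add: eq_neg_iff_add_eq_0 add.commute)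
qed

text \<open>The canonical Hermitian connection \<open>D - 1/2 J (D J)\<close> of Gray.\<close>

definition nab :: "'x \<Rightarrow> 'x \<Rightarrow> 'x" where
  "nab X Y = (1/2) *\<^sub>R (D X Y - J (D X (J Y)))"

text \<open>The torsion of \<open>nab\<close> by \<open>torsion\<close>, and the Nijenhuis tensor by
  \<open>nijenhuis_eq\<close>.\<close>

definition T :: "'x \<Rightarrow> 'x \<Rightarrow> 'x" where
  "T X Y = - J (DJ X Y)"

lemma nab_closed: "X \<in> E \<Longrightarrow> Y \<in> E \<Longrightarrow> nab X Y \<in> E"
  by (simp add: nab_def closed)

lemma T_closed: "X \<in> E \<Longrightarrow> Y \<in> E \<Longrightarrow> T X Y \<in> E"
  by (simp add: T_def closed DJ_closed)

lemma torsion: "T X Y = nab X Y - nab Y X - (D X Y - D Y X)" if "X \<in> E" "Y \<in> E"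
proof -
  have "nab X Y - nab Y X - (D X Y - D Y X) = (1/2) *\<^sub>R (J (DJ Y X) - J (DJ X Y))"
    using that by (simp add: nab_def DJ_def linear closed J_J algebra_simps flip: scaleR_add_left)
  also have "J (DJ Y X) - J (DJ X Y) = (- 2) *\<^sub>R J (DJ X Y)"
    using that DJ_skew[OF that] by (simp add: linear DJ_closed scaleR_2)
  finally show ?thesis by (simp add: T_def)
qed

lemma nab_minus: "\<lbrakk>X \<in> E; Y \<in> E\<rbrakk> \<Longrightarrow> nab (- X) Y = - nab X Y" "\<lbrakk>X \<in> E; Y \<in> E\<rbrakk> \<Longrightarrow> nab X (- Y) = - nab X Y"
  by (simp_all add: nab_def linear closed algebra_simps)

lemma nab_diff: "\<lbrakk>X \<in> E; Y \<in> E; Z \<in> E\<rbrakk> \<Longrightarrow> nab (X - Y) Z = nab X Z - nab Y Z"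
    "\<lbrakk>X \<in> E; Y \<in> E; Z \<in> E\<rbrakk> \<Longrightarrow> nab X (Y - Z) = nab X Y - nab X Z"
  by (simp_all add: nab_def linear closed algebra_simps)

lemma nab_J: "\<lbrakk>X \<in> E; Y \<in> E\<rbrakk> \<Longrightarrow> nab X (J Y) = J (nab X Y)"
  by (simp add: nab_def linear closed J_J algebra_simps)

text \<open>\<open>nab\<close> is the mean of \<open>D\<close> and its conjugate by
  \<open>J\<close>; as \<open>J\<close> is orthogonal, the conjugate is metric too.\<close>

lemma nab_metric: "act X (h Y Z) = h (nab X Y) Z + h Y (nab X Z)" if "X \<in> E" "Y \<in> E" "Z \<in> E"
proof -
  have "2 *\<^sub>R (h (nab X Y) Z + h Y (nab X Z)) =
      h (D X Y) Z + h Y (D X Z) + (h (D X (J Y)) (J Z) + h (J Y) (D X (J Z)))"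
    using that by (simp add: nab_def linear closed h_J algebra_simps)
  also have "\<dots> = 2 *\<^sub>R act X (h Y Z)"
    using that D_metric[of X Y Z] D_metric[of X "J Y" "J Z"]
    by (simp add: h_J_J closed scaleR_2)
  finally show ?thesis by simp
qed

lemma T_skew: "T Y X = - T X Y" if "X \<in> E" "Y \<in> E"
  using that DJ_skew[OF that] by (simp add: T_def linear DJ_closed)

lemma T_self: "X \<in> E \<Longrightarrow> T X X = 0"
proof -
  assume "X \<in> E"
  then have "2 *\<^sub>R T X X = 0" using T_skew[of X X] by (simp add: scaleR_2 eq_neg_iff_add_eq_0)
  then show ?thesis by simp
qed

lemma h_self_J: "X \<in> E \<Longrightarrow> h X (J X) = 0"
proof -
  assume "X \<in> E"
  then have "2 *\<^sub>R h X (J X) = 0"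
    using h_J[of X X] h_sym[of X "J X"] by (simp add: scaleR_2 eq_neg_iff_add_eq_0 J_closed)
  then show ?thesis by simp
qed

lemma T_J: "T X (J Y) = - J (T X Y)" "T (J X) Y = - J (T X Y)" if "X \<in> E" "Y \<in> E"
proof -
  have *: "T X (J Y) = - J (T X Y)" if "X \<in> E" "Y \<in> E" for X Y
    using that by (simp add: T_def DJ_def linear closed J_J)
  show "T X (J Y) = - J (T X Y)" by (rule *[OF that])
  show "T (J X) Y = - J (T X Y)"
    using that *[of Y X] by (simp add: T_skew[of Y] J_minus T_closed closed)
qed

definition t :: "'x \<Rightarrow> 'x \<Rightarrow> 'x \<Rightarrow> 'a \<Rightarrow> real" where
  "t X Y Z = h (T X Y) Z"

lemma t_skew: "t Y X Z = - t X Y Z" if "X \<in> E" "Y \<in> E" "Z \<in> E"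
  using that by (simp add: t_def T_skew[of X Y] h_minus T_closed)

text \<open>Up to a \<open>J\<close> in the last slot this is the axiom \<open>cyclic\<close>.
  Differentiating \<open>J (J Z) = - Z\<close> shows that \<open>D_Y J\<close> anticommutes with
  \<open>J\<close>, which moves that \<open>J\<close> to where it belongs.\<close>

lemma t_cyclic: "t X Y Z = t Y Z X" if "X \<in> E" "Y \<in> E" "Z \<in> E"
proof -
  have *: "t X Y Z = h (DJ X Y) (J Z)" if "X \<in> E" "Y \<in> E" "Z \<in> E" for X Y Z
    using that by (simp add: t_def T_def h_minus h_J DJ_closed closed)
  have "t X Y Z = h (DJ Y (J Z)) X"
    using that cyclic[of X Y "J Z"] * by (simp add: DJ_def closed)
  also have "DJ Y (J Z) = - J (DJ Y Z)"
    using that by (simp add: DJ_def linear closed J_J)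
  finally show ?thesis using that by (simp add: t_def T_def)
qed

lemma t_skew': "t X Z Y = - t X Y Z" if "X \<in> E" "Y \<in> E" "Z \<in> E"
  using that t_cyclic t_skew by metis

lemma t_J: "t (J X) Y Z = t X (J Y) Z" if "X \<in> E" "Y \<in> E" "Z \<in> E"
  using that by (simp add: t_def T_J)

lemma T_self_J: "X \<in> E \<Longrightarrow> T X (J X) = 0" "X \<in> E \<Longrightarrow> T (J X) X = 0"
  using J_scale[of 0 0] by (simp_all add: T_J T_self subspace_0[OF subspace_E])

lemma h_zero: "X \<in> E \<Longrightarrow> h 0 X = 0" "X \<in> E \<Longrightarrow> h X 0 = 0"
  using h_scale[of X X 0] h_scale_right[of X X 0] by simp_all

text \<open>A cyclic shift puts two arguments from the same complex line into \<open>T\<close>,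
  where it vanishes. In real dimension six this confines \<open>T X Y\<close> to one complex line
  when \<open>X\<close> and \<open>Y\<close> are complex independent.\<close>

lemma h_T_orthogonal:
  assumes "X \<in> E" "Y \<in> E"
  shows "h (T X Y) X = 0" "h (T X Y) Y = 0" "h (T X Y) (J X) = 0" "h (T X Y) (J Y) = 0"
proof -
  have 1: "h (T X Y) X = 0" "h (T X Y) (J X) = 0" if "X \<in> E" "Y \<in> E" for X Y
    using that t_cyclic[of X X Y] t_cyclic[of "J X" X Y] by (simp_all add: t_def T_self T_self_J h_zero J_closed)
  have 2: "h (T X Y) Y = 0" "h (T X Y) (J Y) = 0"
    using assms 1[of Y X] by (simp_all add: T_skew[of Y X] h_minus T_closed J_closed)
  show "h (T X Y) X = 0" "h (T X Y) Y = 0" "h (T X Y) (J X) = 0" "h (T X Y) (J Y) = 0"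
    using 1[OF assms] 2 by simp_all
qed

section \<open>Curvature, the Bianchi identity and parallel torsion\<close>

definition R :: "'x \<Rightarrow> 'x \<Rightarrow> 'x \<Rightarrow> 'x" where
  "R X Y Z = nab X (nab Y Z) - nab Y (nab X Z) - nab (D X Y - D Y X) Z"

lemma R_closed: "X \<in> E \<Longrightarrow> Y \<in> E \<Longrightarrow> Z \<in> E \<Longrightarrow> R X Y Z \<in> E"
  by (simp add: R_def closed nab_closed)

lemma R_min:
  assumes "X \<in> E" "Y \<in> E" "Z \<in> E"
  shows "R X Y (- Z) = - R X Y Z" "R (- X) Y Z = - R X Y Z" "R X (- Y) Z = - R X Y Z"
proof -
  show "R X Y (- Z) = - R X Y Z"
    using assms by (simp add: R_def closed nab_closed nab_minus)
  have "D (- X) Y - D Y (- X) = - (D X Y - D Y X)" "D X (- Y) - D (- Y) X = - (D X Y - D Y X)"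
    using assms by (simp_all add: D_minus_left D_minus_right)
  then show "R (- X) Y Z = - R X Y Z" "R X (- Y) Z = - R X Y Z"
    using assms by (simp_all add: R_def nab_closed nab_minus closed del: minus_diff_eq)
qed

lemma R_J: "\<lbrakk>X \<in> E; Y \<in> E; Z \<in> E\<rbrakk> \<Longrightarrow> R X Y (J Z) = J (R X Y Z)"
  by (simp add: R_def linear closed nab_closed nab_J)

lemma R_metric: "h (R X Y Z) W = - h (R X Y W) Z" if "X \<in> E" "Y \<in> E" "Z \<in> E" "W \<in> E"
proof -
  have "h (nab (D X Y - D Y X) Z) W + h Z (nab (D X Y - D Y X) W) = act X (act Y (h Z W)) - act Y (act X (h Z W))"
    using that act_bracket[of X Y "h Z W"] by (simp add: h_closed nab_metric closed)
  moreover have "act X (act Y (h Z W)) = h (nab X (nab Y Z)) W + h (nab Y Z) (nab X W) + (h (nab X Z) (nab Y W) + h Z (nab X (nab Y W)))"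
    if "X \<in> E" "Y \<in> E" for X Y
    using that \<open>Z \<in> E\<close> \<open>W \<in> E\<close> by (simp add: nab_metric act_add h_closed nab_closed)
  ultimately have "h (R X Y Z) W + h Z (R X Y W) = 0"
    using that by (simp add: R_def linear closed nab_closed algebra_simps)
  then show ?thesis
    using that by (simp add: h_sym[of Z] R_closed eq_neg_iff_add_eq_0)
qed

text \<open>Express every bracket by \<open>nab\<close> and \<open>T\<close>. The \<open>nab\<close>
  terms cancel because \<open>J\<close> is parallel, and since \<open>T\<close> is antilinear in
  each slot, each of the four brackets contributes one \<open>T X Y\<close>; hence the factor
  4.\<close>

lemma nijenhuis_eq:
  assumes "X \<in> E" "Y \<in> E"
  defines "br \<equiv> \<lambda>X Y. D X Y - D Y X"
  shows "br (J X) (J Y) - J (br (J X) Y) - J (br X (J Y)) - br X Y = 4 *\<^sub>R T X Y"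
proof -
  have br: "br X Y = nab X Y - nab Y X - T X Y" if "X \<in> E" "Y \<in> E" for X Y
    using torsion[OF that] by (simp add: br_def)
  have "br (J X) (J Y) - J (br (J X) Y) - J (br X (J Y)) - br X Y = T X Y + T X Y + T X Y + T X Y"
    using assms(1,2) by (simp add: br J_closed nab_closed T_closed J_diff J_minus J_add add_closed diff_closed minus_closed nab_J T_J J_J)
  also have "\<dots> = 4 *\<^sub>R T X Y"
    using scaleR_left_distrib[of 2 2 "T X Y"] by (simp add: scaleR_2 add.assoc)
  finally show ?thesis .
qed

definition A :: "'x \<Rightarrow> 'x \<Rightarrow> 'x \<Rightarrow> 'x \<Rightarrow> 'a \<Rightarrow> real" where
  "A V X Y Z = act V (t X Y Z) - t (nab V X) Y Z - t X (nab V Y) Z - t X Y (nab V Z)"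

lemma A_eq: "A V X Y Z = h (nab V (T X Y) - T (nab V X) Y - T X (nab V Y)) Z"
  if "V \<in> E" "X \<in> E" "Y \<in> E" "Z \<in> E"
  using that by (simp add: A_def t_def nab_metric linear nab_closed T_closed closed algebra_simps)

lemma T_add: "\<lbrakk>X \<in> E; Y \<in> E; Z \<in> E\<rbrakk> \<Longrightarrow> T X (Y + Z) = T X Y + T X Z"
  by (simp add: T_def DJ_def linear closed algebra_simps)

lemma T_scale: "\<lbrakk>X \<in> E; Y \<in> E\<rbrakk> \<Longrightarrow> T X (c *\<^sub>R Y) = c *\<^sub>R T X Y"
  by (simp add: T_def DJ_def linear closed algebra_simps)

lemma T_minus: "\<lbrakk>X \<in> E; Y \<in> E\<rbrakk> \<Longrightarrow> T X (- Y) = - T X Y" "\<lbrakk>X \<in> E; Y \<in> E\<rbrakk> \<Longrightarrow> T (- X) Y = - T X Y"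
  by (simp_all add: T_def DJ_def linear closed algebra_simps)

lemma T_diff: "\<lbrakk>X \<in> E; Y \<in> E; Z \<in> E\<rbrakk> \<Longrightarrow> T X (Y - Z) = T X Y - T X Z"
  by (simp add: T_def DJ_def linear closed algebra_simps)

text \<open>This is the Jacobi identity, rewritten with brackets expressed through
  \<open>nab\<close> and its torsion.\<close>

lemma bianchi:
  assumes "X \<in> E" "Y \<in> E" "Z \<in> E"
  shows "R X Y Z + R Y Z X + R Z X Y =
    (nab X (T Y Z) - T (nab X Y) Z - T Y (nab X Z)) + (nab Y (T Z X) - T (nab Y Z) X - T Z (nab Y X))
    + (nab Z (T X Y) - T (nab Z X) Y - T X (nab Z Y)) - T X (T Y Z) - T Y (T Z X) - T Z (T X Y)"
proof -
  define br where "br X Y = D X Y - D Y X" for X Y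
  have br_closed: "br X Y \<in> E" if "X \<in> E" "Y \<in> E" for X Y using that by (simp add: br_def closed)
  have br: "br X Y = nab X Y - nab Y X - T X Y" if "X \<in> E" "Y \<in> E" for X Y
    using torsion[OF that] by (simp add: br_def)
  have jac: "br X (br Y Z) + br Y (br Z X) + br Z (br X Y) = 0"
    using jacobi[OF assms] by (simp add: br_def)
  \<comment> \<open>Exchanging the two arguments of \<open>nab (br X Y) Z\<close> costs a torsion
    term and the double bracket \<open>br Z (br X Y)\<close>; the double brackets cancel in the
    cyclic sum.\<close>
  have R: "R X Y Z = nab X (nab Y Z) - nab Y (nab X Z) - nab Z (br X Y) + T Z (br X Y) + br Z (br X Y)"
    if "X \<in> E" "Y \<in> E" "Z \<in> E" for X Y Z
    using that br[of Z "br X Y"] br_closed by (simp add: R_def flip: br_def)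
  have N: "nab Z (br X Y) = nab Z (nab X Y) - nab Z (nab Y X) - nab Z (T X Y)"
     "T Z (br X Y) = T Z (nab X Y) - T Z (nab Y X) - T Z (T X Y)"
    if "X \<in> E" "Y \<in> E" "Z \<in> E" for X Y Z
    using that by (simp_all add: br nab_diff T_diff nab_closed T_closed closed)
  have "R X Y Z + R Y Z X + R Z X Y =
    (nab X (T Y Z) + T X (nab Y Z) - T X (nab Z Y)) + (nab Y (T Z X) + T Y (nab Z X) - T Y (nab X Z))
    + (nab Z (T X Y) + T Z (nab X Y) - T Z (nab Y X)) - T X (T Y Z) - T Y (T Z X) - T Z (T X Y)
    + (br X (br Y Z) + br Y (br Z X) + br Z (br X Y))"
    using assms by (simp add: R N algebra_simps)
  then show ?thesis
    unfolding jac using assms T_skew[of "nab X Y" Z] T_skew[of "nab Y Z" X] T_skew[of "nab Z X" Y]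
    by (simp add: nab_closed algebra_simps)
qed

text \<open>\<open>A\<close> inherits the symmetries of \<open>t\<close> because \<open>nab\<close>
  commutes with \<open>J\<close>. The hypotheses of \<open>kirichenko_pointwise\<close> are then met
  by the values at each single \<open>p\<close>.\<close>

theorem torsion_parallel:
  assumes "V \<in> E" "X \<in> E" "Y \<in> E" "Z \<in> E"
  shows "act V (t X Y Z) = t (nab V X) Y Z + t X (nab V Y) Z + t X Y (nab V Z)"
proof -
  have tF: "t X Y Z \<in> F" if "X \<in> E" "Y \<in> E" "Z \<in> E" for X Y Z
    using that by (simp add: t_def h_closed T_closed)
  have t_min: "t (- X) Y Z = - t X Y Z" if "X \<in> E" "Y \<in> E" "Z \<in> E" for X Y Z
    using that by (simp add: t_def T_minus h_minus T_closed)
  have A1: "A V Y X Z = - A V X Y Z" if "V \<in> E" "X \<in> E" "Y \<in> E" "Z \<in> E" for V X Y Z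
    using that t_skew[of X Y Z] t_skew[of "nab V X" Y Z] t_skew[of X "nab V Y" Z] t_skew[of X Y "nab V Z"]
    by (simp add: A_def nab_closed act_minus tF algebra_simps)
  have A2: "A V X Z Y = - A V X Y Z" if "V \<in> E" "X \<in> E" "Y \<in> E" "Z \<in> E" for V X Y Z
    using that t_skew'[of X Y Z] t_skew'[of "nab V X" Y Z] t_skew'[of X "nab V Y" Z] t_skew'[of X Y "nab V Z"]
    by (simp add: A_def nab_closed act_minus tF algebra_simps)
  have A3: "A V X (J Y) Z = A V (J X) Y Z" if "V \<in> E" "X \<in> E" "Y \<in> E" "Z \<in> E" for V X Y Z
    using that by (simp add: A_def nab_closed nab_J t_J closed)
  have A4: "A V (- X) Y Z = - A V X Y Z" if "V \<in> E" "X \<in> E" "Y \<in> E" "Z \<in> E" for V X Y Z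
    using that by (simp add: A_def nab_closed nab_minus t_min act_minus tF closed)
  \<comment> \<open>\<open>S\<close> is \<open>A\<close> with the metric stripped off. It gives the
    sign rule in \<open>V\<close>, which \<open>act\<close> does not provide as it is axiomatised as
    linear in the function alone, and it is the expression occurring in
    \<open>bianchi\<close>.\<close>
  define S where "S V X Y = nab V (T X Y) - T (nab V X) Y - T X (nab V Y)" for V X Y
  have S_closed: "S V X Y \<in> E" if "V \<in> E" "X \<in> E" "Y \<in> E" for V X Y
    using that by (simp add: S_def nab_closed T_closed closed)
  have AS: "A V X Y Z = h (S V X Y) Z" if "V \<in> E" "X \<in> E" "Y \<in> E" "Z \<in> E" for V X Y Z
    using A_eq[OF that] by (simp add: S_def)
  have S_min: "S (- V) X Y = - S V X Y" if "V \<in> E" "X \<in> E" "Y \<in> E" for V X Y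
    using that by (simp add: S_def nab_minus T_minus nab_closed T_closed)
  have A5: "A (- V) X Y Z = - A V X Y Z" if "V \<in> E" "X \<in> E" "Y \<in> E" "Z \<in> E" for V X Y Z
    using that by (simp add: AS S_min h_minus S_closed minus_closed)
  have I: "h (R X Y Z) W + h (R Y Z X) W + h (R Z X Y) W = A X Y Z W + A Y Z X W + A Z X Y W
      - h (T X (T Y Z)) W - h (T Y (T Z X)) W - h (T Z (T X Y)) W"
    if "X \<in> E" "Y \<in> E" "Z \<in> E" "W \<in> E" for X Y Z W
  proof -
    have 1: "h (R X Y Z) W + h (R Y Z X) W + h (R Z X Y) W = h (R X Y Z + R Y Z X + R Z X Y) W"
      using that by (simp only: h_add R_closed add_closed)
    have 2: "R X Y Z + R Y Z X + R Z X Y = S X Y Z + S Y Z X + S Z X Y - T X (T Y Z) - T Y (T Z X) - T Z (T X Y)"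
      unfolding S_def by (rule bianchi[OF that(1-3)])
    have 3: "h (S X Y Z + S Y Z X + S Z X Y - T X (T Y Z) - T Y (T Z X) - T Z (T X Y)) W = A X Y Z W + A Y Z X W + A Z X Y W
      - h (T X (T Y Z)) W - h (T Y (T Z X)) W - h (T Z (T X Y)) W"
      using that by (simp only: AS h_add h_diff S_closed T_closed add_closed diff_closed)
    show ?thesis unfolding 1 2 3 ..
  qed
  have "A V X Y Z p = 0" for p
  proof (rule kirichenko_pointwise[where E = E and J = J and A = "\<lambda>V X Y Z. A V X Y Z p"
        and R = "\<lambda>X Y Z W. h (R X Y Z) W p" and Q = "\<lambda>X Y Z W. h (T X (T Y Z)) W p"])
    show "h (R X Y Z) W p + h (R Y Z X) W p + h (R Z X Y) W p = A X Y Z W p + A Y Z X W p + A Z X Y W p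
      - h (T X (T Y Z)) W p - h (T Y (T Z X)) W p - h (T Z (T X Y)) W p"
      if "X \<in> E" "Y \<in> E" "Z \<in> E" "W \<in> E" for X Y Z W
      using fun_cong[OF I[OF that], of p] by simp
    show "h (R X Y W) Z p = - h (R X Y Z) W p" if "X \<in> E" "Y \<in> E" "Z \<in> E" "W \<in> E" for X Y Z W
      using R_metric[of X Y W Z] that by simp
    show "h (T X (T Y (J Z))) W p = h (T X (T (J Y) Z)) W p"
      "h (T X (T Y Z)) (J W) p = h (T (J X) (T Y Z)) W p"
      "h (T X (T (J Y) Z)) W p = - h (T (J X) (T Y Z)) W p"
      "h (T X (T (- Y) Z)) W p = - h (T X (T Y Z)) W p"
      "h (T (- X) (T Y Z)) W p = - h (T X (T Y Z)) W p"
      if "X \<in> E" "Y \<in> E" "Z \<in> E" "W \<in> E" for X Y Z W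
      using that by (simp_all add: T_J T_minus T_closed J_closed J_J J_minus h_J h_minus minus_closed)
    show "h (R X Y (- Z)) W p = - h (R X Y Z) W p" "h (R (- X) Y Z) W p = - h (R X Y Z) W p"
      "h (R X (- Y) Z) W p = - h (R X Y Z) W p" "h (R X Y Z) (J W) p = - h (R X Y (J Z)) W p"
      if "X \<in> E" "Y \<in> E" "Z \<in> E" "W \<in> E" for X Y Z W
      using that by (simp_all add: R_min R_J R_closed h_minus h_J J_closed)
    show "A V Y X Z p = - A V X Y Z p" "A V X Z Y p = - A V X Y Z p"
      if "V \<in> E" "X \<in> E" "Y \<in> E" "Z \<in> E" for V X Y Z
      using fun_cong[OF A1[OF that], of p] fun_cong[OF A2[OF that], of p] by simp_all
  qed (simp_all add: assms J_closed J_J A3 A4 A5)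
  then have "A V X Y Z = 0" by (simp add: fun_eq_iff)
  then show ?thesis by (simp add: A_def algebra_simps)
qed

end

section \<open>Tangent vectors and vector fields\<close>

lemma scaleR_fun_apply [simp]: "(c *\<^sub>R f) x = c *\<^sub>R f x"
  by (simp add: scaleR_fun_def)

lemma sum_fun_apply: "(\<Sum>i\<in>I. f i) x = (\<Sum>i\<in>I. f i x)"
  by (induction I rule: infinite_finite_induct) simp_all

lemma tcomb_eq: "tcomb a v b w = a *\<^sub>R v + b *\<^sub>R w"
  by (auto simp: tcomb_def)

lemma tzero_eq: "tzero = 0"
  by (auto simp: tzero_def)

locale smooth_atlas =
  fixes M :: "'a topology" and A :: "('a, 'e::euclidean_space) atlas"
  assumes manifold: "smooth_manifold M A"
begin

lemma
  assumes "(U, \<phi>) \<in> A"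
  shows chart_openin: "openin M U" and chart_open: "open (\<phi> ` U)"
    and chart_homeo: "homeomorphic_map (subtopology M U) (top_of_set (\<phi> ` U)) \<phi>"
  using manifold assms by (auto simp: smooth_manifold_def)

lemma chart_topspace: "(U, \<phi>) \<in> A \<Longrightarrow> topspace (subtopology M U) = U"
  using openin_subset[OF chart_openin] by (auto simp: topspace_subtopology)

lemma chart_inj: "(U, \<phi>) \<in> A \<Longrightarrow> inj_on \<phi> U"
  using homeomorphic_imp_injective_map[OF chart_homeo] chart_topspace by metis

lemma chart_image_open:
  assumes "(U, \<phi>) \<in> A" "openin M W" "W \<subseteq> U"
  shows "open (\<phi> ` W)"
proof -
  have "openin (subtopology M U) W"
    using assms by (metis inf.absorb1 inf.absorb_iff2 openin_subtopology openin_subtopology_Int)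
  then have "openin (top_of_set (\<phi> ` U)) (\<phi> ` W)"
    using homeomorphic_imp_open_map[OF chart_homeo[OF assms(1)]] by (simp add: open_map_def)
  then show ?thesis
    using chart_open[OF assms(1)] by (simp add: openin_open_eq)
qed

lemma chart_image_Int_open: "(U, \<phi>) \<in> A \<Longrightarrow> openin M W \<Longrightarrow> open (\<phi> ` (U \<inter> W))"
  by (rule chart_image_open[where U = U]) (auto intro: chart_openin)

lemma chart_preimage_open:
  assumes "(U, \<phi>) \<in> A" "open B"
  shows "openin M {q \<in> U. \<phi> q \<in> B}"
proof -
  have "continuous_map (subtopology M U) (top_of_set (\<phi> ` U)) \<phi>"
    using homeomorphic_imp_continuous_map[OF chart_homeo[OF assms(1)]] .
  then have "continuous_map (subtopology M U) euclidean \<phi>"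
    using continuous_map_into_fulltopology by blast
  then have "openin (subtopology M U) {q \<in> topspace (subtopology M U). \<phi> q \<in> B}"
    using assms(2) by (auto simp: continuous_map_def)
  then have "openin (subtopology M U) {q \<in> U. \<phi> q \<in> B}"
    by (simp only: chart_topspace[OF assms(1)])
  then show ?thesis
    using chart_openin[OF assms(1)] openin_open_subtopology by blast
qed

lemma chart_inv: "(U, \<phi>) \<in> A \<Longrightarrow> q \<in> U \<Longrightarrow> inv_into U \<phi> (\<phi> q) = q"
  using chart_inj inv_into_f_f by metis

lemma chart_at:
  assumes "p \<in> topspace M"
  obtains U \<phi> where "(U, \<phi>) \<in> A" "p \<in> U"
proof -
  have "(\<Union>(U, \<phi>)\<in>A. U) = topspace M"
    using manifold unfolding smooth_manifold_def by blast
  then show ?thesis using assms that by blast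
qed

section \<open>Smooth functions and germs\<close>

abbreviation smooth :: "'a set \<Rightarrow> ('a \<Rightarrow> real) \<Rightarrow> bool" where
  "smooth \<equiv> smooth_fun_on M A"

lemma smooth_openin: "smooth W f \<Longrightarrow> openin M W"
  by (simp add: smooth_fun_on_def)

lemma smoothI:
  assumes "openin M W" "\<And>U \<phi>. (U, \<phi>) \<in> A \<Longrightarrow> open (\<phi> ` (U \<inter> W)) \<Longrightarrow> smooth_on (\<phi> ` (U \<inter> W)) (\<lambda>x. f (inv_into U \<phi> x))"
  shows "smooth W f"
  using assms chart_image_Int_open[OF _ assms(1)] by (auto simp: smooth_fun_on_def o_def)

lemma smoothD:
  assumes "smooth W f" "(U, \<phi>) \<in> A"
  shows "smooth_on (\<phi> ` (U \<inter> W)) (\<lambda>x. f (inv_into U \<phi> x))"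
  using assms by (auto simp: smooth_fun_on_def o_def)

lemma smooth_subset: "smooth W f \<Longrightarrow> openin M W' \<Longrightarrow> W' \<subseteq> W \<Longrightarrow> smooth W' f"
  by (rule smoothI) (auto intro: smooth_on_subset[OF smoothD])

lemma smooth_cong:
  assumes "smooth W f" "\<And>q. q \<in> W \<Longrightarrow> f q = g q"
  shows "smooth W g"
proof (rule smoothI)
  show "openin M W" using assms(1) by (rule smooth_openin)
  fix U \<phi> assume c: "(U, \<phi>) \<in> A" and o: "open (\<phi> ` (U \<inter> W))"
  have eq: "f (inv_into U \<phi> x) = g (inv_into U \<phi> x)" if "x \<in> \<phi> ` (U \<inter> W)" for x
    using that assms(2) chart_inv[OF c] by auto
  show "smooth_on (\<phi> ` (U \<inter> W)) (\<lambda>x. g (inv_into U \<phi> x))"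
    by (rule iffD1[OF smooth_on_cong[OF o eq] smoothD[OF assms(1) c]])
qed

lemma smooth_const: "openin M W \<Longrightarrow> smooth W (\<lambda>q. c)"
  by (rule smoothI) (simp_all add: smooth_on_const)

lemma smooth_add: "smooth W f \<Longrightarrow> smooth W g \<Longrightarrow> smooth W (\<lambda>q. f q + g q)"
  by (rule smoothI) (simp_all add: smooth_openin smooth_on_add smoothD)

lemma smooth_mult: "smooth W f \<Longrightarrow> smooth W g \<Longrightarrow> smooth W (\<lambda>q. f q * g q)"
  by (rule smoothI) (simp_all add: smooth_openin smooth_on_mult smoothD)

lemma smooth_lincomb: "smooth W f \<Longrightarrow> smooth W g \<Longrightarrow> smooth W (\<lambda>q. a * f q + b * g q)"
  by (intro smooth_add smooth_mult smooth_const) (auto dest: smooth_openin)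

text \<open>Composing with the transition maps carries smoothness in one chart over to all of
  them.\<close>

lemma smooth_chart:
  assumes c: "(U, \<phi>) \<in> A" and W: "openin M W" "W \<subseteq> U" and G: "smooth_on (\<phi> ` W) G"
  shows "smooth W (\<lambda>q. G (\<phi> q))"
proof (rule smoothI[OF W(1)])
  fix V \<psi> assume d: "(V, \<psi>) \<in> A" and o: "open (\<psi> ` (V \<inter> W))"
  have "smooth_on (\<psi> ` (V \<inter> U)) (\<phi> \<circ> inv_into V \<psi>)"
    using manifold c d unfolding smooth_manifold_def by fast
  then have "smooth_on (\<psi> ` (V \<inter> W)) (\<lambda>x. \<phi> (inv_into V \<psi> x))"
    using W by (auto simp: o_def intro: smooth_on_subset)
  then show "smooth_on (\<psi> ` (V \<inter> W)) (\<lambda>x. G (\<phi> (inv_into V \<psi> x)))"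
    using chart_inv[OF d] by (intro smooth_on_compose[OF o _ G]) auto
qed

lemma smooth_coord: "(U, \<phi>) \<in> A \<Longrightarrow> smooth U (\<lambda>q. \<phi> q \<bullet> b)"
  by (rule smooth_chart[where G = "\<lambda>x. x \<bullet> b"]) (auto intro: chart_openin chart_open smooth_on_inner)

lemma smooth_scale: "smooth W f \<Longrightarrow> smooth W (\<lambda>q. c * f q)"
  using smooth_lincomb[of W f f c 0] by simp

abbreviation near :: "'a \<Rightarrow> ('a \<Rightarrow> real) \<Rightarrow> bool" where
  "near \<equiv> smooth_near M A"

lemma nearI: "smooth W f \<Longrightarrow> p \<in> W \<Longrightarrow> near p f"
  by (auto simp: smooth_near_def)

lemma nearE:
  assumes "near p f" "openin M W" "p \<in> W"
  obtains W' where "W' \<subseteq> W" "p \<in> W'" "smooth W' f" "openin M W'"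
proof -
  obtain V where V: "p \<in> V" "smooth V f" using assms by (auto simp: smooth_near_def)
  then have "openin M (V \<inter> W)" using assms smooth_openin by blast
  then show ?thesis using that[of "V \<inter> W"] V assms smooth_subset[OF V(2)] by auto
qed

lemma near_cong:
  assumes "near p f" "openin M W" "p \<in> W" "\<And>q. q \<in> W \<Longrightarrow> f q = g q"
  shows "near p g"
proof -
  obtain W' where "W' \<subseteq> W" "p \<in> W'" "smooth W' f" using nearE[OF assms(1-3)] by metis
  then show ?thesis using assms(4) smooth_cong[of W' f g] nearI by blast
qed

lemma near_topspace: "near p f \<Longrightarrow> p \<in> topspace M"
  by (auto simp: smooth_near_def dest!: smooth_openin openin_subset)

lemma near_lincomb:
  assumes "near p f" "near p g" shows "near p (\<lambda>q. a * f q + b * g q)"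
proof -
  obtain V where V: "p \<in> V" "smooth V f" using assms by (auto simp: smooth_near_def)
  obtain W where W: "p \<in> W" "smooth W g" "W \<subseteq> V"
    using nearE[OF assms(2) smooth_openin[OF V(2)] V(1)] by metis
  then show ?thesis using V smooth_lincomb smooth_subset smooth_openin nearI by metis
qed

lemma near_mult:
  assumes "near p f" "near p g" shows "near p (\<lambda>q. f q * g q)"
proof -
  obtain V where V: "p \<in> V" "smooth V f" using assms by (auto simp: smooth_near_def)
  obtain W where W: "p \<in> W" "smooth W g" "W \<subseteq> V"
    using nearE[OF assms(2) smooth_openin[OF V(2)] V(1)] by metis
  then show ?thesis using V smooth_mult smooth_subset smooth_openin nearI by metis
qed

section \<open>Derivations at a point\<close>

abbreviation Tan :: "'a \<Rightarrow> 'a tvec set" where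
  "Tan \<equiv> tangent_space M A"

lemma tangent_lincomb:
  "v \<in> Tan p \<Longrightarrow> near p f \<Longrightarrow> near p g \<Longrightarrow> v (\<lambda>q. a * f q + b * g q) = a * v f + b * v g"
  by (simp add: tangent_space_def)

lemma tangent_mult:
  "v \<in> Tan p \<Longrightarrow> near p f \<Longrightarrow> near p g \<Longrightarrow> v (\<lambda>q. f q * g q) = f p * v g + g p * v f"
  by (simp add: tangent_space_def)

lemma tangent_not_near: "v \<in> Tan p \<Longrightarrow> \<not> near p f \<Longrightarrow> v f = 0"
  by (simp add: tangent_space_def)

lemma tangent_add: "v \<in> Tan p \<Longrightarrow> near p f \<Longrightarrow> near p g \<Longrightarrow> v (\<lambda>q. f q + g q) = v f + v g"
  using tangent_lincomb[of v p f g 1 1] by simp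

lemma tangent_diff: "v \<in> Tan p \<Longrightarrow> near p f \<Longrightarrow> near p g \<Longrightarrow> v (\<lambda>q. f q - g q) = v f - v g"
  using tangent_lincomb[of v p f g 1 "-1"] by simp

lemma tangent_scale: "v \<in> Tan p \<Longrightarrow> near p f \<Longrightarrow> v (\<lambda>q. c * f q) = c * v f"
  using tangent_lincomb[of v p f f c 0] by simp

lemma tangent_cong:
  assumes v: "v \<in> Tan p" and W: "openin M W" "p \<in> W" and eq: "\<And>q. q \<in> W \<Longrightarrow> f q = g q"
  shows "v f = v g"
proof (cases "near p f")
  case True
  have g: "near p g" using near_cong[OF True W] eq by blast
  define k where "k q = f q - g q" for q
  \<comment> \<open>The indicator of the complement of \<open>W\<close>: it is zero near
    \<open>p\<close>, and \<open>k * e = k\<close> because \<open>k\<close> vanishes on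
    \<open>W\<close>. Both factors vanish at \<open>p\<close>, so the Leibniz rule gives
    \<open>v k = 0\<close>.\<close>
  define e where "e q = (if q \<in> W then 0 else 1::real)" for q
  have "near p k"
    using near_lincomb[OF True g, of 1 "-1"] by (simp add: k_def[abs_def])
  moreover have "near p e"
    using W by (intro nearI[OF smooth_cong[OF smooth_const[of W 0]]]) (auto simp: e_def)
  ultimately have "v (\<lambda>q. k q * e q) = k p * v e + e p * v k"
    using tangent_mult[OF v] by blast
  moreover have "(\<lambda>q. k q * e q) = k"
    using eq by (auto simp: k_def e_def)
  ultimately have "v k = 0"
    using W eq by (simp add: k_def e_def)
  moreover have "v k = v f - v g"
    using tangent_diff[OF v True g] by (simp add: k_def[abs_def])
  ultimately show ?thesis by simp
next
  case False
  moreover have "\<not> near p g" using near_cong[of p g W f] False W eq by auto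
  ultimately show ?thesis using tangent_not_near[OF v] by simp
qed

lemma tangent_const:
  assumes v: "v \<in> Tan p" shows "v (\<lambda>q. c) = 0"
proof (cases "p \<in> topspace M")
  case True
  then have n: "near p (\<lambda>q. c)" for c
    by (rule nearI[OF smooth_const[OF openin_topspace]])
  have "v (\<lambda>q. 1) = 0"
    using tangent_mult[OF v n[of 1] n[of 1]] by simp
  then show ?thesis using tangent_scale[OF v n[of 1], of c] by simp
next
  case False
  then show ?thesis using v near_topspace tangent_not_near by blast
qed

lemma near_sum:
  "p \<in> topspace M \<Longrightarrow> (\<And>i. i \<in> I \<Longrightarrow> near p (f i)) \<Longrightarrow> near p (\<lambda>q. \<Sum>i\<in>I. f i q)"
proof (induction I rule: infinite_finite_induct)
  case (insert i I)
  then show ?case using near_lincomb[of p "f i" "\<lambda>q. \<Sum>i\<in>I. f i q" 1 1] by simp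
qed (auto intro: nearI[OF smooth_const[OF openin_topspace]])

lemma tangent_sum:
  assumes "v \<in> Tan p" "p \<in> topspace M" "\<And>i. i \<in> I \<Longrightarrow> near p (f i)"
  shows "v (\<lambda>q. \<Sum>i\<in>I. f i q) = (\<Sum>i\<in>I. v (f i))"
  using assms(3)
proof (induction I rule: infinite_finite_induct)
  case (insert i I)
  then show ?case using tangent_add[OF assms(1), of "f i" "\<lambda>q. \<Sum>i\<in>I. f i q"] near_sum[OF assms(2), of I f] by simp
qed (simp_all add: tangent_const[OF assms(1)])

lemma subspace_tangent: "subspace (Tan p)"
  unfolding subspace_def
  by (auto simp: tangent_space_def algebra_simps)

lemma tangent_eqI:
  "v \<in> Tan p \<Longrightarrow> w \<in> Tan p \<Longrightarrow> (\<And>f. near p f \<Longrightarrow> v f = w f) \<Longrightarrow> v = w"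
  by (rule ext) (metis tangent_not_near)

text \<open>The partial derivative in the chart. The value zero on functions that are not smooth
  near \<open>p\<close> is the convention of \<open>tangent_space\<close>.\<close>

definition coord_vector :: "'a set \<Rightarrow> ('a \<Rightarrow> 'e) \<Rightarrow> 'e \<Rightarrow> 'a \<Rightarrow> 'a tvec" where
  "coord_vector U \<phi> b p =
    (\<lambda>f. if near p f then frechet_derivative (\<lambda>x. f (inv_into U \<phi> x)) (at (\<phi> p)) b else 0)"

lemma near_has_derivative:
  assumes c: "(U, \<phi>) \<in> A" and p: "p \<in> U" and f: "near p f"
  shows "((\<lambda>x. f (inv_into U \<phi> x)) has_derivative frechet_derivative (\<lambda>x. f (inv_into U \<phi> x)) (at (\<phi> p))) (at (\<phi> p))"
proof -
  obtain W where "p \<in> W" "smooth W f" using f by (auto simp: smooth_near_def)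
  then show ?thesis using smooth_on_has_derivative[OF smoothD[OF _ c]] p by blast
qed

lemma coord_vector_tangent:
  assumes c: "(U, \<phi>) \<in> A" and p: "p \<in> U"
  shows "coord_vector U \<phi> b p \<in> Tan p"
proof -
  have "coord_vector U \<phi> b p (\<lambda>q. s * f q + t * g q) = s * coord_vector U \<phi> b p f + t * coord_vector U \<phi> b p g"
      "coord_vector U \<phi> b p (\<lambda>q. f q * g q) = f p * coord_vector U \<phi> b p g + g p * coord_vector U \<phi> b p f"
    if "near p f" "near p g" for f g s t
  proof -
    note f = near_has_derivative[OF c p that(1)] and g = near_has_derivative[OF c p that(2)]
    show "coord_vector U \<phi> b p (\<lambda>q. s * f q + t * g q) = s * coord_vector U \<phi> b p f + t * coord_vector U \<phi> b p g"
      using frechet_derivative_at[OF has_derivative_add[OF has_derivative_mult_right[OF f, of s] has_derivative_mult_right[OF g, of t]]]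
        that near_lincomb[OF that] by (simp add: coord_vector_def fun_eq_iff)
    show "coord_vector U \<phi> b p (\<lambda>q. f q * g q) = f p * coord_vector U \<phi> b p g + g p * coord_vector U \<phi> b p f"
      using fun_cong[OF frechet_derivative_at[OF has_derivative_mult[OF f g]], of b, symmetric]
        that near_mult[OF that] by (simp add: coord_vector_def chart_inv[OF c p] mult.commute)
  qed
  then show ?thesis by (auto simp: tangent_space_def coord_vector_def)
qed

text \<open>Hadamard's lemma shows that the coordinate vectors span the space of derivations.\<close>

lemma tangent_expand:
  assumes c: "(U, \<phi>) \<in> A" and p: "p \<in> U" and v: "v \<in> Tan p"
  shows "v = (\<Sum>b\<in>Basis. v (\<lambda>q. \<phi> q \<bullet> b) *\<^sub>R coord_vector U \<phi> b p)"
proof (rule tangent_eqI[OF v])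
  show "(\<Sum>b\<in>Basis. v (\<lambda>q. \<phi> q \<bullet> b) *\<^sub>R coord_vector U \<phi> b p) \<in> Tan p"
    by (intro subspace_sum[OF subspace_tangent] subspace_scale[OF subspace_tangent] coord_vector_tangent c p)
  fix f assume f: "near p f"
  have pM: "p \<in> topspace M" using f by (rule near_topspace)
  let ?f = "\<lambda>x. f (inv_into U \<phi> x)"
  obtain W where W: "W \<subseteq> U" "p \<in> W" "smooth W f" "openin M W"
    using nearE[OF f chart_openin[OF c] p] by metis
  then have "open (\<phi> ` W)" using chart_image_open[OF c] by blast
  then obtain r where r: "r > 0" "ball (\<phi> p) r \<subseteq> \<phi> ` W"
    using W(2) open_contains_ball by blast
  have sm: "smooth_on (\<phi> ` W) ?f" using smoothD[OF W(3) c] W(1) by (simp add: Int_absorb1)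
  obtain g where g: "\<And>b. smooth_on (ball (\<phi> p) r) (g b)"
    and fg: "\<And>x. x \<in> ball (\<phi> p) r \<Longrightarrow> ?f x = ?f (\<phi> p) + (\<Sum>b\<in>Basis. ((x - \<phi> p) \<bullet> b) * g b x)"
    and gp: "\<And>b. g b (\<phi> p) = frechet_derivative ?f (at (\<phi> p)) b"
    by (rule hadamard[OF smooth_on_subset[OF sm r(2)]]) (rule that)
  \<comment> \<open>The part of the chart lying over the ball, so that Hadamard's formula holds at
    every point of it.\<close>
  define V where "V = {q \<in> U. \<phi> q \<in> ball (\<phi> p) r}"
  have V: "openin M V" "V \<subseteq> U" "p \<in> V"
    using chart_preimage_open[OF c open_ball] p r(1) by (auto simp: V_def)
  have ng: "near p (\<lambda>q. g b (\<phi> q))" for b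
    by (rule nearI[OF smooth_chart[OF c V(1,2)] V(3)], rule smooth_on_subset[OF g]) (auto simp: V_def)
  have nc: "near p (\<lambda>q. c)" for c
    by (rule nearI[OF smooth_const[OF openin_topspace] pM])
  have nx: "near p (\<lambda>q. \<phi> q \<bullet> b)" for b
    using smooth_coord[OF c] p nearI by blast
  have nd: "near p (\<lambda>q. (\<phi> q - \<phi> p) \<bullet> b)" for b
    using near_lincomb[OF nx nc, of 1 b "-1" "\<phi> p \<bullet> b"] by (simp add: inner_diff_left)
  have vd: "v (\<lambda>q. (\<phi> q - \<phi> p) \<bullet> b) = v (\<lambda>q. \<phi> q \<bullet> b)" for b
    using tangent_diff[OF v nx[of b] nc[of "\<phi> p \<bullet> b"]] by (simp add: inner_diff_left tangent_const[OF v])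
  have "v f = v (\<lambda>q. f p + (\<Sum>b\<in>Basis. ((\<phi> q - \<phi> p) \<bullet> b) * g b (\<phi> q)))"
  proof (rule tangent_cong[OF v V(1,3)])
    fix q assume q: "q \<in> V"
    then show "f q = f p + (\<Sum>b\<in>Basis. ((\<phi> q - \<phi> p) \<bullet> b) * g b (\<phi> q))"
      using fg[of "\<phi> q"] chart_inv[OF c] p by (simp add: V_def)
  qed
  also have "\<dots> = v (\<lambda>q. \<Sum>b\<in>Basis. ((\<phi> q - \<phi> p) \<bullet> b) * g b (\<phi> q))"
    by (simp add: tangent_add[OF v nc near_sum[OF pM near_mult[OF nd ng]]] tangent_const[OF v])
  also have "\<dots> = (\<Sum>b\<in>Basis. v (\<lambda>q. ((\<phi> q - \<phi> p) \<bullet> b) * g b (\<phi> q)))"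
    by (rule tangent_sum[OF v pM near_mult[OF nd ng]])
  \<comment> \<open>The coordinate differences vanish at \<open>p\<close>, so the Leibniz rule
    leaves only the terms with \<open>g b (\<phi> p)\<close>, and these are the partial
    derivatives.\<close>
  also have "\<dots> = (\<Sum>b\<in>Basis. v (\<lambda>q. \<phi> q \<bullet> b) * coord_vector U \<phi> b p f)"
    by (simp add: tangent_mult[OF v nd ng] vd gp coord_vector_def f) (simp add: mult.commute)
  finally show "v f = (\<Sum>b\<in>Basis. v (\<lambda>q. \<phi> q \<bullet> b) *\<^sub>R coord_vector U \<phi> b p) f"
    by (simp add: sum_fun_apply)
qed

text \<open>The components in a chart map \<open>Tan p\<close> linearly into \<open>'e\<close>, and
  by \<open>tangent_expand\<close> injectively. The indices up to \<open>DIM('e)\<close> number one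
  more than the dimension, and a set that large is dependent; a family with a repeated image is
  treated apart.\<close>

lemma dependent_tangent_vectors:
  assumes p: "p \<in> topspace M" and a: "\<And>i. i \<le> DIM('e) \<Longrightarrow> a i \<in> Tan p"
  obtains c where "(\<Sum>i\<le>DIM('e). c i *\<^sub>R a i) = 0" "\<exists>i\<le>DIM('e). c i \<noteq> 0"
proof -
  obtain U \<phi> where c: "(U, \<phi>) \<in> A" "p \<in> U" using chart_at[OF p] .
  define F :: "'a tvec \<Rightarrow> 'e" where "F v = (\<Sum>b\<in>Basis. v (\<lambda>q. \<phi> q \<bullet> b) *\<^sub>R b)" for v
  have lin: "linear F"
    by (rule linearI) (simp_all add: F_def scaleR_left_distrib sum.distrib scaleR_sum_right)
  have inj: "v = 0" if "v \<in> Tan p" "F v = 0" for v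
  proof -
    have "v (\<lambda>q. \<phi> q \<bullet> b) = 0" if "b \<in> Basis" for b
      using \<open>F v = 0\<close> that inner_sum_left_Basis[of b "\<lambda>b. v (\<lambda>q. \<phi> q \<bullet> b)"] by (simp add: F_def)
    then show ?thesis using tangent_expand[OF c that(1)] by simp
  qed
  show ?thesis
  proof (cases "inj_on (F \<circ> a) {..DIM('e)}")
    case True
    then have "card ((F \<circ> a) ` {..DIM('e)}) > DIM('e)" by (subst card_image) simp_all
    then have "dependent ((F \<circ> a) ` {..DIM('e)})" by (intro dependent_biggerset) auto
    then obtain c where c: "\<exists>v\<in>(F \<circ> a) ` {..DIM('e)}. c v \<noteq> 0" "(\<Sum>v\<in>(F \<circ> a) ` {..DIM('e)}. c v *\<^sub>R v) = 0"
      using dependent_finite[of "(F \<circ> a) ` {..DIM('e)}"] by auto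
    define d where "d i = c (F (a i))" for i
    have "F (\<Sum>i\<le>DIM('e). d i *\<^sub>R a i) = 0"
      using c(2) unfolding sum.reindex[OF True] by (simp add: linear_sum[OF lin] linear_cmul[OF lin] d_def)
    then have "(\<Sum>i\<le>DIM('e). d i *\<^sub>R a i) = 0"
      using a by (intro inj subspace_sum[OF subspace_tangent] subspace_scale[OF subspace_tangent]) auto
    moreover have "\<exists>i\<le>DIM('e). d i \<noteq> 0" using c(1) by (auto simp: d_def)
    ultimately show ?thesis using that by blast
  next
    case False
    then obtain i j where ij: "i \<le> DIM('e)" "j \<le> DIM('e)" "i \<noteq> j" "F (a i) = F (a j)"
      by (auto simp: inj_on_def)
    have "a i - a j = 0"
      using ij a by (intro inj subspace_diff[OF subspace_tangent]) (auto simp: linear_diff[OF lin])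
    \<comment> \<open>Two members of the family coincide, so the coefficients 1 and -1 on them give
      the relation.\<close>
    define d :: "nat \<Rightarrow> real" where "d k = (if k = i then 1 else 0) - (if k = j then 1 else 0)" for k
    have "(\<Sum>k\<le>DIM('e). d k *\<^sub>R a k) = (\<Sum>k\<le>DIM('e). (if k = i then a k else 0)) - (\<Sum>k\<le>DIM('e). (if k = j then a k else 0))"
      unfolding sum_subtractf[symmetric] by (rule sum.cong) (auto simp: d_def)
    also have "\<dots> = 0"
      using ij \<open>a i - a j = 0\<close> by simp
    finally have "(\<Sum>k\<le>DIM('e). d k *\<^sub>R a k) = 0" .
    moreover have "d i \<noteq> 0" using ij by (simp add: d_def)
    ultimately show ?thesis using that ij by blast
  qed
qed

section \<open>Vector fields, brackets and extension by zero\<close>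

abbreviation vf :: "'a set \<Rightarrow> ('a \<Rightarrow> 'a tvec) \<Rightarrow> bool" where
  "vf \<equiv> smooth_vector_field M A"

lemma vf_openin: "vf W X \<Longrightarrow> openin M W"
  by (simp add: smooth_vector_field_def)

lemma vf_tangent: "vf W X \<Longrightarrow> p \<in> W \<Longrightarrow> X p \<in> Tan p"
  by (simp add: smooth_vector_field_def)

lemma vf_smooth: "vf W X \<Longrightarrow> smooth V f \<Longrightarrow> V \<subseteq> W \<Longrightarrow> smooth V (\<lambda>p. X p f)"
  by (simp add: smooth_vector_field_def)

lemma vfI:
  assumes "openin M W" "\<And>p. p \<in> W \<Longrightarrow> X p \<in> Tan p"
    "\<And>V f. V \<subseteq> W \<Longrightarrow> smooth V f \<Longrightarrow> smooth V (\<lambda>p. X p f)"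
  shows "vf W X"
  using assms by (simp add: smooth_vector_field_def)

lemma vf_subset: "vf W X \<Longrightarrow> openin M V \<Longrightarrow> V \<subseteq> W \<Longrightarrow> vf V X"
  by (rule vfI) (auto intro: vf_tangent vf_smooth)

lemma vf_cong:
  assumes "vf W X" "\<And>q. q \<in> W \<Longrightarrow> X q = Y q"
  shows "vf W Y"
proof (rule vfI)
  show "openin M W" using assms(1) by (rule vf_openin)
  show "Y p \<in> Tan p" if "p \<in> W" for p using vf_tangent[OF assms(1) that] assms(2)[OF that] by simp
  show "smooth V (\<lambda>p. Y p f)" if "V \<subseteq> W" "smooth V f" for V f
    using smooth_cong[OF vf_smooth[OF assms(1) that(2,1)]] assms(2) that(1) by (metis subsetD)
qed

lemma vf_zero: "openin M W \<Longrightarrow> vf W 0"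
  by (rule vfI) (auto intro: smooth_const smooth_openin subspace_0[OF subspace_tangent])

lemma vf_add: "vf W X \<Longrightarrow> vf W Y \<Longrightarrow> vf W (X + Y)"
  by (rule vfI) (auto intro: vf_openin smooth_add vf_smooth subspace_add[OF subspace_tangent] vf_tangent)

lemma vf_scale: "vf W X \<Longrightarrow> vf W (c *\<^sub>R X)"
  by (rule vfI)
    (auto intro: vf_openin smooth_scale vf_smooth subspace_scale[OF subspace_tangent] vf_tangent)

lemma vf_coord_vector:
  assumes c: "(U, \<phi>) \<in> A"
  shows "vf U (coord_vector U \<phi> b)"
proof (rule vfI[OF chart_openin[OF c] coord_vector_tangent[OF c]])
  fix V f assume V: "V \<subseteq> U" "smooth V f"
  then have "smooth_on (\<phi> ` V) (\<lambda>x. f (inv_into U \<phi> x))"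
    using smoothD[OF V(2) c] by (simp add: Int_absorb1)
  then have "smooth V (\<lambda>q. frechet_derivative (\<lambda>x. f (inv_into U \<phi> x)) (at (\<phi> q)) b)"
    by (intro smooth_chart[OF c smooth_openin[OF V(2)] V(1), where G = "\<lambda>x. frechet_derivative (\<lambda>x. f (inv_into U \<phi> x)) (at x) b"] smooth_on_derivative)
  then show "smooth V (\<lambda>p. coord_vector U \<phi> b p f)"
    by (rule smooth_cong) (use nearI[OF V(2)] in \<open>simp add: coord_vector_def\<close>)
qed

lemma near_vf:
  assumes "vf W X" "p \<in> W" "near p f"
  shows "near p (\<lambda>q. X q f)"
proof -
  obtain V where "V \<subseteq> W" "p \<in> V" "smooth V f"
    using nearE[OF assms(3) vf_openin[OF assms(1)] assms(2)] by metis
  then show ?thesis using vf_smooth[OF assms(1)] nearI by blast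
qed

lemma lie_bracket_near:
  "near p f \<Longrightarrow> lie_bracket M A X Y p f = X p (\<lambda>q. Y q f) - Y p (\<lambda>q. X q f)"
  by (simp add: lie_bracket_def)

lemma lie_bracket_cong:
  assumes W: "openin M W" "p \<in> W" and X: "X p \<in> Tan p" and Y: "Y p \<in> Tan p"
    and eq: "\<And>q. q \<in> W \<Longrightarrow> X q = X' q" "\<And>q. q \<in> W \<Longrightarrow> Y q = Y' q"
  shows "lie_bracket M A X Y p = lie_bracket M A X' Y' p"
proof -
  have "X p (\<lambda>q. Y q f) = X' p (\<lambda>q. Y' q f)" "Y p (\<lambda>q. X q f) = Y' p (\<lambda>q. X' q f)" for f
    using tangent_cong[OF X W, of "\<lambda>q. Y q f" "\<lambda>q. Y' q f"] tangent_cong[OF Y W, of "\<lambda>q. X q f" "\<lambda>q. X' q f"] eq W(2) by simp_all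
  then show ?thesis unfolding lie_bracket_def by presburger
qed

text \<open>Extending fields and functions by zero outside \<open>W\<close> turns equality on \<open>W\<close> into equality of
  HOL functions.\<close>

definition cut :: "'a set \<Rightarrow> ('a \<Rightarrow> 'b::zero) \<Rightarrow> 'a \<Rightarrow> 'b" where
  "cut W X = (\<lambda>q. if q \<in> W then X q else 0)"

lemma cut_in [simp]: "q \<in> W \<Longrightarrow> cut W X q = X q"
  by (simp add: cut_def)

lemma cut_out [simp]: "q \<notin> W \<Longrightarrow> cut W X q = 0"
  by (simp add: cut_def)

definition VF :: "'a set \<Rightarrow> ('a \<Rightarrow> 'a tvec) set" where
  "VF W = {X. vf W X \<and> (\<forall>q. q \<notin> W \<longrightarrow> X q = 0)}"

definition FN :: "'a set \<Rightarrow> ('a \<Rightarrow> real) set" where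
  "FN W = {f. smooth W f \<and> (\<forall>q. q \<notin> W \<longrightarrow> f q = 0)}"

lemma VF_vf: "X \<in> VF W \<Longrightarrow> vf W X"
  by (simp add: VF_def)

lemma VF_out: "X \<in> VF W \<Longrightarrow> q \<notin> W \<Longrightarrow> X q = 0"
  by (simp add: VF_def)

lemma VF_tangent: "X \<in> VF W \<Longrightarrow> p \<in> W \<Longrightarrow> X p \<in> Tan p"
  by (auto simp: VF_def intro: vf_tangent)

lemma cut_VF: "vf W X \<Longrightarrow> cut W X \<in> VF W"
  by (auto simp: VF_def intro: vf_cong)

lemma cut_FN: "smooth W f \<Longrightarrow> cut W f \<in> FN W"
  by (auto simp: FN_def intro: smooth_cong)

lemma subspace_VF: "openin M W \<Longrightarrow> subspace (VF W)"
  by (auto simp: subspace_def VF_def intro: vf_zero vf_add vf_scale)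

lemma FN_near: "f \<in> FN W \<Longrightarrow> p \<in> W \<Longrightarrow> near p f"
  by (auto simp: FN_def intro: nearI)

end

section \<open>Nearly Kaehler structures on a manifold\<close>

locale nearly_kaehler_manifold = smooth_atlas M A
  for M :: "'a topology" and A :: "('a, 'e::euclidean_space) atlas" +
  fixes h :: "'a \<Rightarrow> 'a tvec \<Rightarrow> 'a tvec \<Rightarrow> real" and J :: "'a \<Rightarrow> 'a tvec \<Rightarrow> 'a tvec"
    and D :: "('a \<Rightarrow> 'a tvec) \<Rightarrow> ('a \<Rightarrow> 'a tvec) \<Rightarrow> 'a \<Rightarrow> 'a tvec"
  assumes hermitian: "almost_hermitian M A h J" and levi_civita: "levi_civita M A h D"
    and nearly_kaehler: "\<And>W X Y Z p. \<lbrakk>vf W X; vf W Y; vf W Z; p \<in> W\<rbrakk> \<Longrightarrow>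
      cov_deriv D (fundamental_form h J) X Y Z p = (1/3) * ext_deriv M A (fundamental_form h J) X Y Z p"
begin

lemma J_tangent: "p \<in> topspace M \<Longrightarrow> v \<in> Tan p \<Longrightarrow> J p v \<in> Tan p"
  using hermitian by (simp add: almost_hermitian_def almost_complex_structure_def smooth_endomorphism_field_def)

lemma J_lincomb: "p \<in> topspace M \<Longrightarrow> v \<in> Tan p \<Longrightarrow> w \<in> Tan p \<Longrightarrow>
    J p (a *\<^sub>R v + b *\<^sub>R w) = a *\<^sub>R J p v + b *\<^sub>R J p w"
  using hermitian
  by (simp add: almost_hermitian_def almost_complex_structure_def smooth_endomorphism_field_def tcomb_eq)

lemma J_J_tangent: "p \<in> topspace M \<Longrightarrow> v \<in> Tan p \<Longrightarrow> J p (J p v) = - v"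
  using hermitian
  by (simp add: almost_hermitian_def almost_complex_structure_def fun_eq_iff)

lemma J_vf: "vf W X \<Longrightarrow> vf W (\<lambda>p. J p (X p))"
  using hermitian openin_subset[OF vf_openin]
  by (auto simp: almost_hermitian_def almost_complex_structure_def smooth_endomorphism_field_def)

lemma h_lincomb: "\<lbrakk>p \<in> topspace M; u \<in> Tan p; v \<in> Tan p; w \<in> Tan p\<rbrakk> \<Longrightarrow>
    h p (a *\<^sub>R u + b *\<^sub>R v) w = a * h p u w + b * h p v w"
  using hermitian
  by (simp add: almost_hermitian_def riemannian_metric_def smooth_bilinear_field_def tcomb_eq)

lemma h_scale_at: "\<lbrakk>p \<in> topspace M; u \<in> Tan p; w \<in> Tan p\<rbrakk> \<Longrightarrow> h p (c *\<^sub>R u) w = c * h p u w"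
  using h_lincomb[of p u u w c 0] by simp

lemma J_scale_at: "\<lbrakk>p \<in> topspace M; u \<in> Tan p\<rbrakk> \<Longrightarrow> J p (c *\<^sub>R u) = c *\<^sub>R J p u"
  using J_lincomb[of p u u c 0] by simp

lemma h_commute: "\<lbrakk>p \<in> topspace M; v \<in> Tan p; w \<in> Tan p\<rbrakk> \<Longrightarrow> h p v w = h p w v"
  using hermitian by (simp add: almost_hermitian_def riemannian_metric_def)

lemma h_pos: "\<lbrakk>p \<in> topspace M; v \<in> Tan p; v \<noteq> 0\<rbrakk> \<Longrightarrow> 0 < h p v v"
  using hermitian by (simp add: almost_hermitian_def riemannian_metric_def tzero_eq)

lemma h_zero_at: "p \<in> topspace M \<Longrightarrow> v \<in> Tan p \<Longrightarrow> h p v 0 = 0" "p \<in> topspace M \<Longrightarrow> v \<in> Tan p \<Longrightarrow> h p 0 v = 0"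
  using h_scale_at[of p v v 0] h_commute[of p v 0] subspace_0[OF subspace_tangent] by simp_all

lemma h_JJ: "\<lbrakk>p \<in> topspace M; v \<in> Tan p; w \<in> Tan p\<rbrakk> \<Longrightarrow> h p (J p v) (J p w) = h p v w"
  using hermitian by (simp add: almost_hermitian_def)

lemma h_smooth: "vf W X \<Longrightarrow> vf W Y \<Longrightarrow> smooth W (\<lambda>p. h p (X p) (Y p))"
  using hermitian openin_subset[OF vf_openin]
  by (auto simp: almost_hermitian_def riemannian_metric_def smooth_bilinear_field_def)

lemma D_vf: "vf W X \<Longrightarrow> vf W Y \<Longrightarrow> vf W (D X Y)"
  using levi_civita by (auto simp: levi_civita_def affine_connection_def)

lemma D_add_l: "vf W X \<Longrightarrow> vf W Y \<Longrightarrow> vf W Z \<Longrightarrow> p \<in> W \<Longrightarrow> D (X + Y) Z p = D X Z p + D Y Z p"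
  using levi_civita by (auto simp: levi_civita_def affine_connection_def tcomb_eq plus_fun_def)

lemma D_add_r: "vf W X \<Longrightarrow> vf W Y \<Longrightarrow> vf W Z \<Longrightarrow> p \<in> W \<Longrightarrow> D X (Y + Z) p = D X Y p + D X Z p"
  using levi_civita by (auto simp: levi_civita_def affine_connection_def tcomb_eq plus_fun_def)

lemma D_scale_lr:
  assumes "vf W X" "vf W Y" "p \<in> W"
  shows "D (c *\<^sub>R X) Y p = c *\<^sub>R D X Y p" "D X (c *\<^sub>R Y) p = c *\<^sub>R D X Y p"
proof -
  have "smooth W (\<lambda>q. c)" using assms vf_openin smooth_const by blast
  then have "D (\<lambda>q f. c * X q f) Y p = (\<lambda>f. c * D X Y p f) \<and>
      D X (\<lambda>q f. c * Y q f) p = tcomb (X p (\<lambda>q. c)) (Y p) c (D X Y p)"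
    using levi_civita assms unfolding levi_civita_def affine_connection_def by blast
  then show "D (c *\<^sub>R X) Y p = c *\<^sub>R D X Y p" "D X (c *\<^sub>R Y) p = c *\<^sub>R D X Y p"
    using tangent_const[OF vf_tangent[OF assms(1,3)]] by (simp_all add: scaleR_fun_def tcomb_def)
qed

lemma D_torsion: "vf W X \<Longrightarrow> vf W Y \<Longrightarrow> p \<in> W \<Longrightarrow> D X Y p - D Y X p = lie_bracket M A X Y p"
  using levi_civita by (fastforce simp: levi_civita_def tcomb_eq)

lemma D_metric_at: "vf W X \<Longrightarrow> vf W Y \<Longrightarrow> vf W Z \<Longrightarrow> p \<in> W \<Longrightarrow>
    X p (\<lambda>q. h q (Y q) (Z q)) = h p (D X Y p) (Z p) + h p (Y p) (D X Z p)"
  using levi_civita unfolding levi_civita_def by blast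

definition Jf :: "'a set \<Rightarrow> ('a \<Rightarrow> 'a tvec) \<Rightarrow> 'a \<Rightarrow> 'a tvec" where
  "Jf W X = cut W (\<lambda>p. J p (X p))"

definition Df :: "'a set \<Rightarrow> ('a \<Rightarrow> 'a tvec) \<Rightarrow> ('a \<Rightarrow> 'a tvec) \<Rightarrow> 'a \<Rightarrow> 'a tvec" where
  "Df W X Y = cut W (D X Y)"

definition hf :: "'a set \<Rightarrow> ('a \<Rightarrow> 'a tvec) \<Rightarrow> ('a \<Rightarrow> 'a tvec) \<Rightarrow> 'a \<Rightarrow> real" where
  "hf W X Y = cut W (\<lambda>p. h p (X p) (Y p))"

lemma Df_VF: "X \<in> VF W \<Longrightarrow> Y \<in> VF W \<Longrightarrow> Df W X Y \<in> VF W"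
  unfolding Df_def by (intro cut_VF D_vf VF_vf)

lemma Jf_VF: "X \<in> VF W \<Longrightarrow> Jf W X \<in> VF W"
  unfolding Jf_def by (intro cut_VF J_vf VF_vf)

lemma bracket_near:
  assumes "X \<in> VF W" "Y \<in> VF W" "p \<in> W" "near p f"
  shows "(Df W X Y - Df W Y X) p f = X p (\<lambda>q. Y q f) - Y p (\<lambda>q. X q f)"
  using D_torsion[OF VF_vf[OF assms(1)] VF_vf[OF assms(2)] assms(3)] lie_bracket_near[OF assms(4), of X Y] assms(3)
  by (simp add: Df_def fun_eq_iff)

lemma bracket_VF:
  assumes "openin M W" "X \<in> VF W" "Y \<in> VF W"
  shows "Df W X Y - Df W Y X \<in> VF W"
  using assms by (intro subspace_diff[OF subspace_VF] Df_VF)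

text \<open>The terms of the double commutator, arranged so that a cyclic sum cancels. The inner
  bracket can be expanded only where \<open>f\<close> is smooth, so the replacement under
  \<open>X p\<close> is made on a neighbourhood \<open>V\<close> by locality of derivations.\<close>

lemma bracket_near2:
  assumes W: "openin M W" and XYZ: "X \<in> VF W" "Y \<in> VF W" "Z \<in> VF W" and p: "p \<in> W" and f: "near p f"
  shows "(Df W X (Df W Y Z - Df W Z Y) - Df W (Df W Y Z - Df W Z Y) X) p f =
    X p (\<lambda>q. Y q (\<lambda>r. Z r f)) - X p (\<lambda>q. Z q (\<lambda>r. Y r f)) - Y p (\<lambda>q. Z q (\<lambda>r. X r f)) + Z p (\<lambda>q. Y q (\<lambda>r. X r f))"
proof -
  note near = near_vf[OF VF_vf[OF XYZ(1)] p] near_vf[OF VF_vf[OF XYZ(2)] p] near_vf[OF VF_vf[OF XYZ(3)] p]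
  obtain V where V: "V \<subseteq> W" "p \<in> V" "smooth V f" "openin M V"
    using nearE[OF f W p] by metis
  have "X p (\<lambda>q. (Df W Y Z - Df W Z Y) q f) = X p (\<lambda>q. Y q (\<lambda>r. Z r f) - Z q (\<lambda>r. Y r f))"
    by (rule tangent_cong[OF VF_tangent[OF XYZ(1) p] V(4,2)])
      (use V XYZ bracket_near nearI in blast)
  also have "\<dots> = X p (\<lambda>q. Y q (\<lambda>r. Z r f)) - X p (\<lambda>q. Z q (\<lambda>r. Y r f))"
    by (intro tangent_diff[OF VF_tangent[OF XYZ(1) p]] near f)
  finally show ?thesis
    using bracket_near[OF XYZ(1) bracket_VF[OF W XYZ(2,3)] p f] bracket_near[OF XYZ(2,3) p near(1)[OF f]] by simp
qed

text \<open>At points of \<open>W\<close> each axiom is a property of the structure on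
  \<open>M\<close>; outside \<open>W\<close> both sides are zero.\<close>

lemma hermitian_module:
  assumes W: "openin M W"
  shows "nearly_kaehler_module (VF W) (FN W) (\<lambda>X f p. X p f) (hf W) (Jf W) (Df W)"
proof
  have WM: "p \<in> topspace M" if "p \<in> W" for p using openin_subset[OF W] that by blast
  show "subspace (VF W)" by (rule subspace_VF[OF W])
  show "(\<lambda>p. X p (f + g)) = (\<lambda>p. X p f) + (\<lambda>p. X p g)" if "X \<in> VF W" "f \<in> FN W" "g \<in> FN W" for X f g
  proof
    fix p
    show "X p (f + g) = ((\<lambda>p. X p f) + (\<lambda>p. X p g)) p"
    proof (cases "p \<in> W")
      case True
      then show ?thesis
        using tangent_add[OF VF_tangent[OF that(1) True], of f g] that FN_near by (simp add: plus_fun_def)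
    qed (simp add: VF_out[OF that(1)])
  qed
  show "(\<lambda>p. X p (c *\<^sub>R f)) = c *\<^sub>R (\<lambda>p. X p f)" if "X \<in> VF W" "f \<in> FN W" for X f c
  proof
    fix p
    show "X p (c *\<^sub>R f) = (c *\<^sub>R (\<lambda>p. X p f)) p"
    proof (cases "p \<in> W")
      case True
      then show ?thesis
        using tangent_scale[OF VF_tangent[OF that(1) True], of f] that FN_near by (simp add: scaleR_fun_def)
    qed (simp add: VF_out[OF that(1)])
  qed
  show "hf W X Y \<in> FN W" if "X \<in> VF W" "Y \<in> VF W" for X Y
    unfolding hf_def using that by (intro cut_FN h_smooth VF_vf)
  show "hf W X Y = hf W Y X" if "X \<in> VF W" "Y \<in> VF W" for X Y
    using that h_commute VF_tangent WM by (auto simp: hf_def cut_def)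
  show "hf W (X + Y) Z = hf W X Z + hf W Y Z" if "X \<in> VF W" "Y \<in> VF W" "Z \<in> VF W" for X Y Z
    using h_lincomb[OF WM, of _ "X _" "Y _" "Z _" 1 1] that VF_tangent by (auto simp: hf_def cut_def)
  show "hf W (c *\<^sub>R X) Z = c *\<^sub>R hf W X Z" if "X \<in> VF W" "Z \<in> VF W" for c X Z
    using h_scale_at[OF WM, of _ "X _" "Z _" c] that VF_tangent by (auto simp: hf_def cut_def fun_eq_iff)
  show "X = 0" if "X \<in> VF W" "hf W X X = 0" for X
  proof
    fix p
    show "X p = 0 p"
    proof (cases "p \<in> W")
      case True
      then have "h p (X p) (X p) = 0" using fun_cong[OF that(2), of p] by (simp add: hf_def)
      then show ?thesis using h_pos[OF WM[OF True] VF_tangent[OF that(1) True]] by auto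
    qed (simp add: VF_out[OF that(1)])
  qed
  show J_closed: "Jf W X \<in> VF W" if "X \<in> VF W" for X
    using that by (rule Jf_VF)
  show "Jf W (X + Y) = Jf W X + Jf W Y" if "X \<in> VF W" "Y \<in> VF W" for X Y
    using J_lincomb[OF WM, of _ "X _" "Y _" 1 1] that VF_tangent by (auto simp: Jf_def cut_def fun_eq_iff)
  show "Jf W (c *\<^sub>R X) = c *\<^sub>R Jf W X" if "X \<in> VF W" for c X
    using J_scale_at[OF WM, of _ "X _" c] that VF_tangent by (auto simp: Jf_def cut_def fun_eq_iff)
  show "Jf W (Jf W X) = - X" if "X \<in> VF W" for X
    using J_J_tangent[OF WM, of _ "X _"] that VF_tangent VF_out by (auto simp: Jf_def cut_def fun_eq_iff)
  show "hf W (Jf W X) (Jf W Y) = hf W X Y" if "X \<in> VF W" "Y \<in> VF W" for X Y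
    using h_JJ[OF WM, of _ "X _" "Y _"] that VF_tangent by (auto simp: Jf_def hf_def cut_def fun_eq_iff)
  show D_closed: "Df W X Y \<in> VF W" if "X \<in> VF W" "Y \<in> VF W" for X Y
    using that by (rule Df_VF)
  show "Df W (X + Y) Z = Df W X Z + Df W Y Z" "Df W X (Y + Z) = Df W X Y + Df W X Z"
    if "X \<in> VF W" "Y \<in> VF W" "Z \<in> VF W" for X Y Z
    using D_add_l[of W X Y Z] D_add_r[of W X Y Z] that[THEN VF_vf] by (auto simp: Df_def cut_def fun_eq_iff)
  show "Df W (c *\<^sub>R X) Y = c *\<^sub>R Df W X Y" "Df W X (c *\<^sub>R Y) = c *\<^sub>R Df W X Y"
    if "X \<in> VF W" "Y \<in> VF W" for c X Y
    using D_scale_lr[of W X Y _ c] that[THEN VF_vf] by (auto simp: Df_def cut_def fun_eq_iff)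
  show metric: "(\<lambda>p. X p (hf W Y Z)) = hf W (Df W X Y) Z + hf W Y (Df W X Z)"
    if "X \<in> VF W" "Y \<in> VF W" "Z \<in> VF W" for X Y Z
  proof
    fix p
    show "X p (hf W Y Z) = (hf W (Df W X Y) Z + hf W Y (Df W X Z)) p"
    proof (cases "p \<in> W")
      case True
      have "X p (hf W Y Z) = X p (\<lambda>q. h q (Y q) (Z q))"
        by (rule tangent_cong[OF VF_tangent[OF that(1) True] W True]) (simp add: hf_def)
      then show ?thesis
        using D_metric_at[OF that[THEN VF_vf] True] True by (simp add: hf_def Df_def)
    qed (simp add: VF_out[OF that(1)] hf_def)
  qed
  show "(\<lambda>p. (Df W X Y - Df W Y X) p f) = (\<lambda>p. X p (\<lambda>p. Y p f)) - (\<lambda>p. Y p (\<lambda>p. X p f))"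
    if "X \<in> VF W" "Y \<in> VF W" "f \<in> FN W" for X Y f
  proof
    fix p
    show "(Df W X Y - Df W Y X) p f = ((\<lambda>p. X p (\<lambda>p. Y p f)) - (\<lambda>p. Y p (\<lambda>p. X p f))) p"
      using bracket_near[OF that(1,2) _ FN_near[OF that(3)]] VF_out[OF that(1)] VF_out[OF that(2)]
      by (cases "p \<in> W") (simp_all add: Df_def)
  qed
  show "(Df W X (Df W Y Z - Df W Z Y) - Df W (Df W Y Z - Df W Z Y) X) + (Df W Y (Df W Z X - Df W X Z) - Df W (Df W Z X - Df W X Z) Y)
      + (Df W Z (Df W X Y - Df W Y X) - Df W (Df W X Y - Df W Y X) Z) = 0" (is "?S = 0")
    if "X \<in> VF W" "Y \<in> VF W" "Z \<in> VF W" for X Y Z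
  proof
    fix p
    have S: "?S \<in> VF W"
      using that by (intro subspace_add[OF subspace_VF[OF W]] bracket_VF[OF W])
    show "?S p = 0 p"
    proof (cases "p \<in> W")
      case True
      show ?thesis
      proof (rule tangent_eqI[OF VF_tangent[OF S True]])
        show "0 p \<in> Tan p" using subspace_0[OF subspace_tangent] by simp
        fix f assume "near p f"
        note b = bracket_near2[OF W _ _ _ True this]
        show "?S p f = 0 p f"
          using b[OF that(1,2,3)] b[OF that(2,3,1)] b[OF that(3,1,2)] by simp
      qed
    next
      case False
      show ?thesis using VF_out[OF S False] by (simp only: zero_fun_apply)
    qed
  qed
  show "hf W (Df W X (Jf W Y) - Jf W (Df W X Y)) Z = hf W (Df W Y (Jf W Z) - Jf W (Df W Y Z)) X"
    if "X \<in> VF W" "Y \<in> VF W" "Z \<in> VF W" for X Y Z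
  proof
    fix p
    show "hf W (Df W X (Jf W Y) - Jf W (Df W X Y)) Z p = hf W (Df W Y (Jf W Z) - Jf W (Df W Y Z)) X p"
    proof (cases "p \<in> W")
      case True
      \<comment> \<open>As \<open>D\<close> is metric, the covariant derivative of the fundamental
        form is \<open>h((D_X J)Y, Z)\<close>.\<close>
      have cov: "hf W (Df W X (Jf W Y) - Jf W (Df W X Y)) Z p = cov_deriv D (fundamental_form h J) X Y Z p"
        if XYZ: "X \<in> VF W" "Y \<in> VF W" "Z \<in> VF W" for X Y Z
      proof -
        have "X p (\<lambda>q. h q (J q (Y q)) (Z q)) = X p (hf W (Jf W Y) Z)"
          by (rule tangent_cong[OF VF_tangent[OF XYZ(1) True] W True]) (simp add: hf_def Jf_def)
        also have "\<dots> = h p (Df W X (Jf W Y) p) (Z p) + h p (J p (Y p)) (D X Z p)"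
          using fun_cong[OF metric[OF XYZ(1) J_closed[OF XYZ(2)] XYZ(3)], of p] True by (simp add: hf_def Df_def Jf_def)
        finally have "cov_deriv D (fundamental_form h J) X Y Z p = h p (Df W X (Jf W Y) p) (Z p) - h p (J p (Df W X Y p)) (Z p)"
          using True by (simp add: cov_deriv_def fundamental_form_def Df_def)
        moreover have "h p (1 *\<^sub>R Df W X (Jf W Y) p + (-1) *\<^sub>R J p (Df W X Y p)) (Z p) =
            1 * h p (Df W X (Jf W Y) p) (Z p) + (-1) * h p (J p (Df W X Y p)) (Z p)"
          using XYZ by (intro h_lincomb WM True VF_tangent[OF _ True] J_tangent D_closed J_closed)
        ultimately show ?thesis
          using True by (simp add: hf_def Jf_def)
      qed
      \<comment> \<open>A cyclic permutation only reorders the summands of \<open>ext_deriv\<close>;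
        the nearly Kaehler equation hands this symmetry to the covariant derivative.\<close>
      have "ext_deriv M A (fundamental_form h J) X Y Z p = ext_deriv M A (fundamental_form h J) Y Z X p"
        by (simp add: ext_deriv_def)
      then show ?thesis
        using cov[OF that] cov[OF that(2,3,1)] nearly_kaehler[OF that[THEN VF_vf] True] nearly_kaehler[OF that(2,3,1)[THEN VF_vf] True]
        by simp
    qed (simp add: hf_def)
  qed
qed

section \<open>The Nijenhuis tensor as torsion, and its components in a frame\<close>

abbreviation N :: "('a \<Rightarrow> 'a tvec) \<Rightarrow> ('a \<Rightarrow> 'a tvec) \<Rightarrow> 'a \<Rightarrow> 'a tvec" where
  "N \<equiv> nijenhuis M A J"

text \<open>The name is justified by \<open>Nf_eq\<close>: on fields over \<open>W\<close> this
  torsion has the values of \<open>N\<close>.\<close>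

abbreviation Nf :: "'a set \<Rightarrow> ('a \<Rightarrow> 'a tvec) \<Rightarrow> ('a \<Rightarrow> 'a tvec) \<Rightarrow> 'a \<Rightarrow> 'a tvec" where
  "Nf W \<equiv> nearly_kaehler_module.T (Jf W) (Df W)"

lemma N_cong:
  assumes W: "openin M W" "p \<in> W" and XY: "vf W X" "vf W Y"
    and eq: "\<And>q. q \<in> W \<Longrightarrow> X q = X' q" "\<And>q. q \<in> W \<Longrightarrow> Y q = Y' q"
  shows "N X Y p = N X' Y' p"
proof -
  have "lie_bracket M A X Y p = lie_bracket M A X' Y' p" if "vf W X" "vf W Y"
    "\<And>q. q \<in> W \<Longrightarrow> X q = X' q" "\<And>q. q \<in> W \<Longrightarrow> Y q = Y' q" for X X' Y Y'
    by (intro lie_bracket_cong[OF W] vf_tangent[of W] that W)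
  then show ?thesis
    using XY eq J_vf[OF XY(1)] J_vf[OF XY(2)] by (simp add: nijenhuis_def Let_def)
qed

lemma Nf_eq:
  assumes W: "openin M W" and XY: "X \<in> VF W" "Y \<in> VF W" and p: "p \<in> W"
  shows "Nf W X Y p = N X Y p"
proof -
  interpret K: nearly_kaehler_module "VF W" "FN W" "\<lambda>X f p. X p f" "hf W" "Jf W" "Df W"
    by (rule hermitian_module[OF W])
  have br: "lie_bracket M A X Y p = (Df W X Y - Df W Y X) p" if "X \<in> VF W" "Y \<in> VF W" for X Y
    using D_torsion[OF that[THEN VF_vf] p] p by (simp add: Df_def)
  have brJ: "lie_bracket M A (\<lambda>q. J q (X q)) (\<lambda>q. J q (Y q)) p = lie_bracket M A (Jf W X) (Jf W Y) p"
    "lie_bracket M A X (\<lambda>q. J q (Y q)) p = lie_bracket M A X (Jf W Y) p"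
    "lie_bracket M A (\<lambda>q. J q (X q)) Y p = lie_bracket M A (Jf W X) Y p"
    using XY p J_vf[OF VF_vf[OF XY(1)]] J_vf[OF VF_vf[OF XY(2)]]
    by (auto intro!: lie_bracket_cong[OF W p] vf_tangent[of W] VF_vf simp: Jf_def)
  have "4 *\<^sub>R Nf W X Y p = (Df W (Jf W X) (Jf W Y) - Df W (Jf W Y) (Jf W X)) p
      - J p ((Df W (Jf W X) Y - Df W Y (Jf W X)) p) - J p ((Df W X (Jf W Y) - Df W (Jf W Y) X) p)
      - (Df W X Y - Df W Y X) p"
    using fun_cong[OF K.nijenhuis_eq[OF XY], of p] p by (simp add: Jf_def)
  also have "\<dots> = 4 *\<^sub>R N X Y p"
    unfolding nijenhuis_def Let_def brJ br[OF XY] br[OF Jf_VF[OF XY(1)] Jf_VF[OF XY(2)]]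
      br[OF Jf_VF[OF XY(1)] XY(2)] br[OF XY(1) Jf_VF[OF XY(2)]]
    by (rule ext) simp
  finally show ?thesis by simp
qed

text \<open>Quantifies over fields near \<open>p\<close>, since \<open>N\<close> takes fields. That
  finitely many frame components decide it is shown in
  \<open>nijenhuis_vanishes_atI\<close>.\<close>

definition nijenhuis_vanishes_at :: "'a \<Rightarrow> bool" where
  "nijenhuis_vanishes_at p \<longleftrightarrow> (\<forall>W X Y. vf W X \<and> vf W Y \<and> p \<in> W \<longrightarrow> N X Y p = 0)"

abbreviation tf :: "'a set \<Rightarrow> ('a \<Rightarrow> 'a tvec) \<Rightarrow> ('a \<Rightarrow> 'a tvec) \<Rightarrow> ('a \<Rightarrow> 'a tvec) \<Rightarrow> 'a \<Rightarrow> real" where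
  "tf W \<equiv> nearly_kaehler_module.t (hf W) (Jf W) (Df W)"

lemma h_sum_right:
  assumes "p \<in> topspace M" "v \<in> Tan p" "\<And>i. i \<in> I \<Longrightarrow> w i \<in> Tan p"
  shows "h p v (\<Sum>i\<in>I. c i *\<^sub>R w i) = (\<Sum>i\<in>I. c i * h p v (w i))"
  using assms(3)
proof (induction I rule: infinite_finite_induct)
  have z: "h p v 0 = 0"
    using h_scale_at[OF assms(1,2,2), of 0] h_commute[OF assms(1,2) subspace_0[OF subspace_tangent]] by simp
  {
    case (infinite I) show ?case using infinite z z[unfolded zero_fun_def] by simp
  next
    case empty show ?case using z z[unfolded zero_fun_def] by simp
  next
    case (insert i I)
    have S: "(\<Sum>i\<in>I. c i *\<^sub>R w i) \<in> Tan p"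
      using insert.prems by (intro subspace_sum[OF subspace_tangent] subspace_scale[OF subspace_tangent]) auto
    have "h p v (c i *\<^sub>R w i + (\<Sum>i\<in>I. c i *\<^sub>R w i)) = h p (c i *\<^sub>R w i + 1 *\<^sub>R (\<Sum>i\<in>I. c i *\<^sub>R w i)) v"
      using insert.prems S assms
      by (subst h_commute) (auto intro!: subspace_add[OF subspace_tangent] subspace_scale[OF subspace_tangent])
    also have "\<dots> = c i * h p (w i) v + 1 * h p (\<Sum>i\<in>I. c i *\<^sub>R w i) v"
      using insert.prems S assms by (intro h_lincomb) auto
    also have "\<dots> = c i * h p v (w i) + h p v (\<Sum>i\<in>I. c i *\<^sub>R w i)"
      using insert.prems S assms h_commute by simp
    finally have *: "h p v (c i *\<^sub>R w i + (\<Sum>i\<in>I. c i *\<^sub>R w i)) = c i * h p v (w i) + h p v (\<Sum>i\<in>I. c i *\<^sub>R w i)" .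
    have IH: "h p v (\<Sum>i\<in>I. c i *\<^sub>R w i) = (\<Sum>i\<in>I. c i * h p v (w i))"
      by (rule insert.IH) (use insert.prems in blast)
    show ?case
      unfolding sum.insert[OF insert.hyps] * IH ..
  }
qed

text \<open>Total skewness makes \<open>t\<close> tensorial in every argument, since it is so in the last one.\<close>

lemma tf_expand:
  assumes c: "(U, \<phi>) \<in> A" and V: "openin M V" "V \<subseteq> U"
    and XYZ: "X \<in> VF V" "Y \<in> VF V" "Z \<in> VF V" and p: "p \<in> V"
  shows "tf V X Y Z p = (\<Sum>b\<in>Basis. X p (\<lambda>q. \<phi> q \<bullet> b) * tf V (cut V (coord_vector U \<phi> b)) Y Z p)"
proof -
  interpret K: nearly_kaehler_module "VF V" "FN V" "\<lambda>X f p. X p f" "hf V" "Jf V" "Df V"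
    by (rule hermitian_module[OF V(1)])
  have pM: "p \<in> topspace M" using openin_subset[OF V(1)] p by blast
  have pU: "p \<in> U" using V p by blast
  let ?e = "\<lambda>b. cut V (coord_vector U \<phi> b)"
  have e: "?e b \<in> VF V" for b
    using vf_subset[OF vf_coord_vector[OF c] V] cut_VF by blast
  have t: "tf V X Y Z p = h p (Nf V Y Z p) (X p)" if "X \<in> VF V" for X
    using K.t_cyclic[OF that XYZ(2,3)] p by (simp add: K.t_def hf_def)
  have "X p = (\<Sum>b\<in>Basis. X p (\<lambda>q. \<phi> q \<bullet> b) *\<^sub>R ?e b p)"
    using tangent_expand[OF c pU VF_tangent[OF XYZ(1) p]] p by simp
  then have "h p (Nf V Y Z p) (X p) = h p (Nf V Y Z p) (\<Sum>b\<in>Basis. X p (\<lambda>q. \<phi> q \<bullet> b) *\<^sub>R ?e b p)"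
    by (rule arg_cong)
  also have "\<dots> = (\<Sum>b\<in>Basis. X p (\<lambda>q. \<phi> q \<bullet> b) * h p (Nf V Y Z p) (?e b p))"
    using XYZ by (intro h_sum_right pM VF_tangent[OF _ p] K.T_closed e)
  finally show ?thesis by (simp add: t[OF XYZ(1)] t[OF e])
qed

text \<open>\<open>tf_expand\<close> expands the first argument; cyclic shifts bring the other two
  there in turn, so that frame vectors are replaced by arbitrary fields one slot at a time.\<close>

lemma nijenhuis_vanishes_atI:
  assumes c: "(U, \<phi>) \<in> A" and p: "p \<in> U"
    and 0: "\<And>b c d. b \<in> Basis \<Longrightarrow> c \<in> Basis \<Longrightarrow> d \<in> Basis \<Longrightarrow>
      h p (N (coord_vector U \<phi> b) (coord_vector U \<phi> c) p) (coord_vector U \<phi> d p) = 0"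
  shows "nijenhuis_vanishes_at p"
  unfolding nijenhuis_vanishes_at_def
proof (intro allI impI)
  fix W X Y assume "vf W X \<and> vf W Y \<and> p \<in> W"
  then have W: "vf W X" "vf W Y" "p \<in> W" by auto
  define V where "V = U \<inter> W"
  have V: "openin M V" "V \<subseteq> U" "V \<subseteq> W" "p \<in> V"
    using chart_openin[OF c] vf_openin[OF W(1)] p W by (auto simp: V_def)
  have pM: "p \<in> topspace M" using openin_subset[OF V(1)] V by blast
  interpret K: nearly_kaehler_module "VF V" "FN V" "\<lambda>X f p. X p f" "hf V" "Jf V" "Df V"
    by (rule hermitian_module[OF V(1)])
  let ?e = "\<lambda>b. cut V (coord_vector U \<phi> b)"
  have e: "?e b \<in> VF V" for b
    using vf_subset[OF vf_coord_vector[OF c] V(1,2)] cut_VF by blast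
  have vfe: "vf V (coord_vector U \<phi> b)" for b
    using vf_subset[OF vf_coord_vector[OF c] V(1,2)] .
  have vXY: "vf V X" "vf V Y" using vf_subset[OF _ V(1,3)] W by blast+
  define x y where "x = cut V X" and "y = cut V Y"
  have xy: "x \<in> VF V" "y \<in> VF V" using vXY cut_VF by (auto simp: x_def y_def)
  \<comment> \<open>The third argument is \<open>N\<close> of the first two, so that vanishing of
    \<open>tf\<close> means vanishing of its squared length.\<close>
  define z where "z = Nf V x y"
  have z: "z \<in> VF V" unfolding z_def by (intro K.T_closed xy)
  have t0: "tf V (?e b) (?e c) (?e d) p = 0" if "b \<in> Basis" "c \<in> Basis" "d \<in> Basis" for b c d
  proof -
    have "Nf V (?e b) (?e c) p = N (coord_vector U \<phi> b) (coord_vector U \<phi> c) p"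
      using Nf_eq[OF V(1) e e V(4)] N_cong[OF V(1,4) vfe vfe, of b "?e b" c "?e c"] by simp
    then show ?thesis using 0[OF that] V(4) by (simp add: K.t_def hf_def)
  qed
  have t1: "tf V (?e b) (?e c) Z p = 0" if "b \<in> Basis" "c \<in> Basis" "Z \<in> VF V" for b c Z
  proof -
    have "tf V (?e b) (?e c) Z p = tf V Z (?e b) (?e c) p"
      using K.t_cyclic[OF that(3) e e] by simp
    also have "\<dots> = (\<Sum>d\<in>Basis. Z p (\<lambda>q. \<phi> q \<bullet> d) * tf V (?e d) (?e b) (?e c) p)"
      by (rule tf_expand[OF c V(1,2) that(3) e e V(4)])
    also have "\<dots> = 0"
      using t0[OF that(1,2)] K.t_cyclic[OF e e e, of _ b c] by (intro sum.neutral) simp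
    finally show ?thesis .
  qed
  have t2: "tf V (?e b) Y Z p = 0" if "b \<in> Basis" "Y \<in> VF V" "Z \<in> VF V" for b Y Z
  proof -
    have "tf V (?e b) Y Z p = tf V Y Z (?e b) p"
      using K.t_cyclic[OF e that(2,3)] by simp
    also have "\<dots> = (\<Sum>c\<in>Basis. Y p (\<lambda>q. \<phi> q \<bullet> c) * tf V (?e c) Z (?e b) p)"
      by (rule tf_expand[OF c V(1,2) that(2,3) e V(4)])
    also have "\<dots> = 0"
    proof (rule sum.neutral, intro ballI)
      fix c :: 'e assume "c \<in> Basis"
      then have "tf V (?e b) (?e c) Z p = 0" using t1 that by blast
      moreover have "tf V (?e c) Z (?e b) = tf V (?e b) (?e c) Z"
        using K.t_cyclic[OF e e that(3), of b c] by simp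
      ultimately show "Y p (\<lambda>q. \<phi> q \<bullet> c) * tf V (?e c) Z (?e b) p = 0" by simp
    qed
    finally show ?thesis .
  qed
  have "tf V x y z p = 0"
    using tf_expand[OF c V(1,2) xy z V(4)] t2[OF _ xy(2) z] by simp
  then have "h p (z p) (z p) = 0"
    using V(4) by (simp add: K.t_def hf_def z_def)
  then have "z p = 0" using h_pos[OF pM VF_tangent[OF z V(4)]] by force
  then show "N X Y p = 0"
    using Nf_eq[OF V(1) xy V(4)] N_cong[OF V(1,4) vXY, of x y] by (simp add: z_def x_def y_def)
qed

section \<open>Propagation of the zeros of the Nijenhuis tensor\<close>

abbreviation frame :: "'a set \<Rightarrow> ('a \<Rightarrow> 'e) \<Rightarrow> 'e \<Rightarrow> 'a \<Rightarrow> 'a tvec" where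
  "frame U \<phi> b \<equiv> cut U (coord_vector U \<phi> b)"

lemma frame_VF: "(U, \<phi>) \<in> A \<Longrightarrow> frame U \<phi> b \<in> VF U"
  by (intro cut_VF vf_coord_vector)

lemma tf_frame:
  assumes c: "(U, \<phi>) \<in> A" and p: "p \<in> U"
  shows "tf U (frame U \<phi> b) (frame U \<phi> c) (frame U \<phi> d) p =
    h p (N (coord_vector U \<phi> b) (coord_vector U \<phi> c) p) (coord_vector U \<phi> d p)"
proof -
  note U = chart_openin[OF c]
  interpret K: nearly_kaehler_module "VF U" "FN U" "\<lambda>X f p. X p f" "hf U" "Jf U" "Df U"
    by (rule hermitian_module[OF U])
  have "Nf U (frame U \<phi> b) (frame U \<phi> c) p = N (coord_vector U \<phi> b) (coord_vector U \<phi> c) p"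
    using Nf_eq[OF U frame_VF[OF c] frame_VF[OF c] p]
      N_cong[OF U p vf_coord_vector[OF c] vf_coord_vector[OF c], of b "frame U \<phi> b" c "frame U \<phi> c"] by simp
  then show ?thesis using p by (simp add: K.t_def hf_def)
qed

text \<open>The \<open>\<Gamma>\<close> are the Christoffel symbols of the canonical connection in
  the coordinate frame, and the equation is \<open>torsion_parallel\<close> written in
  components.\<close>

lemma tf_frame_derivative:
  assumes c: "(U, \<phi>) \<in> A"
  defines "e \<equiv> frame U \<phi>"
  obtains \<Gamma> where "\<And>l b m. smooth U (\<Gamma> l b m)"
    and "\<And>l b c d p. p \<in> U \<Longrightarrow> e l p (tf U (e b) (e c) (e d)) =
      (\<Sum>m\<in>Basis. \<Gamma> l b m p * tf U (e m) (e c) (e d) p) + (\<Sum>m\<in>Basis. \<Gamma> l c m p * tf U (e b) (e m) (e d) p)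
      + (\<Sum>m\<in>Basis. \<Gamma> l d m p * tf U (e b) (e c) (e m) p)"
proof
  note U = chart_openin[OF c]
  interpret K: nearly_kaehler_module "VF U" "FN U" "\<lambda>X f p. X p f" "hf U" "Jf U" "Df U"
    by (rule hermitian_module[OF U])
  define \<Gamma> where "\<Gamma> l b m p = K.nab (e l) (e b) p (\<lambda>q. \<phi> q \<bullet> m)" for l b m p
  have e: "e b \<in> VF U" for b unfolding e_def by (rule frame_VF[OF c])
  have nab: "K.nab (e l) (e b) \<in> VF U" for l b by (rule K.nab_closed[OF e e])
  show "smooth U (\<Gamma> l b m)" for l b m
    unfolding \<Gamma>_def by (rule vf_smooth[OF VF_vf[OF nab] smooth_coord[OF c]]) simp
  fix l b c' d p assume p: "p \<in> U"
  have expand: "tf U (K.nab (e l) (e b)) (e c) (e d) p = (\<Sum>m\<in>Basis. \<Gamma> l b m p * tf U (e m) (e c) (e d) p)" for b c d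
    using tf_expand[OF c U subset_refl nab e e p] by (simp add: \<Gamma>_def e_def)
  have 1: "e l p (tf U (e b) (e c') (e d)) = tf U (K.nab (e l) (e b)) (e c') (e d) p
      + tf U (e b) (K.nab (e l) (e c')) (e d) p + tf U (e b) (e c') (K.nab (e l) (e d)) p"
    using fun_cong[OF K.torsion_parallel[OF e[of l] e[of b] e[of c'] e[of d]], of p] by simp
  \<comment> \<open>Facts 2 and 3 rotate the differentiated argument into the first slot, where
    \<open>expand\<close> applies; 4 and 5 rotate the resulting terms back.\<close>
  have 2: "tf U (e b) (K.nab (e l) (e c')) (e d) = tf U (K.nab (e l) (e c')) (e d) (e b)"
    by (rule K.t_cyclic[OF e nab e])
  have 3: "tf U (e b) (e c') (K.nab (e l) (e d)) = tf U (K.nab (e l) (e d)) (e b) (e c')"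
    by (rule K.t_cyclic[OF nab e e, symmetric])
  have 4: "tf U (e m) (e d) (e b) = tf U (e b) (e m) (e d)" for m
    by (rule K.t_cyclic[OF e e e, symmetric])
  have 5: "tf U (e m) (e b) (e c') = tf U (e b) (e c') (e m)" for m
    by (rule K.t_cyclic[OF e e e])
  show "e l p (tf U (e b) (e c') (e d)) =
      (\<Sum>m\<in>Basis. \<Gamma> l b m p * tf U (e m) (e c') (e d) p) + (\<Sum>m\<in>Basis. \<Gamma> l c' m p * tf U (e b) (e m) (e d) p)
      + (\<Sum>m\<in>Basis. \<Gamma> l d m p * tf U (e b) (e c') (e m) p)"
    unfolding 1 2 3 expand 4 5 ..
qed

text \<open>Along a straight segment of the chart the frame components of \<open>N\<close> solve a
  homogeneous linear system with continuous, hence bounded, coefficients, so zero initial values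
  propagate.\<close>

lemma nijenhuis_vanishes_along_segment:
  assumes c: "(U, \<phi>) \<in> A" and p: "p \<in> U" and q: "q \<in> U"
    and seg: "closed_segment (\<phi> p) (\<phi> q) \<subseteq> \<phi> ` U" and van: "nijenhuis_vanishes_at p"
  shows "nijenhuis_vanishes_at q"
proof -
  note U = chart_openin[OF c]
  interpret K: nearly_kaehler_module "VF U" "FN U" "\<lambda>X f p. X p f" "hf U" "Jf U" "Df U"
    by (rule hermitian_module[OF U])
  define e where "e = frame U \<phi>"
  have e: "e b \<in> VF U" for b unfolding e_def by (rule frame_VF[OF c])
  obtain \<Gamma> where \<Gamma>: "\<And>l b m. smooth U (\<Gamma> l b m)"
    and par: "\<And>l b c d p. p \<in> U \<Longrightarrow> e l p (tf U (e b) (e c) (e d)) =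
      (\<Sum>m\<in>Basis. \<Gamma> l b m p * tf U (e m) (e c) (e d) p) + (\<Sum>m\<in>Basis. \<Gamma> l c m p * tf U (e b) (e m) (e d) p)
      + (\<Sum>m\<in>Basis. \<Gamma> l d m p * tf U (e b) (e c) (e m) p)"
    using tf_frame_derivative[OF c] unfolding e_def by blast
  define v where "v = \<phi> q - \<phi> p"
  define \<gamma> where "\<gamma> s = \<phi> p + s *\<^sub>R v" for s
  define r where "r s = inv_into U \<phi> (\<gamma> s)" for s
  have \<gamma>: "\<gamma> s \<in> \<phi> ` U" if "0 \<le> s" "s \<le> 1" for s
    using seg that by (force simp: \<gamma>_def v_def closed_segment_def algebra_simps)
  have rU: "r s \<in> U" and \<phi>r: "\<phi> (r s) = \<gamma> s" if "0 \<le> s" "s \<le> 1" for s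
    using \<gamma>[OF that] by (simp_all add: r_def inv_into_into f_inv_into_f)
  define I where "I = (Basis \<times> Basis \<times> Basis :: ('e \<times> 'e \<times> 'e) set)"
  have I: "finite I" by (simp add: I_def)
  define T where "T = (\<lambda>(b, c, d). tf U (e b) (e c) (e d))"
  define y where "y i s = T i (r s)" for i s
  define y' where "y' i s = (\<Sum>l\<in>Basis. (v \<bullet> l) * e l (r s) (T i))" for i s
  have T: "T i \<in> FN U" for i
    unfolding T_def by (cases i) (simp add: K.t_def K.h_closed K.T_closed e)
  have smT: "smooth_on (\<phi> ` U) (\<lambda>x. T i (inv_into U \<phi> x))" for i
    using smoothD[OF _ c, of U "T i"] T by (simp add: FN_def)
  define S where "S s = (\<Sum>j\<in>I. \<bar>y j s\<bar>)" for s
  have S: "\<bar>y (b, c, d) s\<bar> \<le> S s" if "b \<in> Basis" "c \<in> Basis" "d \<in> Basis" for b c d s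
    unfolding S_def by (rule member_le_sum[OF _ _ I]) (use that in \<open>auto simp: I_def\<close>)
  \<comment> \<open>Summing over \<open>b\<close> as well makes one maximum on \<open>{0..1}\<close>
    a bound for the coefficients of every frame index.\<close>
  define G where "G s = (\<Sum>b\<in>Basis. \<Sum>l\<in>Basis. \<bar>v \<bullet> l\<bar> * (\<Sum>m\<in>Basis. \<bar>\<Gamma> l b m (r s)\<bar>))" for s
  have "continuous_on {0..1} G"
  proof -
    have "continuous_on {0..1} (\<lambda>s. \<Gamma> l b m (r s))" for l b m
    proof -
      have "continuous_on (\<phi> ` U) (\<lambda>x. \<Gamma> l b m (inv_into U \<phi> x))"
        using smoothD[OF \<Gamma> c] by (simp add: smooth_on_continuous_on)
      then show ?thesis
        unfolding r_def by (rule continuous_on_compose2) (auto simp: \<gamma>_def[abs_def] intro!: continuous_intros \<gamma>[unfolded \<gamma>_def])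
    qed
    then show ?thesis unfolding G_def by (intro continuous_intros)
  qed
  from compact_imp_bounded[OF compact_continuous_image[OF this compact_Icc]]
  obtain C where "\<forall>s\<in>{0..1}. \<bar>G s\<bar> \<le> C" by (auto simp: bounded_iff)
  then have C: "\<bar>G s\<bar> \<le> C" if "0 \<le> s" "s \<le> 1" for s using that by simp
  have G: "(\<Sum>l\<in>Basis. \<bar>v \<bullet> l\<bar> * (\<Sum>m\<in>Basis. \<bar>\<Gamma> l b m (r s)\<bar>)) \<le> C" if "0 \<le> s" "s \<le> 1" "b \<in> Basis" for b s
  proof -
    have "(\<Sum>l\<in>Basis. \<bar>v \<bullet> l\<bar> * (\<Sum>m\<in>Basis. \<bar>\<Gamma> l b m (r s)\<bar>)) \<le> G s"
      unfolding G_def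
      by (rule member_le_sum[OF that(3), where f = "\<lambda>b. \<Sum>l\<in>Basis. \<bar>v \<bullet> l\<bar> * (\<Sum>m\<in>Basis. \<bar>\<Gamma> l b m (r s)\<bar>)"])
        (auto intro!: sum_nonneg mult_nonneg_nonneg)
    then show ?thesis using C[OF that(1,2)] by linarith
  qed
  \<comment> \<open>The constant \<open>3 * C\<close> collects one \<open>C\<close> from each of the
    three frame indices of a component.\<close>
  have y0: "y i 1 = 0" if "i \<in> I" for i
  proof (rule linear_system_zero[OF I, of y y' "3 * C"])
    show "i \<in> I" by (rule that)
    show "y i 0 = 0" if "i \<in> I" for i
    proof -
      obtain b c' d where i: "i = (b, c', d)" by (cases i)
      have "r 0 = p" using chart_inv[OF c p] by (simp add: r_def \<gamma>_def)
      moreover have "N (coord_vector U \<phi> b) (coord_vector U \<phi> c') p = 0"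
        using van vf_coord_vector[OF c] p unfolding nijenhuis_vanishes_at_def by blast
      moreover have "p \<in> topspace M" using openin_subset[OF U] p by blast
      ultimately show ?thesis
        using tf_frame[OF c p] h_scale_at[of p 0 "coord_vector U \<phi> d p" 0] subspace_0[OF subspace_tangent]
          coord_vector_tangent[OF c p]
        by (simp add: y_def T_def i e_def)
    qed
    fix s :: real and i assume i: "i \<in> I" and s: "0 \<le> s" "s \<le> 1"
    let ?f = "\<lambda>x. T i (inv_into U \<phi> x)"
    let ?D = "frechet_derivative ?f (at (\<gamma> s))"
    have D: "(?f has_derivative ?D) (at (\<gamma> s))"
      by (rule smooth_on_has_derivative[OF smT \<gamma>[OF s]])
    have lin: "linear ?D" using D by (rule has_derivative_linear)
    have "(\<gamma> has_derivative (\<lambda>h. h *\<^sub>R v)) (at s)"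
      unfolding \<gamma>_def[abs_def]
      by (rule has_derivative_eq_rhs[OF has_derivative_add[OF has_derivative_const
            has_derivative_scaleR_left[OF has_derivative_ident]]]) simp
    from has_derivative_compose[OF this D] have "(y i has_derivative (\<lambda>h. ?D (h *\<^sub>R v))) (at s)"
      by (simp add: y_def[abs_def] r_def)
    moreover have "(\<lambda>h. ?D (h *\<^sub>R v)) = (*) (y' i s)"
    proof
      fix h
      \<comment> \<open>At \<open>r s\<close> the frame vector \<open>e l\<close> is by definition
        the partial derivative in direction \<open>l\<close>, so the chain rule along the segment
        yields \<open>y'\<close>.\<close>
      have "?D l = e l (r s) (T i)" for l
        using FN_near[OF T rU[OF s]] rU[OF s] \<phi>r[OF s] by (simp add: e_def coord_vector_def)
      moreover have "?D (\<Sum>l\<in>Basis. (v \<bullet> l) *\<^sub>R l) = (\<Sum>l\<in>Basis. (v \<bullet> l) * ?D l)"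
        using lin by (simp add: linear_sum linear_cmul)
      ultimately have "?D v = y' i s" by (simp add: y'_def euclidean_representation)
      then show "?D (h *\<^sub>R v) = y' i s * h" using lin by (simp add: linear_cmul)
    qed
    ultimately show "(y i has_real_derivative y' i s) (at s)"
      by (simp add: has_field_derivative_def)
    obtain b c' d where i': "i = (b, c', d)" and B: "b \<in> Basis" "c' \<in> Basis" "d \<in> Basis"
      using i by (auto simp: I_def)
    define g where "g l b = (\<Sum>m\<in>Basis. \<bar>\<Gamma> l b m (r s)\<bar>)" for l b
    have part: "\<bar>\<Sum>m\<in>Basis. \<Gamma> l b m (r s) * z m\<bar> \<le> g l b * S s" if "\<And>m. m \<in> Basis \<Longrightarrow> \<bar>z m\<bar> \<le> S s" for l b z
    proof -
      have "\<bar>\<Sum>m\<in>Basis. \<Gamma> l b m (r s) * z m\<bar> \<le> (\<Sum>m\<in>Basis. \<bar>\<Gamma> l b m (r s) * z m\<bar>)" by (rule sum_abs)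
      also have "\<dots> \<le> (\<Sum>m\<in>Basis. \<bar>\<Gamma> l b m (r s)\<bar> * S s)"
        using that by (intro sum_mono) (simp add: abs_mult mult_left_mono)
      finally show ?thesis by (simp add: g_def sum_distrib_right)
    qed
    have el: "\<bar>e l (r s) (T i)\<bar> \<le> (g l b + g l c' + g l d) * S s" for l
    proof -
      have "e l (r s) (T i) = (\<Sum>m\<in>Basis. \<Gamma> l b m (r s) * y (m, c', d) s) + (\<Sum>m\<in>Basis. \<Gamma> l c' m (r s) * y (b, m, d) s)
          + (\<Sum>m\<in>Basis. \<Gamma> l d m (r s) * y (b, c', m) s)"
        using par[OF rU[OF s]] by (simp add: T_def y_def i')
      then show ?thesis
        using part[of "\<lambda>m. y (m, c', d) s" l b] part[of "\<lambda>m. y (b, m, d) s" l c'] part[of "\<lambda>m. y (b, c', m) s" l d] S B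
        by (simp add: distrib_right)
    qed
    have S0: "0 \<le> S s" by (simp add: S_def sum_nonneg)
    have "\<bar>y' i s\<bar> \<le> (\<Sum>l\<in>Basis. \<bar>(v \<bullet> l) * e l (r s) (T i)\<bar>)" unfolding y'_def by (rule sum_abs)
    also have "\<dots> \<le> (\<Sum>l\<in>Basis. \<bar>v \<bullet> l\<bar> * ((g l b + g l c' + g l d) * S s))"
      using el by (intro sum_mono) (simp add: abs_mult mult_left_mono)
    also have "\<dots> = ((\<Sum>l\<in>Basis. \<bar>v \<bullet> l\<bar> * g l b) + (\<Sum>l\<in>Basis. \<bar>v \<bullet> l\<bar> * g l c') + (\<Sum>l\<in>Basis. \<bar>v \<bullet> l\<bar> * g l d)) * S s"
      by (simp add: sum_distrib_right distrib_left distrib_right sum.distrib mult.assoc)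
    also have "\<dots> \<le> (C + C + C) * S s"
      using G[OF s] B S0 unfolding g_def by (intro mult_right_mono add_mono) auto
    finally show "\<bar>y' i s\<bar> \<le> 3 * C * (\<Sum>j\<in>I. \<bar>y j s\<bar>)" by (simp add: S_def)
  qed
  have "r 1 = q" using chart_inv[OF c q] by (simp add: r_def \<gamma>_def v_def)
  then have "tf U (e b) (e c') (e d) q = 0" if "b \<in> Basis" "c' \<in> Basis" "d \<in> Basis" for b c' d
    using y0[of "(b, c', d)"] that by (simp add: y_def T_def I_def)
  then show ?thesis
    using tf_frame[OF c q] by (intro nijenhuis_vanishes_atI[OF c q]) (simp add: e_def)
qed

text \<open>Any two points over a ball in a chart are joined by a segment inside it, so vanishing of
  \<open>N\<close> is a locally constant property, and \<open>M\<close> is connected.\<close>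

lemma nijenhuis_vanishes_everywhere:
  assumes conn: "connected_space M" and p: "p \<in> topspace M" "nijenhuis_vanishes_at p" and q: "q \<in> topspace M"
  shows "nijenhuis_vanishes_at q"
proof -
  have loc: "\<exists>B. openin M B \<and> x \<in> B \<and> (\<forall>a\<in>B. \<forall>b\<in>B. nijenhuis_vanishes_at a \<longrightarrow> nijenhuis_vanishes_at b)"
    if x: "x \<in> topspace M" for x
  proof -
    obtain U \<phi> where c: "(U, \<phi>) \<in> A" and xU: "x \<in> U" using chart_at[OF x] .
    obtain r where r: "r > 0" "ball (\<phi> x) r \<subseteq> \<phi> ` U"
      using chart_open[OF c] xU open_contains_ball by blast
    let ?B = "{a \<in> U. \<phi> a \<in> ball (\<phi> x) r}"
    have "nijenhuis_vanishes_at b" if "a \<in> ?B" "b \<in> ?B" "nijenhuis_vanishes_at a" for a b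
    proof (rule nijenhuis_vanishes_along_segment[OF c _ _ _ that(3)])
      have "closed_segment (\<phi> a) (\<phi> b) \<subseteq> ball (\<phi> x) r"
        using that by (intro closed_segment_subset convex_ball) auto
      then show "closed_segment (\<phi> a) (\<phi> b) \<subseteq> \<phi> ` U" using r(2) by blast
    qed (use that in auto)
    then have "\<forall>a\<in>?B. \<forall>b\<in>?B. nijenhuis_vanishes_at a \<longrightarrow> nijenhuis_vanishes_at b" by blast
    moreover have "x \<in> ?B" using xU r(1) by simp
    ultimately show ?thesis
      using chart_preimage_open[OF c open_ball] by blast
  qed
  let ?S = "{a \<in> topspace M. nijenhuis_vanishes_at a}"
  \<comment> \<open>The local implication holds in both directions between points of
    \<open>B\<close>; the variable \<open>t\<close> treats the zero set and its complement
    together.\<close>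
  have op: "openin M {a \<in> topspace M. nijenhuis_vanishes_at a = t}" for t
  proof (rule openin_subopen[THEN iffD2], intro ballI)
    fix x assume x: "x \<in> {a \<in> topspace M. nijenhuis_vanishes_at a = t}"
    then obtain B where B: "openin M B" "x \<in> B"
      "\<forall>a\<in>B. \<forall>b\<in>B. nijenhuis_vanishes_at a \<longrightarrow> nijenhuis_vanishes_at b"
      using loc[of x] by auto
    then have "B \<subseteq> {a \<in> topspace M. nijenhuis_vanishes_at a = t}"
      using x openin_subset[OF B(1)] by blast
    then show "\<exists>T. openin M T \<and> x \<in> T \<and> T \<subseteq> {a \<in> topspace M. nijenhuis_vanishes_at a = t}"
      using B(1,2) by blast
  qed
  have "openin M ?S" using op[of True] by simp
  moreover have "topspace M - ?S = {a \<in> topspace M. nijenhuis_vanishes_at a = False}" by auto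
  then have "openin M (topspace M - ?S)" using op[of False] by simp
  ultimately have "?S = {} \<or> ?S = topspace M"
    using conn by (auto simp: connected_space_clopen_in closedin_def)
  then show ?thesis using p q by blast
qed

section \<open>Symplectic forms\<close>

text \<open>Otherwise \<open>u\<close> would extend the family to \<open>DIM('e) + 1\<close> nonzero
  orthogonal vectors; pairing a linear relation with a member of nonzero coefficient gives a
  contradiction.\<close>

lemma orthogonal_to_all:
  assumes p: "p \<in> topspace M" and a: "\<And>i. i < DIM('e) \<Longrightarrow> a i \<in> Tan p" "\<And>i. i < DIM('e) \<Longrightarrow> a i \<noteq> 0"
    and orth: "\<And>i j. i < DIM('e) \<Longrightarrow> j < i \<Longrightarrow> h p (a i) (a j) = 0"
    and u: "u \<in> Tan p" "\<And>i. i < DIM('e) \<Longrightarrow> h p u (a i) = 0"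
  shows "u = 0"
proof (rule ccontr)
  assume "u \<noteq> 0"
  \<comment> \<open>The candidate \<open>u\<close> is appended at index \<open>DIM('e)\<close>,
    matching the range of \<open>dependent_tangent_vectors\<close>.\<close>
  define b where "b i = (if i < DIM('e) then a i else u)" for i
  have b: "b i \<in> Tan p" "b i \<noteq> 0" for i using a u \<open>u \<noteq> 0\<close> by (simp_all add: b_def)
  have lower: "h p (b i) (b j) = 0" if "j < i" "i \<le> DIM('e)" for i j
    using that orth[of i j] u(2) by (auto simp: b_def)
  have orth': "h p (b i) (b j) = 0" if "i \<noteq> j" "i \<le> DIM('e)" "j \<le> DIM('e)" for i j
    using that lower[of i j] lower[of j i] h_commute[OF p b(1)[of i] b(1)[of j]] by linarith
  obtain c where c: "(\<Sum>i\<le>DIM('e). c i *\<^sub>R b i) = 0" and "\<exists>k\<le>DIM('e). c k \<noteq> 0"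
    by (rule dependent_tangent_vectors[OF p, of b]) (rule b(1))
  then obtain k where k: "k \<le> DIM('e)" "c k \<noteq> 0" by blast
  have "h p (b k) (\<Sum>i\<le>DIM('e). c i *\<^sub>R b i) = (\<Sum>i\<le>DIM('e). c i * h p (b k) (b i))"
    by (rule h_sum_right[OF p b(1) b(1)])
  also have "\<dots> = (\<Sum>i\<le>DIM('e). if i = k then c k * h p (b k) (b k) else 0)"
    using orth' k by (intro sum.cong) auto
  also have "\<dots> = c k * h p (b k) (b k)" using k by simp
  finally have "h p (b k) 0 = c k * h p (b k) (b k)" unfolding c .
  moreover have "h p (b k) 0 = 0"
    using h_sum_right[OF p b(1), where I = "{}"] by simp
  ultimately show False using k h_pos[OF p b] by (metis less_irrefl mult_eq_0_iff)
qed

section \<open>A compatible symplectic form\<close>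

context
  fixes U \<omega>
  assumes symplectic: "symplectic_form M A U \<omega>" and compatible: "compatible_on M A U J \<omega>"
begin

lemma U_topspace: "p \<in> U \<Longrightarrow> p \<in> topspace M"
  using compatible openin_subset
  by (auto simp: compatible_on_def riemannian_metric_def smooth_bilinear_field_def)

lemma \<omega>_lincomb:
  assumes "p \<in> U" "u \<in> Tan p" "v \<in> Tan p" "w \<in> Tan p"
  shows "\<omega> p (a *\<^sub>R u + b *\<^sub>R v) w = a * \<omega> p u w + b * \<omega> p v w"
    and "\<omega> p w (a *\<^sub>R u + b *\<^sub>R v) = a * \<omega> p w u + b * \<omega> p w v"
  using symplectic assms
  by (simp_all add: symplectic_form_def closed_two_form_def smooth_two_form_def smooth_bilinear_field_def tcomb_eq)

lemma \<omega>_diff: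
  assumes "p \<in> U" "u \<in> Tan p" "v \<in> Tan p" "w \<in> Tan p"
  shows "\<omega> p (u - v) w = \<omega> p u w - \<omega> p v w"
  using \<omega>_lincomb(1)[OF assms, of 1 "-1"] by simp

lemma \<omega>_scale:
  assumes "p \<in> U" "u \<in> Tan p" "w \<in> Tan p"
  shows "\<omega> p (a *\<^sub>R u) w = a * \<omega> p u w" "\<omega> p w (a *\<^sub>R u) = a * \<omega> p w u"
  using \<omega>_lincomb[of p u u w a 0] assms by simp_all

lemma \<omega>_skew:
  assumes "p \<in> U" "u \<in> Tan p" "v \<in> Tan p"
  shows "\<omega> p u v = - \<omega> p v u"
proof -
  have "\<omega> p w w = 0" if "w \<in> Tan p" for w
    using symplectic assms(1) that by (simp add: symplectic_form_def closed_two_form_def smooth_two_form_def)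
  moreover have "1 *\<^sub>R u + 1 *\<^sub>R v \<in> Tan p"
    using assms by (intro subspace_add[OF subspace_tangent] subspace_scale[OF subspace_tangent])
  moreover have "\<omega> p (1 *\<^sub>R u + 1 *\<^sub>R v) (1 *\<^sub>R u + 1 *\<^sub>R v) =
      \<omega> p u u + \<omega> p u v + (\<omega> p v u + \<omega> p v v)"
    using assms \<omega>_lincomb(1)[of p u v "1 *\<^sub>R u + 1 *\<^sub>R v" 1 1] \<omega>_lincomb(2)[of p u v _ 1 1] calculation(2) by simp
  ultimately show ?thesis using assms(2,3) by fastforce
qed

lemma \<omega>_J_pos: "p \<in> U \<Longrightarrow> v \<in> Tan p \<Longrightarrow> v \<noteq> 0 \<Longrightarrow> 0 < \<omega> p v (J p v)"
  using compatible by (simp add: compatible_on_def riemannian_metric_def tzero_eq)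

text \<open>Symmetry of the metric \<open>\<omega>(_, J _)\<close> combined with skewness of
  \<open>\<omega>\<close>; this is the statement that \<open>\<omega>\<close> has type
  (1,1).\<close>

lemma \<omega>_J_right:
  assumes "p \<in> U" "u \<in> Tan p" "v \<in> Tan p"
  shows "\<omega> p u (J p v) = - \<omega> p (J p u) v"
proof -
  have "\<omega> p u (J p v) = \<omega> p v (J p u)"
    using compatible assms by (simp add: compatible_on_def riemannian_metric_def)
  then show ?thesis
    using \<omega>_skew assms J_tangent U_topspace by metis
qed

lemma \<omega>_J_J:
  assumes "p \<in> U" "u \<in> Tan p" "v \<in> Tan p"
  shows "\<omega> p (J p u) (J p v) = \<omega> p u v"
  using \<omega>_J_right[OF assms(1) J_tangent[OF U_topspace[OF assms(1)] assms(2)] assms(3)]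
    J_J_tangent[OF U_topspace[OF assms(1)] assms(2)] \<omega>_scale(1)[OF assms, of "-1"] by simp

lemma \<omega>_smooth: "W \<subseteq> U \<Longrightarrow> vf W X \<Longrightarrow> vf W Y \<Longrightarrow> smooth W (\<lambda>p. \<omega> p (X p) (Y p))"
  using symplectic
  by (auto simp: symplectic_form_def closed_two_form_def smooth_two_form_def smooth_bilinear_field_def)

text \<open>The part of type \<open>(3,0) + (0,3)\<close> of \<open>d\<omega>\<close> is the cyclic sum of \<open>\<omega>(N(X,Y),Z)\<close>, because
  \<open>\<omega>\<close> is of type \<open>(1,1)\<close>.\<close>

lemma \<omega>_nijenhuis_cyclic:
  assumes W: "openin M W" "W \<subseteq> U" and XYZ: "X \<in> VF W" "Y \<in> VF W" "Z \<in> VF W" and p: "p \<in> W"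
  shows "\<omega> p (Nf W X Y p) (Z p) + \<omega> p (Nf W Y Z p) (X p) + \<omega> p (Nf W Z X p) (Y p) = 0"
proof -
  interpret K: nearly_kaehler_module "VF W" "FN W" "\<lambda>X f p. X p f" "hf W" "Jf W" "Df W"
    by (rule hermitian_module[OF W(1)])
  have pU: "p \<in> U" using W p by blast
  define br where "br X Y = Df W X Y - Df W Y X" for X Y
  have br: "br X Y \<in> VF W" if "X \<in> VF W" "Y \<in> VF W" for X Y
    unfolding br_def by (rule bracket_VF[OF W(1) that])
  have lb: "lie_bracket M A X Y p = br X Y p" if "X \<in> VF W" "Y \<in> VF W" for X Y
    using D_torsion[OF that[THEN VF_vf] p] p by (simp add: br_def Df_def)
  have Jp: "Jf W X p = J p (X p)" for X using p by (simp add: Jf_def)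
  have closed: "X p (\<lambda>q. \<omega> q (Y q) (Z q)) + Y p (\<lambda>q. \<omega> q (Z q) (X q)) + Z p (\<lambda>q. \<omega> q (X q) (Y q))
      - \<omega> p (br X Y p) (Z p) - \<omega> p (br Y Z p) (X p) - \<omega> p (br Z X p) (Y p) = 0"
    if "X \<in> VF W" "Y \<in> VF W" "Z \<in> VF W" for X Y Z
  proof -
    have "ext_deriv M A \<omega> X Y Z p = 0"
      using symplectic W(2) that[THEN VF_vf] p unfolding symplectic_form_def closed_two_form_def by blast
    then show ?thesis using that by (simp add: ext_deriv_def lb)
  qed
  have d1: "X p (\<lambda>q. \<omega> q (Jf W Y q) (Jf W Z q)) = X p (\<lambda>q. \<omega> q (Y q) (Z q))"
    if "X \<in> VF W" "Y \<in> VF W" "Z \<in> VF W" for X Y Z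
  proof (rule tangent_cong[OF VF_tangent[OF that(1) p] W(1) p])
    fix q assume q: "q \<in> W"
    then show "\<omega> q (Jf W Y q) (Jf W Z q) = \<omega> q (Y q) (Z q)"
      using \<omega>_J_J[of q "Y q" "Z q"] VF_tangent[OF that(2) q] VF_tangent[OF that(3) q] W(2) by (auto simp: Jf_def)
  qed
  have d2: "X p (\<lambda>q. \<omega> q (Y q) (Jf W Z q)) = - X p (\<lambda>q. \<omega> q (Jf W Y q) (Z q))"
    if "X \<in> VF W" "Y \<in> VF W" "Z \<in> VF W" for X Y Z
  proof -
    have "X p (\<lambda>q. \<omega> q (Y q) (Jf W Z q)) = X p (\<lambda>q. - 1 * \<omega> q (Jf W Y q) (Z q))"
    proof (rule tangent_cong[OF VF_tangent[OF that(1) p] W(1) p])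
      fix q assume q: "q \<in> W"
      then show "\<omega> q (Y q) (Jf W Z q) = - 1 * \<omega> q (Jf W Y q) (Z q)"
        using \<omega>_J_right[of q "Y q" "Z q"] VF_tangent[OF that(2) q] VF_tangent[OF that(3) q] W(2) by (auto simp: Jf_def)
    qed
    also have "\<dots> = - 1 * X p (\<lambda>q. \<omega> q (Jf W Y q) (Z q))"
      by (rule tangent_scale[OF VF_tangent[OF that(1) p]
            nearI[OF \<omega>_smooth[OF W(2) VF_vf[OF K.J_closed[OF that(2)]] VF_vf[OF that(3)]] p]])
    finally show ?thesis by simp
  qed
  have N4: "4 * \<omega> p (Nf W X Y p) (Z p) = \<omega> p (br (Jf W X) (Jf W Y) p) (Z p) + \<omega> p (br (Jf W X) Y p) (J p (Z p))
      + \<omega> p (br X (Jf W Y) p) (J p (Z p)) - \<omega> p (br X Y p) (Z p)"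
    if XYZ: "X \<in> VF W" "Y \<in> VF W" "Z \<in> VF W" for X Y Z
  proof -
    note tan = VF_tangent[OF _ p]
    have b: "br X Y p \<in> Tan p" "br (Jf W X) Y p \<in> Tan p" "br X (Jf W Y) p \<in> Tan p" "br (Jf W X) (Jf W Y) p \<in> Tan p"
      and Z: "Z p \<in> Tan p"
      using XYZ by (intro tan br K.J_closed; simp)+
    note Jb = b(2,3)[THEN J_tangent[OF U_topspace[OF pU]]]
    note dd = subspace_diff[OF subspace_tangent]
    have "4 *\<^sub>R Nf W X Y p = br (Jf W X) (Jf W Y) p - J p (br (Jf W X) Y p) - J p (br X (Jf W Y) p) - br X Y p"
      using fun_cong[OF K.nijenhuis_eq[OF XYZ(1,2)], of p] by (simp add: Jp flip: br_def)
    then have "\<omega> p (4 *\<^sub>R Nf W X Y p) (Z p) = \<omega> p (br (Jf W X) (Jf W Y) p - J p (br (Jf W X) Y p) - J p (br X (Jf W Y) p) - br X Y p) (Z p)"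
      by simp
    also have "\<dots> = \<omega> p (br (Jf W X) (Jf W Y) p) (Z p) - \<omega> p (J p (br (Jf W X) Y p)) (Z p)
        - \<omega> p (J p (br X (Jf W Y) p)) (Z p) - \<omega> p (br X Y p) (Z p)"
      using b Jb Z by (simp add: \<omega>_diff[OF pU] dd)
    finally show ?thesis
      using \<omega>_scale(1)[OF pU tan[OF K.T_closed[OF XYZ(1,2)]] Z, of 4] \<omega>_J_right[OF pU b(2) Z] \<omega>_J_right[OF pU b(3) Z] by simp
  qed
  note J = XYZ[THEN K.J_closed]
  \<comment> \<open>Closedness is used for \<open>(X,Y,Z)\<close> minus its three variants with
    \<open>J\<close> on two arguments. By \<open>d1\<close> and \<open>d2\<close> all derivative
    terms cancel, and by \<open>N4\<close> the bracket terms add up to four times the cyclic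
    sum.\<close>
  show ?thesis
    using closed[OF XYZ] closed[OF J(1,2) XYZ(3)] closed[OF J(1) XYZ(2) J(3)] closed[OF XYZ(1) J(2,3)]
      N4[OF XYZ] N4[OF XYZ(2,3,1)] N4[OF XYZ(3,1,2)]
      d1[OF XYZ] d1[OF XYZ(2,3,1)] d1[OF XYZ(3,1,2)]
      d2[OF J(1) XYZ(2,3)] d2[OF J(2) XYZ(3,1)] d2[OF J(3) XYZ(1,2)]
    by (simp add: Jp)
qed

end

text \<open>Orthogonality of \<open>J\<close> completes the six given relations to the fifteen that
  make \<open>x, Jx, y, Jy, z, Jz\<close> an orthogonal family, and six nonzero orthogonal vectors
  leave no room in dimension six.\<close>

lemma hermitian_frame_spans:
  assumes dim: "DIM('e) = 6" and p: "p \<in> topspace M" and T: "x \<in> Tan p" "y \<in> Tan p" "z \<in> Tan p"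
    and nz: "x \<noteq> 0" "y \<noteq> 0" "z \<noteq> 0"
    and orth: "h p x y = 0" "h p (J p x) y = 0" "h p x z = 0" "h p (J p x) z = 0" "h p y z = 0" "h p (J p y) z = 0"
    and u: "u \<in> Tan p" "h p u x = 0" "h p u (J p x) = 0" "h p u y = 0" "h p u (J p y) = 0"
      "h p u z = 0" "h p u (J p z) = 0"
  shows "u = 0"
proof -
  define a where "a i = [x, J p x, y, J p y, z, J p z] ! i" for i
  note JT = T[THEN J_tangent[OF p]]
  have Jnz: "J p v \<noteq> 0" if "v \<in> Tan p" "v \<noteq> 0" for v
    using h_pos[OF p that] h_JJ[OF p that(1) that(1)] h_zero_at[OF p] subspace_0[OF subspace_tangent] by force
  have J1: "h p v (J p w) = - h p (J p v) w" if "v \<in> Tan p" "w \<in> Tan p" for v w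
    using h_JJ[OF p J_tangent[OF p that(1)] that(2)] J_J_tangent[OF p that(1)]
      h_scale_at[OF p that(1) J_tangent[OF p that(2)], of "-1"] by simp
  have J2: "h p (J p v) v = 0" if "v \<in> Tan p" for v
    using J1[OF that that] h_commute[OF p that J_tangent[OF p that]] by simp
  have F: "h p x (J p x) = 0" "h p y (J p y) = 0" "h p z (J p z) = 0"
    "h p x (J p y) = 0" "h p x (J p z) = 0" "h p y (J p z) = 0"
    "h p (J p x) (J p y) = 0" "h p (J p x) (J p z) = 0" "h p (J p y) (J p z) = 0"
    using J1[OF T(1) T(1)] J1[OF T(2) T(2)] J1[OF T(3) T(3)] J1[OF T(1) T(2)] J1[OF T(1) T(3)] J1[OF T(2) T(3)]
      J2[OF T(1)] J2[OF T(2)] J2[OF T(3)] h_JJ[OF p T(1) T(2)] h_JJ[OF p T(1) T(3)] h_JJ[OF p T(2) T(3)] orth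
    by linarith+
  note F = F orth
  have six: "i < 6 \<longleftrightarrow> i = 0 \<or> i = 1 \<or> i = 2 \<or> i = 3 \<or> i = 4 \<or> i = 5" for i :: nat by arith
  show ?thesis
  proof (rule orthogonal_to_all[OF p, of a])
    fix i j assume "i < DIM('e)" "j < i"
    then have ij: "i < 6" "j < 6" "j < i" using dim by simp_all
    then have "a i \<in> Tan p" "a j \<in> Tan p"
      using T JT unfolding six by (auto simp: a_def)
    then have "h p (a i) (a j) = h p (a j) (a i)" by (rule h_commute[OF p])
    moreover have "h p (a j) (a i) = 0"
      using ij unfolding six by (elim disjE) (simp_all add: a_def F)
    ultimately show "h p (a i) (a j) = 0" by simp
  qed (use dim T JT nz Jnz u in \<open>auto simp: a_def six\<close>)
qed

text \<open>With \<open>Z = J N(X,Y)\<close>, the vector \<open>N(Y,Z)\<close> is orthogonal to the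
  complex lines of \<open>Y\<close> and \<open>Z\<close>, and to \<open>X\<close> because
  \<open>h (N(Y,Z)) X = h (N(X,Y)) Z = 0\<close>. Only the direction \<open>JX\<close>
  remains.\<close>

lemma nijenhuis_third_vector:
  assumes dim: "DIM('e) = 6" and W: "openin M W" "p \<in> W" and XY: "X \<in> VF W" "Y \<in> VF W"
    and nz: "X p \<noteq> 0" "Y p \<noteq> 0" "Nf W X Y p \<noteq> 0"
    and orth: "hf W X Y p = 0" "hf W (Jf W X) Y p = 0"
  shows "Nf W Y (Jf W (Nf W X Y)) p = - (hf W (Nf W X Y) (Nf W X Y) p / hf W X X p) *\<^sub>R J p (X p)"
proof -
  interpret K: nearly_kaehler_module "VF W" "FN W" "\<lambda>X f p. X p f" "hf W" "Jf W" "Df W"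
    by (rule hermitian_module[OF W(1)])
  note cl = K.closed K.T_closed
  have pM: "p \<in> topspace M" using openin_subset[OF W(1)] W(2) by blast
  have hf: "h p (V p) (V' p) = hf W V V' p" for V V' using W(2) by (simp add: hf_def)
  have Jp: "J p (V p) = Jf W V p" for V using W(2) by (simp add: Jf_def)
  define n where "n = Nf W X Y"
  define Z where "Z = Jf W n"
  have n: "n \<in> VF W" unfolding n_def using XY by (intro cl)
  then have Z: "Z \<in> VF W" unfolding Z_def by (intro cl)
  \<comment> \<open>The factor is found by pairing with \<open>JX\<close>: total skewness and
    antilinearity give \<open>h (N(Y,Z)) (JX) = - h n n\<close>, while
    \<open>h (JX) (JX) = h X X\<close>.\<close>
  define \<beta> where "\<beta> = hf W n n p / hf W X X p"
  have "hf W X X p > 0"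
    using h_pos[OF pM VF_tangent[OF XY(1) W(2)] nz(1)] by (simp add: hf)
  then have \<beta>: "\<beta> * hf W X X p = hf W n n p" by (simp add: \<beta>_def)
  define u where "u = Nf W Y Z + \<beta> *\<^sub>R Jf W X"
  have u: "u \<in> VF W" unfolding u_def using XY Z by (intro cl)
  have JZ: "Jf W Z = - n" using n by (simp add: Z_def K.J_J)
  have hn: "hf W n X = 0" "hf W n Y = 0" "hf W n (Jf W X) = 0" "hf W n (Jf W Y) = 0"
    unfolding n_def by (rule K.h_T_orthogonal[OF XY])+
  have hZ: "hf W V Z p = - hf W n (Jf W V) p" if "V \<in> VF W" for V
    using K.h_J[OF n that] K.h_sym[OF that Z] by (simp add: Z_def)
  have t1: "hf W (Nf W Y Z) X = 0"
    using K.t_cyclic[OF XY Z] K.h_self_J[OF n] K.t_cyclic[OF XY(2) Z XY(1)] K.t_cyclic[OF Z XY]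
    by (simp add: K.t_def n_def Z_def)
  have t2: "hf W (Nf W Y Z) (Jf W X) p = - hf W n n p"
    using K.t_cyclic[OF K.J_closed[OF XY(1)] XY(2) Z] K.T_J(2)[OF XY] K.h_J_J[OF n n] K.h_minus[OF K.J_closed[OF n] Z]
    by (simp add: K.t_def n_def Z_def)
  have hu: "hf W u V p = hf W (Nf W Y Z) V p + \<beta> * hf W (Jf W X) V p" if "V \<in> VF W" for V
    using that XY Z by (simp add: u_def K.h_add K.h_scale cl)
  note TYZ = K.h_T_orthogonal[OF XY(2) Z]
  have hJX: "hf W (Jf W X) X p = 0" "hf W (Jf W X) (Jf W X) p = hf W X X p"
     "hf W (Jf W X) (Jf W Y) p = 0" "hf W (Jf W X) Z p = 0" "hf W (Jf W X) (Jf W Z) p = 0"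
    using K.h_self_J[OF XY(1)] K.h_sym[OF XY(1) K.J_closed[OF XY(1)]] K.h_J_J XY orth hZ[OF K.J_closed[OF XY(1)]]
      hZ[OF XY(1)] hn Z
    by (simp_all add: K.J_J K.h_minus_right n)
  have "u p = 0"
  proof (rule hermitian_frame_spans[OF dim pM])
    show "X p \<in> Tan p" "Y p \<in> Tan p" "Z p \<in> Tan p" "u p \<in> Tan p"
      using XY Z u by (simp_all add: VF_tangent[OF _ W(2)])
    show "X p \<noteq> 0" "Y p \<noteq> 0" by (fact nz)+
    show "Z p \<noteq> 0"
    proof
      assume "Z p = 0"
      then have "hf W Z Z p = 0" using h_zero_at[OF pM VF_tangent[OF Z W(2)]] by (simp flip: hf)
      then have "hf W n n p = 0" using fun_cong[OF K.h_J_J[OF n n], of p] by (simp add: Z_def)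
      then show False using h_pos[OF pM VF_tangent[OF n W(2)]] nz(3) by (simp add: hf n_def)
    qed
    show "h p (X p) (Y p) = 0" "h p (J p (X p)) (Y p) = 0" unfolding hf Jp by (fact orth)+
    show "h p (X p) (Z p) = 0" "h p (Y p) (Z p) = 0" "h p (J p (X p)) (Z p) = 0" "h p (J p (Y p)) (Z p) = 0"
      unfolding hf Jp using hZ XY hn n by (simp_all add: K.J_closed K.J_J K.h_minus_right)
    show "h p (u p) (X p) = 0" "h p (u p) (J p (X p)) = 0" "h p (u p) (Y p) = 0" "h p (u p) (J p (Y p)) = 0"
      "h p (u p) (Z p) = 0" "h p (u p) (J p (Z p)) = 0"
      unfolding hf Jp using XY Z t1 t2 TYZ hJX \<beta> orth by (simp_all add: hu K.J_closed)
  qed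
  then show ?thesis
    using W(2) by (simp add: u_def Z_def n_def \<beta>_def Jp eq_neg_iff_add_eq_0)
qed

lemma nijenhuis_vanishes_symplectic:
  assumes dim: "DIM('e) = 6" and symplectic: "symplectic_form M A U \<omega>"
    and compatible: "compatible_on M A U J \<omega>" and p: "p \<in> U"
  shows "nijenhuis_vanishes_at p"
  unfolding nijenhuis_vanishes_at_def
proof (intro allI impI)
  fix W0 X0 Y0 assume 0: "vf W0 X0 \<and> vf W0 Y0 \<and> p \<in> W0"
  have "openin M U" using compatible
    by (simp add: compatible_on_def riemannian_metric_def smooth_bilinear_field_def)
  define W where "W = W0 \<inter> U"
  have W: "openin M W" "W \<subseteq> U" "W \<subseteq> W0" "p \<in> W"
    using 0 p \<open>openin M U\<close> vf_openin by (auto simp: W_def)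
  have pM: "p \<in> topspace M" using openin_subset[OF W(1)] W(4) by blast
  interpret K: nearly_kaehler_module "VF W" "FN W" "\<lambda>X f p. X p f" "hf W" "Jf W" "Df W"
    by (rule hermitian_module[OF W(1)])
  have vf0: "vf W X0" "vf W Y0" using 0 vf_subset[OF _ W(1,3)] by blast+
  define X Y where "X = cut W X0" and "Y = cut W Y0"
  have XY: "X \<in> VF W" "Y \<in> VF W" using vf0 cut_VF by (auto simp: X_def Y_def)
  note tan = VF_tangent[OF _ W(4)]
  have hf: "hf W V V' p = h p (V p) (V' p)" for V V' using W(4) by (simp add: hf_def)
  have Jp: "Jf W V p = J p (V p)" for V using W(4) by (simp add: Jf_def)
  have pos: "hf W V V p > 0" if "V \<in> VF W" "V p \<noteq> 0" for V
    using h_pos[OF pM tan[OF that(1)] that(2)] by (simp add: hf)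
  have "Nf W X Y p = 0"
  proof (rule ccontr)
    assume nz: "Nf W X Y p \<noteq> 0"
    \<comment> \<open>Tensoriality in the first slot, obtained by pairing with
      \<open>N(V,V')\<close> itself: a cyclic shift moves \<open>V\<close> into the metric, so the
      squared length of \<open>N(V,V')\<close> vanishes at \<open>p\<close> when \<open>V\<close>
      does.\<close>
    have left0: "V p \<noteq> 0" if "V \<in> VF W" "V' \<in> VF W" "Nf W V V' p \<noteq> 0" for V V'
    proof
      assume "V p = 0"
      then have "hf W (Nf W V' (Nf W V V')) V p = 0"
        using h_zero_at(1)[OF pM tan[OF K.T_closed[OF that(2) K.T_closed[OF that(1,2)]]]] by (simp add: hf)
      then have "hf W (Nf W V V') (Nf W V V') p = 0"
        using fun_cong[OF K.t_cyclic[OF that(1,2) K.T_closed[OF that(1,2)]], of p] by (simp add: K.t_def)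
      then show False using pos[OF K.T_closed[OF that(1,2)] that(3)] by simp
    qed
    have Xp: "X p \<noteq> 0" using left0[OF XY nz] .
    define \<alpha> where "\<alpha> = hf W X X p"
    have \<alpha>: "\<alpha> > 0" using pos[OF XY(1) Xp] by (simp add: \<alpha>_def)
    \<comment> \<open>Removes from \<open>Y\<close> its components along \<open>X\<close> and
      \<open>JX\<close> at \<open>p\<close>. The coefficients are constants, and
      \<open>N(X,Y)\<close> is unchanged because \<open>N(X,X)\<close> and \<open>N(X,JX)\<close>
      vanish.\<close>
    define Y' where "Y' = Y - ((hf W X Y p / \<alpha>) *\<^sub>R X + (hf W (Jf W X) Y p / \<alpha>) *\<^sub>R Jf W X)"
    note cl = K.closed K.T_closed
    have Y': "Y' \<in> VF W" unfolding Y'_def using XY by (intro cl)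
    have "Nf W X Y' = Nf W X Y"
      unfolding Y'_def using XY
      by (simp add: K.T_diff K.T_add K.T_scale K.T_self K.T_self_J cl)
    then have nz': "Nf W X Y' p \<noteq> 0" using nz by simp
    then have nz'': "Nf W Y' X p \<noteq> 0" using K.T_skew[OF XY(1) Y'] by simp
    have Y'p: "Y' p \<noteq> 0" using left0[OF Y' XY(1) nz''] .
    have JX: "hf W (Jf W X) X = 0" "hf W X (Jf W X) = 0" "hf W (Jf W X) (Jf W X) = hf W X X"
      using K.h_self_J[OF XY(1)] K.h_sym[OF XY(1) K.J_closed[OF XY(1)]] K.h_J_J[OF XY(1) XY(1)] by simp_all
    have orth: "hf W X Y' p = 0" "hf W (Jf W X) Y' p = 0"
      using \<alpha> XY unfolding Y'_def by (simp_all add: K.linear cl JX) (simp_all add: \<alpha>_def)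
    have orth': "hf W Y' X p = 0" "hf W (Jf W Y') X p = 0"
      using orth K.h_sym[OF Y' XY(1)] K.h_J[OF Y' XY(1)] K.h_sym[OF Y' K.J_closed[OF XY(1)]] by simp_all
    define n where "n = Nf W X Y'"
    define Z where "Z = Jf W n"
    have n: "n \<in> VF W" unfolding n_def by (intro cl XY Y')
    have Z: "Z \<in> VF W" unfolding Z_def by (intro cl n)
    define c d where "c = hf W n n p / hf W X X p" and "d = hf W n n p / hf W Y' Y' p"
    have cd: "c > 0" "d > 0"
      using pos[OF XY(1) Xp] pos[OF Y' Y'p] pos[OF n] nz' by (simp_all add: c_def d_def n_def)
    have 1: "Nf W Y' Z p = - c *\<^sub>R J p (X p)"
      unfolding Z_def n_def c_def by (rule nijenhuis_third_vector[OF dim W(1,4) XY(1) Y' Xp Y'p nz' orth])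
    have n': "Nf W Y' X = - n" using K.T_skew[OF XY(1) Y'] by (simp add: n_def)
    \<comment> \<open>The previous step with \<open>X\<close> and \<open>Y'\<close> exchanged: this
      turns \<open>n\<close> into \<open>- n\<close>, hence \<open>Z\<close> into
      \<open>- Z\<close>, and skewness then converts \<open>N(X,-Z)\<close> into
      \<open>N(Z,X)\<close>.\<close>
    have "Nf W X (- Z) p = - d *\<^sub>R J p (Y' p)"
      using nijenhuis_third_vector[OF dim W(1,4) Y' XY(1) Y'p Xp nz'' orth'] n
      by (simp add: n' K.J_minus K.h_minus K.h_minus_right cl d_def flip: Z_def)
    then have 2: "Nf W Z X p = - d *\<^sub>R J p (Y' p)"
      using K.T_skew[OF XY(1) Z] XY Z by (simp add: K.T_minus)
    \<comment> \<open>This turns the negative multiples of \<open>JX\<close> and \<open>JY'\<close>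
      into positive multiples of \<open>\<omega>(X,JX)\<close> and
      \<open>\<omega>(Y',JY')\<close>.\<close>
    have w: "\<omega> p (- a *\<^sub>R J p (V p)) (V p) = a * \<omega> p (V p) (J p (V p))" if "V \<in> VF W" for a V
      using \<omega>_scale(1)[OF symplectic compatible p J_tangent[OF pM tan[OF that]] tan[OF that], of "- a"]
        \<omega>_J_right[OF symplectic compatible p tan[OF that] tan[OF that]] by simp
    have "\<omega> p (n p) (J p (n p)) + c * \<omega> p (X p) (J p (X p)) + d * \<omega> p (Y' p) (J p (Y' p)) = 0"
      using \<omega>_nijenhuis_cyclic[OF symplectic compatible W(1,2) XY(1) Y' Z W(4)] w[OF XY(1), of c] w[OF Y', of d]
      by (simp add: 1 2 flip: n_def) (simp add: Z_def Jp)
    moreover have g: "\<omega> p (V p) (J p (V p)) > 0" if "V \<in> VF W" "V p \<noteq> 0" for V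
      by (rule \<omega>_J_pos[OF symplectic compatible p tan[OF that(1)] that(2)])
    have "\<omega> p (n p) (J p (n p)) > 0" using g[OF n] nz' by (simp add: n_def)
    then have "\<omega> p (n p) (J p (n p)) + c * \<omega> p (X p) (J p (X p)) + d * \<omega> p (Y' p) (J p (Y' p)) > 0"
      using cd g[OF XY(1) Xp] g[OF Y' Y'p] by (intro add_pos_pos mult_pos_pos)
    ultimately show False by simp
  qed
  then show "N X0 Y0 p = 0"
    using Nf_eq[OF W(1) XY W(4)] N_cong[OF W(1,4) vf0, of X Y] by (simp add: X_def Y_def)
qed

end

theorem theorem3p1:
  fixes M :: "'a topology" and A :: "('a, real ^ 6) atlas"
    and h :: "'a \<Rightarrow> 'a tvec \<Rightarrow> 'a tvec \<Rightarrow> real" and J :: "'a \<Rightarrow> 'a tvec \<Rightarrow> 'a tvec"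
    and U :: "'a set"
  assumes "smooth_manifold M A" and "connected_space M"
    and "nearly_kaehler M A h J" and "\<not> integrable_acs M A J"
    and "openin M U" and "U \<noteq> {}"
  shows "\<not> (\<exists>\<omega>. symplectic_form M A U \<omega> \<and> compatible_on M A U J \<omega>)"
proof
  assume "\<exists>\<omega>. symplectic_form M A U \<omega> \<and> compatible_on M A U J \<omega>"
  then obtain \<omega> where \<omega>: "symplectic_form M A U \<omega>" "compatible_on M A U J \<omega>" by blast
  obtain D where D: "levi_civita M A h D"
    "\<And>W X Y Z p. \<lbrakk>smooth_vector_field M A W X; smooth_vector_field M A W Y; smooth_vector_field M A W Z; p \<in> W\<rbrakk> \<Longrightarrow>
      cov_deriv D (fundamental_form h J) X Y Z p = (1/3) * ext_deriv M A (fundamental_form h J) X Y Z p"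
    using assms(3) unfolding nearly_kaehler_def by blast
  interpret nearly_kaehler_manifold M A h J D
    by unfold_locales (use assms D in \<open>simp_all add: nearly_kaehler_def\<close>)
  obtain p where p: "p \<in> U" using assms(6) by blast
  have "nijenhuis_vanishes_at p"
    by (rule nijenhuis_vanishes_symplectic[OF _ \<omega> p]) simp
  then have van: "nijenhuis_vanishes_at q" if "q \<in> topspace M" for q
    using nijenhuis_vanishes_everywhere[OF assms(2)] openin_subset[OF assms(5)] p that by blast
  have "integrable_acs M A J"
    unfolding integrable_acs_def tzero_eq
    using van vf_openin openin_subset unfolding nijenhuis_vanishes_at_def by blast
  then show False using assms(4) by blast
qed

end
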